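(* The assignments - on objects: $(M,\omega)\mapsto\big(\dots\to\mathrm{Cone}(\omega^{p+1})\xrightarrow{q}\mathrm{Cone}(\omega^p)\to\dots\to\mathrm{Cone}(\omega)\big)$, and - on morphisms: $f\mapsto f^*_{\mathrm{Cone}}$ define a functor $$\underline{\mathsf{Symp}}^{\mathrm{op}}\to\mathrm{Fun}(\mathbb Z_{\ge0}^{\mathrm{op}},\underline{\mathsf{cdga}}).$$
   Context: $\underline{\mathsf{Symp}}$ is the category whose objects are symplectic manifolds $(M,\omega)$ and whose morphisms $(M,\omega)\to(M',\omega')$ are smooth maps $f:M\to M'$ with $f^*\omega'=\omega$. $\underline{\mathsf{cdga}}$ is the category of commutative differential graded algebras over $\mathbb R$ and cdga maps. $\mathbb Z_{\ge0}$ is the usual poset viewed as a category; $\mathrm{Fun}$ is the functor category with natural transformations as morphisms. For $p\ge0$, $\mathrm{Cone}(\omega^{p+1})$ is the cdga obtained from the de Rham algebra $\Omega^\bullet(M)$ by freely adjoining a variable $\theta$ of degree $2p+1$ with $d\theta=\omega^{p+1}$: in degree $k$ it is $\Omega^k(M)\oplus\theta\,\Omega^{k-2p-1}(M)$, with $d(\eta+\theta\xi)=(d\eta+\omega^{p+1}\wedge\xi)-\theta\,d\xi$ and product $(\alpha+\theta\alpha')(\beta+\theta\beta')=\alpha\wedge\beta+\theta(\alpha'\wedge\beta+(-1)^{|\alpha|}\alpha\wedge\beta')$. The functor associated to $(M,\omega)$ sends $p\in\mathbb Z_{\ge0}$ to $\mathrm{Cone}(\omega^{p+1})$, with structure maps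 generated by $q:\mathrm{Cone}(\omega^{p+1})\to\mathrm{Cone}(\omega^p)$, $q(\alpha\oplus\theta\beta)=\alpha\oplus\theta(\beta\wedge\omega)$ (with $\theta$ of degree $2p+1$ on the source and $2p-1$ on the target). For a morphism $f$, $f^*_{\mathrm{Cone}}:\mathrm{Cone}(\omega'^{p+1})\to\mathrm{Cone}(\omega^{p+1})$ is $\alpha\oplus\theta'\beta\mapsto f^*\alpha\oplus\theta f^*\beta$, for every $p\ge0$, where $\theta'$ and $\theta$ are the adjoined variables. *)

theory Defs
  imports "HOL-Analysis.Analysis" "HOL-Algebra.Module"
begin

section \<open>Categories and functors\<close>

text \<open>Hom-sets are indexed by source and target and need not be disjoint, so identities,
  composition and the morphism part of a functor carry the objects as arguments:
  \<open>Comp C a b c g f\<close> is the composite of \<open>f : a \<rightarrow> b\<close> and \<open>g : b \<rightarrow> c\<close>.\<close>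

record ('o, 'm) category =
  Obj :: "'o set"
  Hom :: "'o \<Rightarrow> 'o \<Rightarrow> 'm set"
  Idn :: "'o \<Rightarrow> 'm"
  Comp :: "'o \<Rightarrow> 'o \<Rightarrow> 'o \<Rightarrow> 'm \<Rightarrow> 'm \<Rightarrow> 'm"

locale is_category =
  fixes C :: "('o, 'm) category"
  assumes Idn_in: "a \<in> Obj C \<Longrightarrow> Idn C a \<in> Hom C a a"
    and Comp_in: "\<lbrakk>a \<in> Obj C; b \<in> Obj C; c \<in> Obj C; f \<in> Hom C a b; g \<in> Hom C b c\<rbrakk>
      \<Longrightarrow> Comp C a b c g f \<in> Hom C a c"
    and Comp_Idn_right: "\<lbrakk>a \<in> Obj C; b \<in> Obj C; f \<in> Hom C a b\<rbrakk> \<Longrightarrow> Comp C a a b f (Idn C a) = f"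
    and Comp_Idn_left: "\<lbrakk>a \<in> Obj C; b \<in> Obj C; f \<in> Hom C a b\<rbrakk> \<Longrightarrow> Comp C a b b (Idn C b) f = f"
    and Comp_assoc: "\<lbrakk>a \<in> Obj C; b \<in> Obj C; c \<in> Obj C; d \<in> Obj C;
        f \<in> Hom C a b; g \<in> Hom C b c; h \<in> Hom C c d\<rbrakk>
      \<Longrightarrow> Comp C a c d h (Comp C a b c g f) = Comp C a b d (Comp C b c d h g) f"

definition op_cat :: "('o, 'm) category \<Rightarrow> ('o, 'm) category" where
  "op_cat C = \<lparr>Obj = Obj C, Hom = (\<lambda>a b. Hom C b a), Idn = Idn C,
     Comp = (\<lambda>a b c g f. Comp C c b a f g)\<rparr>"

definition poset_cat :: "('o::order, unit) category" where
  "poset_cat = \<lparr>Obj = UNIV, Hom = (\<lambda>a b. if a \<le> b then {()} else {}), Idn = (\<lambda>a. ()),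
     Comp = (\<lambda>a b c g f. ())\<rparr>"

record ('o, 'm, 'p, 'n) functor_data =
  Fobj :: "'o \<Rightarrow> 'p"
  Fmor :: "'o \<Rightarrow> 'o \<Rightarrow> 'm \<Rightarrow> 'n"

locale is_functor = source: is_category C + target: is_category D
  for C :: "('o, 'm) category" and D :: "('p, 'n) category" +
  fixes F :: "('o, 'm, 'p, 'n) functor_data"
  assumes Fobj_in: "a \<in> Obj C \<Longrightarrow> Fobj F a \<in> Obj D"
    and Fmor_in: "\<lbrakk>a \<in> Obj C; b \<in> Obj C; f \<in> Hom C a b\<rbrakk>
      \<Longrightarrow> Fmor F a b f \<in> Hom D (Fobj F a) (Fobj F b)"
    and Fmor_Idn: "a \<in> Obj C \<Longrightarrow> Fmor F a a (Idn C a) = Idn D (Fobj F a)"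
    and Fmor_Comp: "\<lbrakk>a \<in> Obj C; b \<in> Obj C; c \<in> Obj C; f \<in> Hom C a b; g \<in> Hom C b c\<rbrakk>
      \<Longrightarrow> Fmor F a c (Comp C a b c g f)
        = Comp D (Fobj F a) (Fobj F b) (Fobj F c) (Fmor F b c g) (Fmor F a b f)"

definition nat_trans :: "('o, 'm) category \<Rightarrow> ('p, 'n) category \<Rightarrow>
    ('o, 'm, 'p, 'n) functor_data \<Rightarrow> ('o, 'm, 'p, 'n) functor_data \<Rightarrow> ('o \<Rightarrow> 'n) \<Rightarrow> bool" where
  "nat_trans C D F G \<eta> \<longleftrightarrow>
     \<eta> \<in> (\<Pi>\<^sub>E a\<in>Obj C. Hom D (Fobj F a) (Fobj G a)) \<and>
     (\<forall>a\<in>Obj C. \<forall>b\<in>Obj C. \<forall>f\<in>Hom C a b.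
        Comp D (Fobj F a) (Fobj F b) (Fobj G b) (\<eta> b) (Fmor F a b f)
      = Comp D (Fobj F a) (Fobj G a) (Fobj G b) (Fmor G a b f) (\<eta> a))"

text \<open>Objects of the functor category are required to be extensional, so that two of them are
  equal iff they agree on the objects and morphisms of the source category.\<close>

definition functor_ext :: "('o, 'm) category \<Rightarrow> ('o, 'm, 'p, 'n) functor_data \<Rightarrow> bool" where
  "functor_ext C F \<longleftrightarrow> Fobj F \<in> extensional (Obj C) \<and>
     (\<forall>a b. Fmor F a b \<in> extensional {f \<in> Hom C a b. a \<in> Obj C \<and> b \<in> Obj C})"

definition fun_cat :: "('o, 'm) category \<Rightarrow> ('p, 'n) category \<Rightarrow>
    (('o, 'm, 'p, 'n) functor_data, 'o \<Rightarrow> 'n) category" where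
  "fun_cat C D = \<lparr>Obj = {F. is_functor C D F \<and> functor_ext C F},
     Hom = (\<lambda>F G. {\<eta>. nat_trans C D F G \<eta>}),
     Idn = (\<lambda>F. \<lambda>a\<in>Obj C. Idn D (Fobj F a)),
     Comp = (\<lambda>F G H \<mu> \<eta>. \<lambda>a\<in>Obj C. Comp D (Fobj F a) (Fobj G a) (Fobj H a) (\<mu> a) (\<eta> a))\<rparr>"


section \<open>Commutative differential graded algebras over the reals\<close>

definition real_ring :: "real ring" where
  "real_ring = \<lparr>carrier = UNIV, monoid.mult = (*), one = 1, zero = 0, add = (+)\<rparr>"

text \<open>A \<open>\<int>\<close>-graded algebra with cohomological differential: \<open>gpiece A k\<close> is the real vector space
  of elements of degree \<open>k\<close> (the \<open>mult\<close> and \<open>one\<close> fields of this record are not used by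
  \<^locale>\<open>module\<close>), \<open>gmul A k l\<close> the product of elements of degrees \<open>k\<close> and \<open>l\<close>,
  \<open>gdiff A k\<close> the differential on degree \<open>k\<close>.\<close>

record 'c graded_algebra =
  gpiece :: "int \<Rightarrow> (real, 'c) module"
  gmul :: "int \<Rightarrow> int \<Rightarrow> 'c \<Rightarrow> 'c \<Rightarrow> 'c"
  gone :: 'c
  gdiff :: "int \<Rightarrow> 'c \<Rightarrow> 'c"

abbreviation gcarrier :: "'c graded_algebra \<Rightarrow> int \<Rightarrow> 'c set" where
  "gcarrier A k \<equiv> carrier (gpiece A k)"

locale is_cdga =
  fixes A :: "'c graded_algebra"
  assumes piece_module: "module real_ring (gpiece A k)"
    and mul_closed: "\<lbrakk>a \<in> gcarrier A k; b \<in> gcarrier A l\<rbrakk> \<Longrightarrow> gmul A k l a b \<in> gcarrier A (k + l)"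
    and mul_add_left: "\<lbrakk>a \<in> gcarrier A k; a' \<in> gcarrier A k; b \<in> gcarrier A l\<rbrakk>
      \<Longrightarrow> gmul A k l (a \<oplus>\<^bsub>gpiece A k\<^esub> a') b
        = gmul A k l a b \<oplus>\<^bsub>gpiece A (k + l)\<^esub> gmul A k l a' b"
    and mul_add_right: "\<lbrakk>a \<in> gcarrier A k; b \<in> gcarrier A l; b' \<in> gcarrier A l\<rbrakk>
      \<Longrightarrow> gmul A k l a (b \<oplus>\<^bsub>gpiece A l\<^esub> b')
        = gmul A k l a b \<oplus>\<^bsub>gpiece A (k + l)\<^esub> gmul A k l a b'"
    and mul_smult_left: "\<lbrakk>a \<in> gcarrier A k; b \<in> gcarrier A l\<rbrakk>
      \<Longrightarrow> gmul A k l (r \<odot>\<^bsub>gpiece A k\<^esub> a) b = r \<odot>\<^bsub>gpiece A (k + l)\<^esub> gmul A k l a b"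
    and mul_smult_right: "\<lbrakk>a \<in> gcarrier A k; b \<in> gcarrier A l\<rbrakk>
      \<Longrightarrow> gmul A k l a (r \<odot>\<^bsub>gpiece A l\<^esub> b) = r \<odot>\<^bsub>gpiece A (k + l)\<^esub> gmul A k l a b"
    and mul_assoc: "\<lbrakk>a \<in> gcarrier A k; b \<in> gcarrier A l; c \<in> gcarrier A m\<rbrakk>
      \<Longrightarrow> gmul A (k + l) m (gmul A k l a b) c = gmul A k (l + m) a (gmul A l m b c)"
    and one_closed: "gone A \<in> gcarrier A 0"
    and mul_one_left: "a \<in> gcarrier A k \<Longrightarrow> gmul A 0 k (gone A) a = a"
    and mul_one_right: "a \<in> gcarrier A k \<Longrightarrow> gmul A k 0 a (gone A) = a"
    and mul_comm: "\<lbrakk>a \<in> gcarrier A k; b \<in> gcarrier A l\<rbrakk>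
      \<Longrightarrow> gmul A k l a b = ((-1) powi (k * l)) \<odot>\<^bsub>gpiece A (k + l)\<^esub> gmul A l k b a"
    and diff_closed: "a \<in> gcarrier A k \<Longrightarrow> gdiff A k a \<in> gcarrier A (k + 1)"
    and diff_add: "\<lbrakk>a \<in> gcarrier A k; a' \<in> gcarrier A k\<rbrakk>
      \<Longrightarrow> gdiff A k (a \<oplus>\<^bsub>gpiece A k\<^esub> a') = gdiff A k a \<oplus>\<^bsub>gpiece A (k + 1)\<^esub> gdiff A k a'"
    and diff_smult: "a \<in> gcarrier A k
      \<Longrightarrow> gdiff A k (r \<odot>\<^bsub>gpiece A k\<^esub> a) = r \<odot>\<^bsub>gpiece A (k + 1)\<^esub> gdiff A k a"
    and diff_diff: "a \<in> gcarrier A k \<Longrightarrow> gdiff A (k + 1) (gdiff A k a) = \<zero>\<^bsub>gpiece A (k + 2)\<^esub>"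
    and diff_mul: "\<lbrakk>a \<in> gcarrier A k; b \<in> gcarrier A l\<rbrakk>
      \<Longrightarrow> gdiff A (k + l) (gmul A k l a b)
        = gmul A (k + 1) l (gdiff A k a) b
            \<oplus>\<^bsub>gpiece A (k + l + 1)\<^esub>
          ((-1) powi k) \<odot>\<^bsub>gpiece A (k + l + 1)\<^esub> gmul A k (l + 1) a (gdiff A l b)"

definition cdga_hom :: "'c graded_algebra \<Rightarrow> 'c graded_algebra \<Rightarrow> (int \<Rightarrow> 'c \<Rightarrow> 'c) set" where
  "cdga_hom A B = {f.
     (\<forall>k. f k \<in> gcarrier A k \<rightarrow>\<^sub>E gcarrier B k) \<and>
     (\<forall>k. \<forall>a\<in>gcarrier A k. \<forall>b\<in>gcarrier A k.
        f k (a \<oplus>\<^bsub>gpiece A k\<^esub> b) = f k a \<oplus>\<^bsub>gpiece B k\<^esub> f k b) \<and>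
     (\<forall>k r. \<forall>a\<in>gcarrier A k. f k (r \<odot>\<^bsub>gpiece A k\<^esub> a) = r \<odot>\<^bsub>gpiece B k\<^esub> f k a) \<and>
     (\<forall>k l. \<forall>a\<in>gcarrier A k. \<forall>b\<in>gcarrier A l.
        f (k + l) (gmul A k l a b) = gmul B k l (f k a) (f l b)) \<and>
     f 0 (gone A) = gone B \<and>
     (\<forall>k. \<forall>a\<in>gcarrier A k. f (k + 1) (gdiff A k a) = gdiff B k (f k a))}"

definition cdga_cat :: "('c graded_algebra, int \<Rightarrow> 'c \<Rightarrow> 'c) category" where
  "cdga_cat = \<lparr>Obj = {A. is_cdga A}, Hom = cdga_hom,
     Idn = (\<lambda>A k. \<lambda>a\<in>gcarrier A k. a),
     Comp = (\<lambda>A B C g f k. compose (gcarrier A k) (g k) (f k))\<rparr>"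

text \<open>Free adjunction of a variable \<open>\<theta>\<close> of odd degree \<open>m\<close> with \<open>d\<theta> = z\<close>, where \<open>z\<close> is a cocycle of
  degree \<open>m + 1\<close>. The pair \<open>(\<eta>, \<xi>)\<close> stands for \<open>\<eta> + \<theta>\<xi>\<close>.\<close>

definition adjoin :: "'c graded_algebra \<Rightarrow> int \<Rightarrow> 'c \<Rightarrow> ('c \<times> 'c) graded_algebra" where
  "adjoin A m z = \<lparr>
     gpiece = (\<lambda>k. \<lparr>carrier = gcarrier A k \<times> gcarrier A (k - m),
        monoid.mult = undefined, one = undefined,
        zero = (\<zero>\<^bsub>gpiece A k\<^esub>, \<zero>\<^bsub>gpiece A (k - m)\<^esub>),
        add = (\<lambda>(\<eta>, \<xi>) (\<eta>', \<xi>'). (\<eta> \<oplus>\<^bsub>gpiece A k\<^esub> \<eta>', \<xi> \<oplus>\<^bsub>gpiece A (k - m)\<^esub> \<xi>')),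
        smult = (\<lambda>r (\<eta>, \<xi>). (r \<odot>\<^bsub>gpiece A k\<^esub> \<eta>, r \<odot>\<^bsub>gpiece A (k - m)\<^esub> \<xi>))\<rparr>),
     gmul = (\<lambda>k l (\<alpha>, \<alpha>') (\<beta>, \<beta>').
        (gmul A k l \<alpha> \<beta>,
         gmul A (k - m) l \<alpha>' \<beta>
           \<oplus>\<^bsub>gpiece A (k + l - m)\<^esub>
         ((-1) powi k) \<odot>\<^bsub>gpiece A (k + l - m)\<^esub> gmul A k (l - m) \<alpha> \<beta>')),
     gone = (gone A, \<zero>\<^bsub>gpiece A (- m)\<^esub>),
     gdiff = (\<lambda>k (\<eta>, \<xi>).
        (gdiff A k \<eta> \<oplus>\<^bsub>gpiece A (k + 1)\<^esub> gmul A (m + 1) (k - m) z \<xi>,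
         \<ominus>\<^bsub>gpiece A (k + 1 - m)\<^esub> gdiff A (k - m) \<xi>))\<rparr>"


section \<open>Smooth maps between open subsets of Euclidean spaces\<close>

text \<open>Points of \<open>\<real>\<^sup>n\<close> are the points of \<^const>\<open>Euclidean_space\<close> \<open>n\<close>, i.e. sequences vanishing from index
  \<open>n\<close> on; thus the dimension is a term and one type accommodates manifolds of all dimensions.\<close>

type_synonym rvec = "nat \<Rightarrow> real"

definition pderivative :: "nat \<Rightarrow> (rvec \<Rightarrow> real) \<Rightarrow> rvec \<Rightarrow> real" where
  "pderivative i f x = deriv (\<lambda>t. f (x(i := t))) (x i)"

primrec iter_pderivative :: "nat list \<Rightarrow> (rvec \<Rightarrow> real) \<Rightarrow> rvec \<Rightarrow> real" where
  "iter_pderivative [] f = f"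
| "iter_pderivative (i # is) f = pderivative i (iter_pderivative is f)"

text \<open>\<open>C\<^sup>\<infinity>\<close> on an open subset \<open>V\<close> of \<open>\<real>\<^sup>n\<close>: all iterated partial derivatives exist and are
  continuous on \<open>V\<close>.\<close>

definition smooth_fun :: "nat \<Rightarrow> rvec set \<Rightarrow> (rvec \<Rightarrow> real) \<Rightarrow> bool" where
  "smooth_fun n V f \<longleftrightarrow> (\<forall>is. set is \<subseteq> {..<n} \<longrightarrow>
     continuous_map (subtopology (Euclidean_space n) V) euclideanreal (iter_pderivative is f) \<and>
     (\<forall>i<n. \<forall>x\<in>V. (\<lambda>t. iter_pderivative is f (x(i := t))) field_differentiable at (x i)))"

definition smooth_vfun :: "nat \<Rightarrow> nat \<Rightarrow> rvec set \<Rightarrow> (rvec \<Rightarrow> rvec) \<Rightarrow> bool" where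
  "smooth_vfun n m V g \<longleftrightarrow> (\<forall>i<m. smooth_fun n V (\<lambda>x. g x i))"


section \<open>Differential forms in local coordinates\<close>

text \<open>An element \<open>a\<close> of the exterior algebra on \<open>dx\<^sub>0, dx\<^sub>1, \<dots>\<close> is given by its coefficients: \<open>a I\<close> is the
  coefficient of \<open>dx\<^sub>I = dx\<^bsub>i\<^sub>1\<^esub> \<and> \<dots> \<and> dx\<^bsub>i\<^sub>k\<^esub>\<close> where \<open>i\<^sub>1 < \<dots> < i\<^sub>k\<close> are the elements of \<open>I\<close>. The sign in
  the product is the one in \<open>dx\<^sub>I \<and> dx\<^sub>J = \<plusminus> dx\<^bsub>I \<union> J\<^esub>\<close> for disjoint \<open>I\<close>, \<open>J\<close>.\<close>

type_synonym ext = "nat set \<Rightarrow> real"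
type_synonym local_form = "rvec \<Rightarrow> ext"

definition ext_mul :: "ext \<Rightarrow> ext \<Rightarrow> ext" where
  "ext_mul a b = (\<lambda>K. \<Sum>I\<in>Pow K.
     (-1) ^ card {(i, j). i \<in> I \<and> j \<in> K - I \<and> j < i} * a I * b (K - I))"

definition ext_one :: ext where
  "ext_one = (\<lambda>I. if I = {} then 1 else 0)"

definition local_fun :: "(rvec \<Rightarrow> real) \<Rightarrow> local_form" where
  "local_fun u = (\<lambda>x I. if I = {} then u x else 0)"

text \<open>\<open>d (f dx\<^sub>J) = (\<Sum>i. \<partial>\<^sub>i f dx\<^sub>i \<and> dx\<^sub>J)\<close>, summed over \<open>i < n\<close>\<close>

definition local_d :: "nat \<Rightarrow> local_form \<Rightarrow> local_form" where
  "local_d n \<alpha> = (\<lambda>x K. if K \<subseteq> {..<n}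
     then \<Sum>i\<in>K. (-1) ^ card {j \<in> K. j < i} * pderivative i (\<lambda>y. \<alpha> y (K - {i})) x else 0)"

text \<open>Pullback along a smooth map \<open>g\<close> from an open subset of \<open>\<real>\<^sup>n\<close> to \<open>\<real>\<^sup>m\<close>:
  \<open>g\<^sup>* (b dy\<^sub>I) = (b \<circ> g) dg\<^bsub>i\<^sub>1\<^esub> \<and> \<dots> \<and> dg\<^bsub>i\<^sub>k\<^esub>\<close> for \<open>I = {i\<^sub>1 < \<dots> < i\<^sub>k}\<close>.\<close>

definition local_pullback :: "nat \<Rightarrow> nat \<Rightarrow> (rvec \<Rightarrow> rvec) \<Rightarrow> local_form \<Rightarrow> local_form" where
  "local_pullback n m g \<beta> = (\<lambda>x K. \<Sum>I\<in>Pow {..<m}. \<beta> (g x) I *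
     foldr ext_mul (map (\<lambda>i. local_d n (local_fun (\<lambda>y. g y i)) x) (sorted_list_of_set I)) ext_one K)"


section \<open>Smooth manifolds and smooth maps\<close>

text \<open>A chart is a pair of its domain and an extensional coordinate map.\<close>

type_synonym 'a chart = "'a set \<times> ('a \<Rightarrow> rvec)"

definition chart_image :: "'a chart \<Rightarrow> rvec set" where
  "chart_image c = snd c ` fst c"

definition chart_inv :: "'a chart \<Rightarrow> rvec \<Rightarrow> 'a" where
  "chart_inv c = inv_into (fst c) (snd c)"

definition is_chart :: "'a topology \<Rightarrow> nat \<Rightarrow> 'a chart \<Rightarrow> bool" where
  "is_chart X n c \<longleftrightarrow> openin X (fst c) \<and> snd c \<in> extensional (fst c) \<and>
     openin (Euclidean_space n) (chart_image c) \<and>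
     homeomorphic_map (subtopology X (fst c)) (subtopology (Euclidean_space n) (chart_image c)) (snd c)"

definition smooth_transition :: "nat \<Rightarrow> 'a chart \<Rightarrow> 'a chart \<Rightarrow> bool" where
  "smooth_transition n c c' \<longleftrightarrow>
     smooth_vfun n n (snd c ` (fst c \<inter> fst c')) (\<lambda>x. snd c' (chart_inv c x))"

record 'a smooth_manifold =
  mtop :: "'a topology"
  mdim :: nat
  matlas :: "'a chart set"

definition is_smooth_manifold :: "('a, 'z) smooth_manifold_scheme \<Rightarrow> bool" where
  "is_smooth_manifold M \<longleftrightarrow>
     Hausdorff_space (mtop M) \<and> second_countable (mtop M) \<and>
     (\<forall>c\<in>matlas M. is_chart (mtop M) (mdim M) c) \<and>
     (\<Union>c\<in>matlas M. fst c) = topspace (mtop M) \<and>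
     (\<forall>c\<in>matlas M. \<forall>c'\<in>matlas M. smooth_transition (mdim M) c c') \<and>
     (\<forall>c. is_chart (mtop M) (mdim M) c \<and>
        (\<forall>c'\<in>matlas M. smooth_transition (mdim M) c c' \<and> smooth_transition (mdim M) c' c)
        \<longrightarrow> c \<in> matlas M)"

definition smooth_map ::
  "('a, 'z) smooth_manifold_scheme \<Rightarrow> ('b, 'y) smooth_manifold_scheme \<Rightarrow> ('a \<Rightarrow> 'b) \<Rightarrow> bool" where
  "smooth_map M N f \<longleftrightarrow> continuous_map (mtop M) (mtop N) f \<and>
     (\<forall>c\<in>matlas M. \<forall>c'\<in>matlas N.
        smooth_vfun (mdim M) (mdim N) (snd c ` {p \<in> fst c. f p \<in> fst c'})
          (\<lambda>x. snd c' (f (chart_inv c x))))"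


section \<open>The de Rham algebra\<close>

text \<open>A differential form is a family of local forms on the images of the charts, compatible under
  pullback along the transition maps. Coefficients at chart--point pairs outside the atlas are 0,
  so that forms are determined by their values in the charts.\<close>

type_synonym 'a form = "'a chart \<Rightarrow> local_form"

definition Omega :: "('a, 'z) smooth_manifold_scheme \<Rightarrow> int \<Rightarrow> 'a form set" where
  "Omega M k = {\<omega>.
     (\<forall>c x I. \<omega> c x I \<noteq> 0 \<longrightarrow>
        c \<in> matlas M \<and> x \<in> chart_image c \<and> I \<subseteq> {..<mdim M} \<and> int (card I) = k) \<and>
     (\<forall>c\<in>matlas M. \<forall>I. smooth_fun (mdim M) (chart_image c) (\<lambda>x. \<omega> c x I)) \<and>
     (\<forall>c\<in>matlas M. \<forall>c'\<in>matlas M. \<forall>x\<in>snd c ` (fst c \<inter> fst c').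
        \<omega> c x = local_pullback (mdim M) (mdim M) (\<lambda>y. snd c' (chart_inv c y)) (\<omega> c') x)}"

definition wedge :: "'a form \<Rightarrow> 'a form \<Rightarrow> 'a form" where
  "wedge \<alpha> \<beta> = (\<lambda>c x. ext_mul (\<alpha> c x) (\<beta> c x))"

definition form_one :: "('a, 'z) smooth_manifold_scheme \<Rightarrow> 'a form" where
  "form_one M = (\<lambda>c x. if c \<in> matlas M \<and> x \<in> chart_image c then ext_one else (\<lambda>_. 0))"

primrec wedge_power :: "('a, 'z) smooth_manifold_scheme \<Rightarrow> 'a form \<Rightarrow> nat \<Rightarrow> 'a form" where
  "wedge_power M \<omega> 0 = form_one M"
| "wedge_power M \<omega> (Suc p) = wedge \<omega> (wedge_power M \<omega> p)"

definition ext_d :: "('a, 'z) smooth_manifold_scheme \<Rightarrow> 'a form \<Rightarrow> 'a form" where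
  "ext_d M \<alpha> = (\<lambda>c x. if c \<in> matlas M \<and> x \<in> chart_image c
     then local_d (mdim M) (\<alpha> c) x else (\<lambda>_. 0))"

definition deRham :: "('a, 'z) smooth_manifold_scheme \<Rightarrow> 'a form graded_algebra" where
  "deRham M = \<lparr>
     gpiece = (\<lambda>k. \<lparr>carrier = Omega M k, monoid.mult = undefined, one = undefined,
        zero = (\<lambda>c x I. 0), add = (\<lambda>\<alpha> \<beta> c x I. \<alpha> c x I + \<beta> c x I),
        smult = (\<lambda>r \<alpha> c x I. r * \<alpha> c x I)\<rparr>),
     gmul = (\<lambda>k l. wedge), gone = form_one M, gdiff = (\<lambda>k. ext_d M)\<rparr>"

text \<open>Around a point \<open>p\<close> the pullback is computed in any chart of the target around \<open>f p\<close>; by the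
  compatibility of the local forms the choice is immaterial.\<close>

definition pullback :: "('a, 'z) smooth_manifold_scheme \<Rightarrow> ('b, 'y) smooth_manifold_scheme \<Rightarrow>
    ('a \<Rightarrow> 'b) \<Rightarrow> 'b form \<Rightarrow> 'a form" where
  "pullback M N f \<beta> = (\<lambda>c x. if c \<in> matlas M \<and> x \<in> chart_image c
     then let c' = (SOME c'. c' \<in> matlas N \<and> f (chart_inv c x) \<in> fst c')
       in local_pullback (mdim M) (mdim N) (\<lambda>y. snd c' (f (chart_inv c y))) (\<beta> c') x
     else (\<lambda>_. 0))"


section \<open>Symplectic manifolds\<close>

record 'a symplectic_manifold = "'a smooth_manifold" +
  sform :: "'a form"

definition ext2_eval :: "nat \<Rightarrow> ext \<Rightarrow> rvec \<Rightarrow> rvec \<Rightarrow> real" where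
  "ext2_eval n a v w = (\<Sum>j<n. \<Sum>i<j. a {i, j} * (v i * w j - v j * w i))"

definition nondegenerate :: "nat \<Rightarrow> ext \<Rightarrow> bool" where
  "nondegenerate n a \<longleftrightarrow> (\<forall>v\<in>topspace (Euclidean_space n).
     (\<forall>w\<in>topspace (Euclidean_space n). ext2_eval n a v w = 0) \<longrightarrow> v = (\<lambda>i. 0))"

definition is_symplectic :: "'a symplectic_manifold \<Rightarrow> bool" where
  "is_symplectic X \<longleftrightarrow> is_smooth_manifold X \<and> sform X \<in> Omega X 2 \<and>
     ext_d X (sform X) = (\<lambda>c x I. 0) \<and>
     (\<forall>c\<in>matlas X. \<forall>x\<in>chart_image c. nondegenerate (mdim X) (sform X c x))"

definition symp_cat :: "('a symplectic_manifold, 'a \<Rightarrow> 'a) category" where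
  "symp_cat = \<lparr>Obj = {X. is_symplectic X},
     Hom = (\<lambda>X Y. {f \<in> extensional (topspace (mtop X)).
        smooth_map X Y f \<and> pullback X Y f (sform Y) = sform X}),
     Idn = (\<lambda>X. \<lambda>p\<in>topspace (mtop X). p),
     Comp = (\<lambda>X Y Z g f. compose (topspace (mtop X)) g f)\<rparr>"


section \<open>The tower of cones\<close>

text \<open>\<open>symp_cone X p\<close> is \<open>Cone(\<omega>\<^bsup>p+1\<^esup>)\<close>.\<close>

definition symp_cone :: "'a symplectic_manifold \<Rightarrow> nat \<Rightarrow> ('a form \<times> 'a form) graded_algebra" where
  "symp_cone X p = adjoin (deRham X) (2 * int p + 1) (wedge_power X (sform X) (p + 1))"

text \<open>\<open>cone_q X r\<close> is \<open>q : Cone(\<omega>\<^bsup>r+2\<^esup>) \<rightarrow> Cone(\<omega>\<^bsup>r+1\<^esup>)\<close>, and \<open>cone_q_iter X b j\<close> is the composite of \<open>j\<close> such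
  maps, from \<open>Cone(\<omega>\<^bsup>b+j+1\<^esup>)\<close> to \<open>Cone(\<omega>\<^bsup>b+1\<^esup>)\<close>.\<close>

definition cone_q :: "'a symplectic_manifold \<Rightarrow> nat \<Rightarrow> int \<Rightarrow>
    'a form \<times> 'a form \<Rightarrow> 'a form \<times> 'a form" where
  "cone_q X r = (\<lambda>k. \<lambda>(\<alpha>, \<beta>)\<in>gcarrier (symp_cone X (Suc r)) k. (\<alpha>, wedge \<beta> (sform X)))"

primrec cone_q_iter :: "'a symplectic_manifold \<Rightarrow> nat \<Rightarrow> nat \<Rightarrow> int \<Rightarrow>
    'a form \<times> 'a form \<Rightarrow> 'a form \<times> 'a form" where
  "cone_q_iter X b 0 = Idn cdga_cat (symp_cone X b)"
| "cone_q_iter X b (Suc j) = Comp cdga_cat (symp_cone X (Suc (b + j))) (symp_cone X (b + j)) (symp_cone X b)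
     (cone_q_iter X b j) (cone_q X (b + j))"

definition cone_tower :: "'a symplectic_manifold \<Rightarrow>
    (nat, unit, ('a form \<times> 'a form) graded_algebra,
     int \<Rightarrow> 'a form \<times> 'a form \<Rightarrow> 'a form \<times> 'a form) functor_data" where
  "cone_tower X = \<lparr>Fobj = symp_cone X,
     Fmor = (\<lambda>a b. \<lambda>u\<in>Hom (op_cat poset_cat) a b. cone_q_iter X b (a - b))\<rparr>"

definition cone_pullback :: "'a symplectic_manifold \<Rightarrow> 'a symplectic_manifold \<Rightarrow> ('a \<Rightarrow> 'a) \<Rightarrow>
    nat \<Rightarrow> int \<Rightarrow> 'a form \<times> 'a form \<Rightarrow> 'a form \<times> 'a form" where
  "cone_pullback X Y f = (\<lambda>p k. \<lambda>(\<alpha>, \<beta>)\<in>gcarrier (symp_cone Y p) k.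
     (pullback X Y f \<alpha>, pullback X Y f \<beta>))"

text \<open>A morphism \<open>Y \<rightarrow> X\<close> of the opposite category is a symplectic map \<open>f : X \<rightarrow> Y\<close>.\<close>

definition cone_functor :: "('a symplectic_manifold, 'a \<Rightarrow> 'a,
    (nat, unit, ('a form \<times> 'a form) graded_algebra,
     int \<Rightarrow> 'a form \<times> 'a form \<Rightarrow> 'a form \<times> 'a form) functor_data,
    nat \<Rightarrow> int \<Rightarrow> 'a form \<times> 'a form \<Rightarrow> 'a form \<times> 'a form) functor_data" where
  "cone_functor = \<lparr>Fobj = cone_tower, Fmor = (\<lambda>Y X f. cone_pullback X Y f)\<rparr>"

end

theory Submission
  imports Defs
begin

text \<open>A symplectic map \<open>f : X \<rightarrow> Y\<close> pulls forms back by a cdga homomorphism \<open>\<Omega>(Y) \<rightarrow> \<Omega>(X)\<close>, functorially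
  in \<open>f\<close>, and this homomorphism maps \<open>\<omega>\<^sub>Y\<close> to \<open>\<omega>\<^sub>X\<close>, hence every power to the same power. The rest is
  algebra: adjoining an odd variable \<open>\<theta>\<close> with \<open>d\<theta> = z\<close> to a cdga is functorial in the pair of the cdga
  and its even cocycle \<open>z\<close> (\<open>is_cdga_adjoin\<close>, \<open>adjoin_map_hom\<close>), and multiplying the cocycle by another
  central cocycle \<open>w\<close> induces the homomorphism \<open>\<theta>' \<mapsto> \<theta>w\<close> (\<open>adjoin_mul_hom\<close>). For powers of \<open>\<omega>\<close> the latter
  is \<open>q\<close>. It commutes with pullbacks because \<open>f\<^sup>*(\<beta> \<wedge> \<omega>\<^sub>Y) = f\<^sup>*\<beta> \<wedge> \<omega>\<^sub>X\<close>; iterating \<open>q\<close> makes the cones a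
  tower, and the pullbacks a natural transformation of towers.

  What has to be built is the de Rham functor. Three facts carry it.

  \<^item> Smooth functions are closed under sums, products and composition. Smoothness is a coinductive
    property (\<open>smooth_fun_coinduct\<close>), and the functions built by these operations have partial derivatives
    built in the same way, by the chain rule. Second partial derivatives commute.

  \<^item> The form \<open>d\<alpha>\<close> is \<open>\<Sum>i. dx\<^sub>i \<and> \<partial>\<^sub>i\<alpha>\<close> (\<open>local_d_eq\<close>). Since the \<open>dx\<^sub>i\<close> anticommute, the Leibniz rule for
    partial derivatives gives the graded one, and the symmetry of second derivatives gives \<open>d\<^sup>2 = 0\<close>.

  \<^item> The pullback along \<open>g\<close> is, at each point, substitution of the one-forms \<open>dg\<^sub>i\<close> for the \<open>dy\<^sub>i\<close>. Any
    substitution of one-forms is an algebra homomorphism (\<open>ext_subst_mul\<close>), because one-forms obey the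
    relations of the \<open>dy\<^sub>i\<close>. So two pullbacks that agree on the \<open>dy\<^sub>i\<close> agree, which reduces functoriality to
    the chain rule, and pullback commutes with \<open>d\<close> because products of the exact forms \<open>dg\<^sub>i\<close> are closed.

  These local statements transfer to manifolds, where a form is a family of local forms that are
  compatible under the transition maps: compatibility makes the choice of a chart of the target
  immaterial (\<open>pullback_in_chart\<close>), so that every identity can be checked in charts adapted to a point.\<close>


section \<open>Categories and functors\<close>

lemma op_cat_simps [simp]:
  "Obj (op_cat C) = Obj C" "Hom (op_cat C) a b = Hom C b a" "Idn (op_cat C) = Idn C"
  "Comp (op_cat C) a b c g f = Comp C c b a f g"
  by (simp_all add: op_cat_def)

lemma is_category_op_cat:
  assumes "is_category C"
  shows "is_category (op_cat C)"
proof -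
  interpret is_category C by fact
  show ?thesis
    by unfold_locales (auto simp: Idn_in Comp_in Comp_Idn_left Comp_Idn_right Comp_assoc)
qed

lemma is_category_poset_cat: "is_category (poset_cat :: ('o::order, unit) category)"
  by unfold_locales (auto simp: poset_cat_def split: if_splits)

lemma fun_cat_simps [simp]:
  "Obj (fun_cat C D) = {F. is_functor C D F \<and> functor_ext C F}"
  "Hom (fun_cat C D) F G = {\<eta>. nat_trans C D F G \<eta>}"
  "Idn (fun_cat C D) F = (\<lambda>a\<in>Obj C. Idn D (Fobj F a))"
  "Comp (fun_cat C D) F G H \<mu> \<eta> = (\<lambda>a\<in>Obj C. Comp D (Fobj F a) (Fobj G a) (Fobj H a) (\<mu> a) (\<eta> a))"
  by (simp_all add: fun_cat_def)

lemma nat_trans_in: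
  "\<lbrakk>nat_trans C D F G \<eta>; a \<in> Obj C\<rbrakk> \<Longrightarrow> \<eta> a \<in> Hom D (Fobj F a) (Fobj G a)"
  by (auto simp: nat_trans_def)

lemma nat_trans_square:
  "\<lbrakk>nat_trans C D F G \<eta>; a \<in> Obj C; b \<in> Obj C; f \<in> Hom C a b\<rbrakk>
   \<Longrightarrow> Comp D (Fobj F a) (Fobj F b) (Fobj G b) (\<eta> b) (Fmor F a b f)
     = Comp D (Fobj F a) (Fobj G a) (Fobj G b) (Fmor G a b f) (\<eta> a)"
  by (auto simp: nat_trans_def)

lemma nat_trans_extensional: "nat_trans C D F G \<eta> \<Longrightarrow> \<eta> \<in> extensional (Obj C)"
  by (auto simp: nat_trans_def PiE_def)

lemma nat_trans_Idn:
  assumes "is_functor C D F"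
  shows "nat_trans C D F F (\<lambda>a\<in>Obj C. Idn D (Fobj F a))"
proof -
  interpret is_functor C D F by fact
  show ?thesis
    by (auto simp: nat_trans_def Fobj_in Fmor_in target.Idn_in target.Comp_Idn_left
        target.Comp_Idn_right)
qed

text \<open>The naturality square of a composite is obtained by pasting the two given squares.\<close>

lemma nat_trans_Comp:
  assumes "is_functor C D F" "is_functor C D G" "is_functor C D H"
    and \<eta>: "nat_trans C D F G \<eta>" and \<mu>: "nat_trans C D G H \<mu>"
  shows "nat_trans C D F H (\<lambda>a\<in>Obj C. Comp D (Fobj F a) (Fobj G a) (Fobj H a) (\<mu> a) (\<eta> a))"
proof -
  interpret F: is_functor C D F by fact
  interpret G: is_functor C D G by fact
  interpret H: is_functor C D H by fact
  note in_D = F.Fobj_in G.Fobj_in H.Fobj_in nat_trans_in[OF \<eta>] nat_trans_in[OF \<mu>]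
  have "Comp D (Fobj F a) (Fobj F b) (Fobj H b)
          (Comp D (Fobj F b) (Fobj G b) (Fobj H b) (\<mu> b) (\<eta> b)) (Fmor F a b f)
      = Comp D (Fobj F a) (Fobj H a) (Fobj H b) (Fmor H a b f)
          (Comp D (Fobj F a) (Fobj G a) (Fobj H a) (\<mu> a) (\<eta> a))"
    if "a \<in> Obj C" "b \<in> Obj C" "f \<in> Hom C a b" for a b f
  proof -
    note f = that
    have "Comp D (Fobj F a) (Fobj F b) (Fobj H b)
          (Comp D (Fobj F b) (Fobj G b) (Fobj H b) (\<mu> b) (\<eta> b)) (Fmor F a b f)
      = Comp D (Fobj F a) (Fobj G b) (Fobj H b) (\<mu> b)
          (Comp D (Fobj F a) (Fobj F b) (Fobj G b) (\<eta> b) (Fmor F a b f))"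
      by (rule F.target.Comp_assoc[symmetric]) (use f in_D F.Fmor_in in auto)
    also have "\<dots> = Comp D (Fobj F a) (Fobj G b) (Fobj H b) (\<mu> b)
          (Comp D (Fobj F a) (Fobj G a) (Fobj G b) (Fmor G a b f) (\<eta> a))"
      using nat_trans_square[OF \<eta> f] by simp
    also have "\<dots> = Comp D (Fobj F a) (Fobj G a) (Fobj H b)
          (Comp D (Fobj G a) (Fobj G b) (Fobj H b) (\<mu> b) (Fmor G a b f)) (\<eta> a)"
      by (rule F.target.Comp_assoc) (use f in_D G.Fmor_in in auto)
    also have "\<dots> = Comp D (Fobj F a) (Fobj G a) (Fobj H b)
          (Comp D (Fobj G a) (Fobj H a) (Fobj H b) (Fmor H a b f) (\<mu> a)) (\<eta> a)"
      using nat_trans_square[OF \<mu> f] by simp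
    also have "\<dots> = Comp D (Fobj F a) (Fobj H a) (Fobj H b) (Fmor H a b f)
          (Comp D (Fobj F a) (Fobj G a) (Fobj H a) (\<mu> a) (\<eta> a))"
      by (rule F.target.Comp_assoc[symmetric]) (use f in_D H.Fmor_in in auto)
    finally show ?thesis .
  qed
  then show ?thesis
    using in_D by (auto simp: nat_trans_def intro!: F.target.Comp_in)
qed

lemma is_category_fun_cat:
  assumes "is_category C" "is_category D"
  shows "is_category (fun_cat C D)"
proof -
  interpret C: is_category C by fact
  interpret D: is_category D by fact
  show ?thesis
  proof
    fix F assume "F \<in> Obj (fun_cat C D)"
    then show "Idn (fun_cat C D) F \<in> Hom (fun_cat C D) F F"
      by (auto intro: nat_trans_Idn)
  next
    fix F G H \<eta> \<mu>
    assume "F \<in> Obj (fun_cat C D)" "G \<in> Obj (fun_cat C D)" "H \<in> Obj (fun_cat C D)"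
      "\<eta> \<in> Hom (fun_cat C D) F G" "\<mu> \<in> Hom (fun_cat C D) G H"
    then show "Comp (fun_cat C D) F G H \<mu> \<eta> \<in> Hom (fun_cat C D) F H"
      by (auto intro: nat_trans_Comp)
  next
    fix F G \<eta>
    assume "F \<in> Obj (fun_cat C D)" "G \<in> Obj (fun_cat C D)" "\<eta> \<in> Hom (fun_cat C D) F G"
    then have \<eta>: "nat_trans C D F G \<eta>"
      and "is_functor C D F" "is_functor C D G" by auto
    then have "\<And>a. a \<in> Obj C \<Longrightarrow> Fobj F a \<in> Obj D" "\<And>a. a \<in> Obj C \<Longrightarrow> Fobj G a \<in> Obj D"
      by (auto dest: is_functor.Fobj_in)
    then show "Comp (fun_cat C D) F F G \<eta> (Idn (fun_cat C D) F) = \<eta>"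
      and "Comp (fun_cat C D) F G G (Idn (fun_cat C D) G) \<eta> = \<eta>"
      using nat_trans_in[OF \<eta>]
      by (auto intro!: extensionalityI[OF _ nat_trans_extensional[OF \<eta>]]
          simp: D.Comp_Idn_left D.Comp_Idn_right)
  next
    fix F G H K \<eta> \<mu> \<nu>
    assume "F \<in> Obj (fun_cat C D)" "G \<in> Obj (fun_cat C D)" "H \<in> Obj (fun_cat C D)"
      "K \<in> Obj (fun_cat C D)" "\<eta> \<in> Hom (fun_cat C D) F G" "\<mu> \<in> Hom (fun_cat C D) G H"
      "\<nu> \<in> Hom (fun_cat C D) H K"
    then show "Comp (fun_cat C D) F H K \<nu> (Comp (fun_cat C D) F G H \<mu> \<eta>)
        = Comp (fun_cat C D) F G K (Comp (fun_cat C D) G H K \<nu> \<mu>) \<eta>"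
      by (auto intro!: restrict_ext D.Comp_assoc dest: is_functor.Fobj_in nat_trans_in)
  qed
qed

lemma cdga_homD:
  assumes "f \<in> cdga_hom A B"
  shows "f k \<in> gcarrier A k \<rightarrow>\<^sub>E gcarrier B k"
    and "a \<in> gcarrier A k \<Longrightarrow> f k a \<in> gcarrier B k"
    and "\<lbrakk>a \<in> gcarrier A k; b \<in> gcarrier A k\<rbrakk>
      \<Longrightarrow> f k (a \<oplus>\<^bsub>gpiece A k\<^esub> b) = f k a \<oplus>\<^bsub>gpiece B k\<^esub> f k b"
    and "a \<in> gcarrier A k \<Longrightarrow> f k (r \<odot>\<^bsub>gpiece A k\<^esub> a) = r \<odot>\<^bsub>gpiece B k\<^esub> f k a"
    and "\<lbrakk>a \<in> gcarrier A k; b \<in> gcarrier A l\<rbrakk>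
      \<Longrightarrow> f (k + l) (gmul A k l a b) = gmul B k l (f k a) (f l b)"
    and "f 0 (gone A) = gone B"
    and "a \<in> gcarrier A k \<Longrightarrow> f (k + 1) (gdiff A k a) = gdiff B k (f k a)"
proof -
  show "f k \<in> gcarrier A k \<rightarrow>\<^sub>E gcarrier B k" using assms by (simp add: cdga_hom_def)
  then show "a \<in> gcarrier A k \<Longrightarrow> f k a \<in> gcarrier B k" by blast
qed (use assms in \<open>simp_all add: cdga_hom_def\<close>)

lemma cdga_cat_simps [simp]:
  "Obj cdga_cat = {A. is_cdga A}" "Hom cdga_cat = cdga_hom"
  "Idn cdga_cat A = (\<lambda>k. \<lambda>a\<in>gcarrier A k. a)"
  "Comp cdga_cat A B C g f = (\<lambda>k. compose (gcarrier A k) (g k) (f k))"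
  by (simp_all add: cdga_cat_def)

lemma real_ring_simps [simp]:
  "carrier real_ring = UNIV" "x \<oplus>\<^bsub>real_ring\<^esub> y = x + y" "x \<otimes>\<^bsub>real_ring\<^esub> y = x * y"
  "\<one>\<^bsub>real_ring\<^esub> = 1" "\<zero>\<^bsub>real_ring\<^esub> = 0"
  by (simp_all add: real_ring_def)

lemma module_closed:
  assumes "module real_ring M" "a \<in> carrier M"
  shows "b \<in> carrier M \<Longrightarrow> a \<oplus>\<^bsub>M\<^esub> b \<in> carrier M" "r \<odot>\<^bsub>M\<^esub> a \<in> carrier M"
proof -
  interpret module real_ring M by fact
  show "b \<in> carrier M \<Longrightarrow> a \<oplus>\<^bsub>M\<^esub> b \<in> carrier M" "r \<odot>\<^bsub>M\<^esub> a \<in> carrier M"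
    using assms(2) by simp_all
qed

lemma cdga_hom_id:
  assumes "is_cdga A"
  shows "(\<lambda>k. \<lambda>a\<in>gcarrier A k. a) \<in> cdga_hom A A"
proof -
  interpret is_cdga A by fact
  show ?thesis
    using module_closed[OF piece_module]
    by (simp add: cdga_hom_def mul_closed diff_closed one_closed)
qed

lemma cdga_hom_compose:
  assumes A: "is_cdga A" and f: "f \<in> cdga_hom A B" and g: "g \<in> cdga_hom B C"
  shows "(\<lambda>k. compose (gcarrier A k) (g k) (f k)) \<in> cdga_hom A C"
proof -
  interpret is_cdga A by fact
  show ?thesis
    using module_closed[OF piece_module] cdga_homD(2-)[OF f] cdga_homD(2-)[OF g]
    by (simp add: cdga_hom_def compose_eq mul_closed diff_closed one_closed
        compose_def[of _ "g _" "f _"] PiE_def Pi_def)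
qed

lemma is_category_cdga_cat: "is_category cdga_cat"
proof
  fix A B f assume "A \<in> Obj cdga_cat" "B \<in> Obj cdga_cat" "f \<in> Hom cdga_cat A B"
  then have f: "\<And>k. f k \<in> gcarrier A k \<rightarrow>\<^sub>E gcarrier B k" by (auto dest: cdga_homD(1))
  show "Comp cdga_cat A A B f (Idn cdga_cat A) = f" "Comp cdga_cat A B B (Idn cdga_cat B) f = f"
    using f by (auto simp: compose_def PiE_iff extensional_def fun_eq_iff)
next
  fix A B C D f g h
  assume "A \<in> Obj cdga_cat" "B \<in> Obj cdga_cat" "C \<in> Obj cdga_cat" "D \<in> Obj cdga_cat"
    "f \<in> Hom cdga_cat A B" "g \<in> Hom cdga_cat B C" "h \<in> Hom cdga_cat C D"
  then show "Comp cdga_cat A C D h (Comp cdga_cat A B C g f)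
    = Comp cdga_cat A B D (Comp cdga_cat B C D h g) f"
    by (auto simp: fun_eq_iff compose_def dest: cdga_homD(2))
qed (auto intro: cdga_hom_id cdga_hom_compose[unfolded])

section \<open>Adjoining an odd variable to a cdga\<close>

text \<open>The module laws with coefficients of type \<^typ>\<open>real\<close>: negation is written as the coefficient
  \<open>-1\<close>, so that all signs are collected by real arithmetic.\<close>

lemma module_smult_simps:
  assumes "module real_ring M" "a \<in> carrier M"
  shows "r \<odot>\<^bsub>M\<^esub> (s \<odot>\<^bsub>M\<^esub> a) = (r * s) \<odot>\<^bsub>M\<^esub> a"
    and "b \<in> carrier M \<Longrightarrow> r \<odot>\<^bsub>M\<^esub> (a \<oplus>\<^bsub>M\<^esub> b) = r \<odot>\<^bsub>M\<^esub> a \<oplus>\<^bsub>M\<^esub> r \<odot>\<^bsub>M\<^esub> b"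
    and "1 \<odot>\<^bsub>M\<^esub> a = a" and "0 \<odot>\<^bsub>M\<^esub> a = \<zero>\<^bsub>M\<^esub>" and "\<ominus>\<^bsub>M\<^esub> a = (-1) \<odot>\<^bsub>M\<^esub> a"
    and "r \<odot>\<^bsub>M\<^esub> a \<oplus>\<^bsub>M\<^esub> s \<odot>\<^bsub>M\<^esub> a = (r + s) \<odot>\<^bsub>M\<^esub> a"
proof -
  interpret module real_ring M by fact
  show 1: "r \<odot>\<^bsub>M\<^esub> (s \<odot>\<^bsub>M\<^esub> a) = (r * s) \<odot>\<^bsub>M\<^esub> a" for r s
    using smult_assoc1[of r s a] assms(2) by simp
  show "b \<in> carrier M \<Longrightarrow> r \<odot>\<^bsub>M\<^esub> (a \<oplus>\<^bsub>M\<^esub> b) = r \<odot>\<^bsub>M\<^esub> a \<oplus>\<^bsub>M\<^esub> r \<odot>\<^bsub>M\<^esub> b"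
    using smult_r_distr[of r a b] assms(2) by simp
  show one: "1 \<odot>\<^bsub>M\<^esub> a = a" using smult_one[of a] assms(2) by simp
  show zero: "0 \<odot>\<^bsub>M\<^esub> a = \<zero>\<^bsub>M\<^esub>" using smult_l_null[of a] assms(2) by simp
  show add: "r \<odot>\<^bsub>M\<^esub> a \<oplus>\<^bsub>M\<^esub> s \<odot>\<^bsub>M\<^esub> a = (r + s) \<odot>\<^bsub>M\<^esub> a" for r s
    using smult_l_distr[of r s a] assms(2) by simp
  have cl: "r \<odot>\<^bsub>M\<^esub> a \<in> carrier M" for r using smult_closed[of r a] assms(2) by simp
  have "(-1) \<odot>\<^bsub>M\<^esub> a \<oplus>\<^bsub>M\<^esub> a = \<zero>\<^bsub>M\<^esub>" using add[of "-1" 1] one zero by simp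
  then show "\<ominus>\<^bsub>M\<^esub> a = (-1) \<odot>\<^bsub>M\<^esub> a"
    using minus_equality[of "(-1) \<odot>\<^bsub>M\<^esub> a" a] assms(2) cl by simp
qed

context is_cdga
begin

lemma piece_group: "abelian_group (gpiece A k)"
  using piece_module by (rule module.axioms)

lemmas piece_monoid = abelian_group.axioms(1)[OF piece_group]
lemmas piece_closed [simp] = module_closed[OF piece_module] abelian_monoid.zero_closed[OF piece_monoid]
  abelian_group.a_inv_closed[OF piece_group]
lemmas piece_smult = module_smult_simps[OF piece_module]
lemmas piece_zero = abelian_monoid.l_zero[OF piece_monoid] abelian_monoid.r_zero[OF piece_monoid]
lemmas piece_ac = abelian_monoid.a_comm[OF piece_monoid] abelian_monoid.a_assoc[OF piece_monoid]
  abelian_monoid.a_lcomm[OF piece_monoid]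

lemma smult_zero: "r \<odot>\<^bsub>gpiece A k\<^esub> \<zero>\<^bsub>gpiece A k\<^esub> = \<zero>\<^bsub>gpiece A k\<^esub>"
  using module.smult_r_null[OF piece_module] by simp

lemma piece_cancel:
  assumes "a \<in> gcarrier A k"
  shows "(-1) \<odot>\<^bsub>gpiece A k\<^esub> a \<oplus>\<^bsub>gpiece A k\<^esub> a = \<zero>\<^bsub>gpiece A k\<^esub>"
    and "a \<oplus>\<^bsub>gpiece A k\<^esub> (-1) \<odot>\<^bsub>gpiece A k\<^esub> a = \<zero>\<^bsub>gpiece A k\<^esub>"
    and "c \<in> gcarrier A k \<Longrightarrow> (-1) \<odot>\<^bsub>gpiece A k\<^esub> a \<oplus>\<^bsub>gpiece A k\<^esub> (a \<oplus>\<^bsub>gpiece A k\<^esub> c) = c"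
    and "c \<in> gcarrier A k \<Longrightarrow> a \<oplus>\<^bsub>gpiece A k\<^esub> ((-1) \<odot>\<^bsub>gpiece A k\<^esub> a \<oplus>\<^bsub>gpiece A k\<^esub> c) = c"
proof -
  show 1: "(-1) \<odot>\<^bsub>gpiece A k\<^esub> a \<oplus>\<^bsub>gpiece A k\<^esub> a = \<zero>\<^bsub>gpiece A k\<^esub>"
    and 2: "a \<oplus>\<^bsub>gpiece A k\<^esub> (-1) \<odot>\<^bsub>gpiece A k\<^esub> a = \<zero>\<^bsub>gpiece A k\<^esub>"
    using assms piece_smult(6)[of a k "-1" 1] piece_smult(6)[of a k 1 "-1"]
    by (simp_all add: piece_smult)
  show "c \<in> gcarrier A k \<Longrightarrow> (-1) \<odot>\<^bsub>gpiece A k\<^esub> a \<oplus>\<^bsub>gpiece A k\<^esub> (a \<oplus>\<^bsub>gpiece A k\<^esub> c) = c"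
    "c \<in> gcarrier A k \<Longrightarrow> a \<oplus>\<^bsub>gpiece A k\<^esub> ((-1) \<odot>\<^bsub>gpiece A k\<^esub> a \<oplus>\<^bsub>gpiece A k\<^esub> c) = c"
    using assms 1 2 by (simp_all add: piece_ac(2)[symmetric] piece_zero)
qed

text \<open>Two opposite monomials end up in these positions when the Leibniz rule below is normalized modulo
  associativity and commutativity.\<close>

lemma piece_cancel_last:
  assumes a: "a \<in> gcarrier A k" and "b \<in> gcarrier A k" "c \<in> gcarrier A k" "d \<in> gcarrier A k"
  shows "a \<oplus>\<^bsub>gpiece A k\<^esub> (b \<oplus>\<^bsub>gpiece A k\<^esub> (c \<oplus>\<^bsub>gpiece A k\<^esub> (d \<oplus>\<^bsub>gpiece A k\<^esub> (-1) \<odot>\<^bsub>gpiece A k\<^esub> a)))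
    = b \<oplus>\<^bsub>gpiece A k\<^esub> (c \<oplus>\<^bsub>gpiece A k\<^esub> d)"
proof -
  let ?n = "(-1) \<odot>\<^bsub>gpiece A k\<^esub> a"
  have n: "?n \<in> gcarrier A k" using a by simp
  have "b \<oplus>\<^bsub>gpiece A k\<^esub> (c \<oplus>\<^bsub>gpiece A k\<^esub> (d \<oplus>\<^bsub>gpiece A k\<^esub> ?n))
      = ?n \<oplus>\<^bsub>gpiece A k\<^esub> (b \<oplus>\<^bsub>gpiece A k\<^esub> (c \<oplus>\<^bsub>gpiece A k\<^esub> d))"
    using assms n by (simp add: piece_ac)
  then show ?thesis using assms piece_cancel(4)[OF a] by simp
qed

text \<open>Equal degrees such as \<open>(k - m) + l\<close> and \<open>k + l - m\<close> are different terms. In the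
  following forms of the axioms the degree of a composite expression is a variable on the left-hand
  side, so that they apply whichever of these terms appears there.\<close>

lemma mul_closed_deg:
  "\<lbrakk>a \<in> gcarrier A k; b \<in> gcarrier A l; p = k + l\<rbrakk> \<Longrightarrow> gmul A k l a b \<in> gcarrier A p"
  by (simp add: mul_closed)

lemma diff_closed_deg: "\<lbrakk>a \<in> gcarrier A k; p = k + 1\<rbrakk> \<Longrightarrow> gdiff A k a \<in> gcarrier A p"
  by (simp add: diff_closed)

lemma mul_assoc_deg:
  "\<lbrakk>a \<in> gcarrier A k; b \<in> gcarrier A l; c \<in> gcarrier A j; p = k + l\<rbrakk>
   \<Longrightarrow> gmul A p j (gmul A k l a b) c = gmul A k (l + j) a (gmul A l j b c)"
  by (simp add: mul_assoc)

lemma mul_comm_deg: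
  "\<lbrakk>a \<in> gcarrier A k; b \<in> gcarrier A l\<rbrakk>
   \<Longrightarrow> gmul A k l a b = (if even k \<or> even l then 1 else -1) \<odot>\<^bsub>gpiece A (k + l)\<^esub> gmul A l k b a"
  using mul_comm[of a k b l] by simp

lemma diff_diff_deg:
  "\<lbrakk>a \<in> gcarrier A k; p = k + 1\<rbrakk> \<Longrightarrow> gdiff A p (gdiff A k a) = \<zero>\<^bsub>gpiece A (k + 2)\<^esub>"
  by (simp add: diff_diff)

lemma diff_mul_deg:
  "\<lbrakk>a \<in> gcarrier A k; b \<in> gcarrier A l; p = k + l\<rbrakk>
   \<Longrightarrow> gdiff A p (gmul A k l a b) = gmul A (k + 1) l (gdiff A k a) b \<oplus>\<^bsub>gpiece A (k + l + 1)\<^esub>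
     (if even k then 1 else -1) \<odot>\<^bsub>gpiece A (k + l + 1)\<^esub> gmul A k (l + 1) a (gdiff A l b)"
  using diff_mul[of a k b l] by simp

lemmas axioms_deg = mul_closed_deg diff_closed_deg mul_add_left mul_add_right mul_smult_left
  mul_smult_right mul_assoc_deg diff_add diff_smult diff_diff_deg diff_mul_deg piece_smult piece_ac
  algebra_simps

lemma mul_zero_left: "b \<in> gcarrier A l \<Longrightarrow> gmul A k l \<zero>\<^bsub>gpiece A k\<^esub> b = \<zero>\<^bsub>gpiece A (k + l)\<^esub>"
  using mul_smult_left[of "\<zero>\<^bsub>gpiece A k\<^esub>" k b l 0] by (simp add: piece_smult mul_closed)

lemma mul_zero_right: "a \<in> gcarrier A k \<Longrightarrow> gmul A k l a \<zero>\<^bsub>gpiece A l\<^esub> = \<zero>\<^bsub>gpiece A (k + l)\<^esub>"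
  using mul_smult_right[of a k "\<zero>\<^bsub>gpiece A l\<^esub>" l 0] by (simp add: piece_smult mul_closed)

lemma even_central:
  assumes "even e" "w \<in> gcarrier A e" "b \<in> gcarrier A k"
  shows "gmul A k e b w = gmul A e k w b"
  using mul_comm_deg[of b k w e] assms by (simp add: axioms_deg)

lemma even_central_left:
  assumes "even e" "w \<in> gcarrier A e" "b \<in> gcarrier A k" "c \<in> gcarrier A l" "q = e + l"
  shows "gmul A k q b (gmul A e l w c) = gmul A e (k + l) w (gmul A k l b c)"
proof -
  have "gmul A k q b (gmul A e l w c) = gmul A (e + k) l (gmul A k e b w) c"
    using assms by (simp add: mul_assoc_deg)
  also have "\<dots> = gmul A e (k + l) w (gmul A k l b c)"
    using assms even_central[of e w b k] by (simp add: mul_assoc)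
  finally show ?thesis .
qed

text \<open>\<open>d1 = d(1 \<cdot> 1) = d1 + d1\<close>.\<close>

lemma diff_one: "gdiff A 0 (gone A) = \<zero>\<^bsub>gpiece A 1\<^esub>"
proof -
  let ?d = "gdiff A 0 (gone A)"
  interpret abelian_group "gpiece A 1" by (rule piece_group)
  have d: "?d \<in> gcarrier A 1" using diff_closed[OF one_closed] by simp
  have "?d = ?d \<oplus>\<^bsub>gpiece A 1\<^esub> ?d"
    using diff_mul[OF one_closed one_closed] d one_closed
    by (simp add: mul_one_left mul_one_right piece_smult)
  then show ?thesis using d by (metis add.r_cancel_one')
qed

end

lemma adjoin_simps [simp]:
  "gcarrier (adjoin A m z) k = gcarrier A k \<times> gcarrier A (k - m)"
  "\<zero>\<^bsub>gpiece (adjoin A m z) k\<^esub> = (\<zero>\<^bsub>gpiece A k\<^esub>, \<zero>\<^bsub>gpiece A (k - m)\<^esub>)"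
  "(a, a') \<oplus>\<^bsub>gpiece (adjoin A m z) k\<^esub> (b, b')
     = (a \<oplus>\<^bsub>gpiece A k\<^esub> b, a' \<oplus>\<^bsub>gpiece A (k - m)\<^esub> b')"
  "r \<odot>\<^bsub>gpiece (adjoin A m z) k\<^esub> (a, a') = (r \<odot>\<^bsub>gpiece A k\<^esub> a, r \<odot>\<^bsub>gpiece A (k - m)\<^esub> a')"
  "gone (adjoin A m z) = (gone A, \<zero>\<^bsub>gpiece A (- m)\<^esub>)"
  "gmul (adjoin A m z) k l (a, a') (b, b') = (gmul A k l a b, gmul A (k - m) l a' b
     \<oplus>\<^bsub>gpiece A (k + l - m)\<^esub> (if even k then 1 else -1) \<odot>\<^bsub>gpiece A (k + l - m)\<^esub> gmul A k (l - m) a b')"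
  "gdiff (adjoin A m z) k (a, a') = (gdiff A k a \<oplus>\<^bsub>gpiece A (k + 1)\<^esub> gmul A (m + 1) (k - m) z a',
     \<ominus>\<^bsub>gpiece A (k + 1 - m)\<^esub> gdiff A (k - m) a')"
  by (simp_all add: adjoin_def)

lemma (in is_cdga) adjoin_piece_module: "module real_ring (gpiece (adjoin A m z) k)"
proof (rule moduleI)
  show "cring real_ring" using piece_module[of 0] by (rule module.axioms)
  show "abelian_group (gpiece (adjoin A m z) k)"
  proof (rule abelian_groupI)
    fix x assume "x \<in> gcarrier (adjoin A m z) k"
    then show "\<exists>y\<in>gcarrier (adjoin A m z) k.
        y \<oplus>\<^bsub>gpiece (adjoin A m z) k\<^esub> x = \<zero>\<^bsub>gpiece (adjoin A m z) k\<^esub>"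
      by (intro bexI[of _ "(-1) \<odot>\<^bsub>gpiece (adjoin A m z) k\<^esub> x"]) (auto simp: piece_cancel)
  qed (auto simp: piece_ac piece_zero)
qed (auto simp: piece_smult)

text \<open>As \<open>m\<close> is odd, moving \<open>\<theta>\<close> past an element of degree \<open>k\<close> costs \<open>(-1)\<^sup>k\<close>, and \<open>z\<close>, of even degree
  \<open>m + 1\<close>, is central. In \<open>d(d(\<eta> + \<theta>\<xi>))\<close> the terms \<open>d(z\<xi>) = z d\<xi>\<close> (here \<open>dz = 0\<close> enters) and
  \<open>- z d\<xi>\<close> cancel; in the Leibniz rule the term \<open>z a' b'\<close> occurs with both signs, once as \<open>a' z b'\<close>.\<close>

lemma (in is_cdga) is_cdga_adjoin:
  assumes m: "odd m" and z: "z \<in> gcarrier A (m + 1)" and dz: "gdiff A (m + 1) z = \<zero>\<^bsub>gpiece A (m + 2)\<^esub>"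
  shows "is_cdga (adjoin A m z)"
proof (rule is_cdga.intro)
  let ?B = "adjoin A m z"
  show "module real_ring (gpiece ?B k)" for k by (rule adjoin_piece_module)
  show "gmul ?B k l x y \<in> gcarrier ?B (k + l)"
    if "x \<in> gcarrier ?B k" "y \<in> gcarrier ?B l" for x y k l
    using that by (auto simp: axioms_deg)
  show "gmul ?B k l (x \<oplus>\<^bsub>gpiece ?B k\<^esub> x') y
      = gmul ?B k l x y \<oplus>\<^bsub>gpiece ?B (k + l)\<^esub> gmul ?B k l x' y"
    if "x \<in> gcarrier ?B k" "x' \<in> gcarrier ?B k" "y \<in> gcarrier ?B l" for x x' y k l
    using that by (auto simp: axioms_deg)
  show "gmul ?B k l x (y \<oplus>\<^bsub>gpiece ?B l\<^esub> y')
      = gmul ?B k l x y \<oplus>\<^bsub>gpiece ?B (k + l)\<^esub> gmul ?B k l x y'"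
    if "x \<in> gcarrier ?B k" "y \<in> gcarrier ?B l" "y' \<in> gcarrier ?B l" for x y y' k l
    using that by (auto simp: axioms_deg)
  show "gmul ?B k l (r \<odot>\<^bsub>gpiece ?B k\<^esub> x) y = r \<odot>\<^bsub>gpiece ?B (k + l)\<^esub> gmul ?B k l x y"
    "gmul ?B k l x (r \<odot>\<^bsub>gpiece ?B l\<^esub> y) = r \<odot>\<^bsub>gpiece ?B (k + l)\<^esub> gmul ?B k l x y"
    if "x \<in> gcarrier ?B k" "y \<in> gcarrier ?B l" for x y k l r
    using that by (auto simp: axioms_deg)
  show "gmul ?B (k + l) j (gmul ?B k l x y) w = gmul ?B k (l + j) x (gmul ?B l j y w)"
    if "x \<in> gcarrier ?B k" "y \<in> gcarrier ?B l" "w \<in> gcarrier ?B j" for x y w k l j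
    using that by (auto simp: axioms_deg)
  show "gone ?B \<in> gcarrier ?B 0" by (simp add: one_closed)
  show "gmul ?B 0 k (gone ?B) x = x" "gmul ?B k 0 x (gone ?B) = x" if "x \<in> gcarrier ?B k" for x k
    using that by (auto simp: mul_one_left mul_one_right mul_zero_left mul_zero_right piece_zero
        piece_smult smult_zero one_closed)
  show "gmul ?B k l x y = ((-1) powi (k * l)) \<odot>\<^bsub>gpiece ?B (k + l)\<^esub> gmul ?B l k y x"
    if "x \<in> gcarrier ?B k" "y \<in> gcarrier ?B l" for x y k l
  proof -
    from that obtain a a' b b' where eqs: "x = (a, a')" "y = (b, b')"
      and mem: "a \<in> gcarrier A k" "a' \<in> gcarrier A (k - m)" "b \<in> gcarrier A l"
        "b' \<in> gcarrier A (l - m)" by auto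
    show ?thesis
      using m mem mul_comm_deg[of a k b l] mul_comm_deg[of a k b' "l - m"]
        mul_comm_deg[of a' "k - m" b l]
      by (auto simp: eqs axioms_deg)
  qed
  show "gdiff ?B k x \<in> gcarrier ?B (k + 1)" if "x \<in> gcarrier ?B k" for x k
    using that z by (auto simp: axioms_deg)
  show "gdiff ?B k (x \<oplus>\<^bsub>gpiece ?B k\<^esub> y) = gdiff ?B k x \<oplus>\<^bsub>gpiece ?B (k + 1)\<^esub> gdiff ?B k y"
    if "x \<in> gcarrier ?B k" "y \<in> gcarrier ?B k" for x y k
    using that z by (auto simp: axioms_deg)
  show "gdiff ?B k (r \<odot>\<^bsub>gpiece ?B k\<^esub> x) = r \<odot>\<^bsub>gpiece ?B (k + 1)\<^esub> gdiff ?B k x"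
    if "x \<in> gcarrier ?B k" for x k r
    using that z by (auto simp: axioms_deg)
  show "gdiff ?B (k + 1) (gdiff ?B k x) = \<zero>\<^bsub>gpiece ?B (k + 2)\<^esub>" if "x \<in> gcarrier ?B k" for x k
    using that z m dz by (auto simp: axioms_deg mul_zero_left piece_zero piece_cancel smult_zero)
  show "gdiff ?B (k + l) (gmul ?B k l x y) = gmul ?B (k + 1) l (gdiff ?B k x) y
      \<oplus>\<^bsub>gpiece ?B (k + l + 1)\<^esub> ((-1) powi k) \<odot>\<^bsub>gpiece ?B (k + l + 1)\<^esub> gmul ?B k (l + 1) x (gdiff ?B l y)"
    if "x \<in> gcarrier ?B k" "y \<in> gcarrier ?B l" for x y k l
  proof -
    from that obtain a a' b b' where eqs: "x = (a, a')" "y = (b, b')"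
      and mem: "a \<in> gcarrier A k" "a' \<in> gcarrier A (k - m)" "b \<in> gcarrier A l"
        "b' \<in> gcarrier A (l - m)" by auto
    show ?thesis
      using m mem z by (auto simp: eqs axioms_deg piece_cancel piece_cancel_last even_central_left[where w = z])
  qed
qed

lemma cdga_hom_zero:
  assumes "is_cdga A" "is_cdga B" "f \<in> cdga_hom A B"
  shows "f k \<zero>\<^bsub>gpiece A k\<^esub> = \<zero>\<^bsub>gpiece B k\<^esub>"
proof -
  have zero: "\<zero>\<^bsub>gpiece A k\<^esub> \<in> gcarrier A k" using is_cdga.piece_closed(3)[OF assms(1)] .
  have "f k (0 \<odot>\<^bsub>gpiece A k\<^esub> \<zero>\<^bsub>gpiece A k\<^esub>) = 0 \<odot>\<^bsub>gpiece B k\<^esub> f k \<zero>\<^bsub>gpiece A k\<^esub>"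
    using cdga_homD(4)[OF assms(3) zero] .
  then show ?thesis
    using zero cdga_homD(2)[OF assms(3) zero] by (simp add: is_cdga.piece_smult assms(1,2))
qed

text \<open>A homomorphism that maps \<open>z\<close> to \<open>z'\<close> extends by \<open>\<theta> \<mapsto> \<theta>'\<close>; this is how pullbacks act on cones.\<close>

lemma adjoin_map_hom:
  assumes A: "is_cdga A" and B: "is_cdga B" and f: "f \<in> cdga_hom A B"
    and z: "z \<in> gcarrier A (m + 1)" and fz: "f (m + 1) z = z'"
  shows "(\<lambda>k. \<lambda>(a, b)\<in>gcarrier (adjoin A m z) k. (f k a, f (k - m) b))
    \<in> cdga_hom (adjoin A m z) (adjoin B m z')"
proof -
  interpret A: is_cdga A by fact
  interpret B: is_cdga B by fact
  note f_simps = cdga_homD(2-)[OF f] cdga_hom_zero[OF A B f]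
  have f_mul: "f p (gmul A k l a b) = gmul B k l (f k a) (f l b)"
    if "a \<in> gcarrier A k" "b \<in> gcarrier A l" "p = k + l" for p k l a b
    using that cdga_homD(5)[OF f] by simp
  have f_diff: "f p (gdiff A k a) = gdiff B k (f k a)" if "a \<in> gcarrier A k" "p = k + 1" for p k a
    using that cdga_homD(7)[OF f] by simp
  show ?thesis
    unfolding cdga_hom_def
    using z fz
    by (auto simp: f_simps f_mul f_diff A.one_closed A.mul_closed_deg A.diff_closed_deg A.piece_smult
        B.piece_smult B.diff_closed_deg algebra_simps)
qed

text \<open>If \<open>d\<theta>' = w z\<close> and \<open>d\<theta> = z\<close> with a central cocycle \<open>w\<close>, then \<open>\<theta>' \<mapsto> \<theta>w\<close> is compatible with the
  differentials because \<open>d(\<theta>w) = z w\<close>. For \<open>w = \<omega>\<close> and \<open>z\<close> a power of \<open>\<omega>\<close> this is the map \<open>q\<close>.\<close>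

lemma (in is_cdga) adjoin_mul_hom:
  assumes e: "even e" and w: "w \<in> gcarrier A e" and dw: "gdiff A e w = \<zero>\<^bsub>gpiece A (e + 1)\<^esub>"
    and z: "z \<in> gcarrier A (m + 1)"
  shows "(\<lambda>k. \<lambda>(a, b)\<in>gcarrier (adjoin A (m + e) (gmul A e (m + 1) w z)) k. (a, gmul A (k - (m + e)) e b w))
    \<in> cdga_hom (adjoin A (m + e) (gmul A e (m + 1) w z)) (adjoin A m z)"
proof -
  show ?thesis
    unfolding cdga_hom_def
    using w dw z e
    by (auto simp: one_closed even_central[OF e w] even_central_left[OF e w] axioms_deg
        mul_zero_right mul_zero_left piece_zero smult_zero)
qed

section \<open>Smooth functions on open subsets of Euclidean space\<close>

abbreviation Rn :: "nat \<Rightarrow> rvec set" where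
  "Rn n \<equiv> topspace (Euclidean_space n)"

abbreviation open_Rn :: "nat \<Rightarrow> rvec set \<Rightarrow> bool" where
  "open_Rn n \<equiv> openin (Euclidean_space n)"

abbreviation has_partial :: "nat \<Rightarrow> (rvec \<Rightarrow> real) \<Rightarrow> real \<Rightarrow> rvec \<Rightarrow> bool" where
  "has_partial i f D x \<equiv> ((\<lambda>t. f (x(i := t))) has_real_derivative D) (at (x i))"

lemma Euclidean_space_top_of_set: "Euclidean_space n = top_of_set {x. \<forall>i\<ge>n. x i = 0}"
  by (simp add: Euclidean_space_def euclidean_product_topology)

lemma Rn_iff: "x \<in> Rn n \<longleftrightarrow> (\<forall>i\<ge>n. x i = 0)"
  by (simp add: topspace_Euclidean_space)

lemma Rn_upd: "\<lbrakk>x \<in> Rn n; i < n\<rbrakk> \<Longrightarrow> x(i := t) \<in> Rn n"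
  by (auto simp: Rn_iff)

lemma openin_Euclidean_subset: "open_Rn n V \<Longrightarrow> V \<subseteq> Rn n"
  by (rule openin_subset)

lemma continuous_map_Euclidean_iff:
  assumes "V \<subseteq> Rn n"
  shows "continuous_map (subtopology (Euclidean_space n) V) euclideanreal f \<longleftrightarrow> continuous_on V f"
  using assms by (simp add: Euclidean_space_top_of_set subtopology_subtopology inf_absorb2)

text \<open>A basic open set of the product topology restricts finitely many coordinates, and from index \<open>n\<close>
  on the points of \<open>\<real>\<^sup>n\<close> agree. Hence the open boxes in the first \<open>n\<close> coordinates suffice.\<close>

lemma openin_Euclidean_box:
  assumes "open_Rn n V" "x \<in> V"
  obtains e where "e > 0" "\<And>y. \<lbrakk>y \<in> Rn n; \<And>i. i < n \<Longrightarrow> \<bar>y i - x i\<bar> < e\<rbrakk> \<Longrightarrow> y \<in> V"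
proof -
  obtain T where T: "openin (powertop_real UNIV) T" and V: "V = T \<inter> Rn n"
    using assms(1) by (auto simp: Euclidean_space_def openin_subtopology topspace_Euclidean_space)
  obtain X where X: "x \<in> (\<Pi>\<^sub>E i\<in>UNIV. X i)" "\<And>i. open (X i)" "(\<Pi>\<^sub>E i\<in>UNIV. X i) \<subseteq> T"
    using product_topology_open_contains_basis[OF T, of x] assms(2) V by auto
  have "\<exists>e>0. ball (x i) e \<subseteq> X i" for i
    using X(1,2) open_contains_ball by (metis PiE_mem UNIV_I)
  then obtain e where e: "\<And>i. e i > 0" "\<And>i. ball (x i) (e i) \<subseteq> X i" by metis
  define d where "d = Min (insert 1 (e ` {..<n}))"
  have d: "d > 0" "\<And>i. i < n \<Longrightarrow> d \<le> e i" using e(1) by (auto simp: d_def)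
  have "y \<in> V" if y: "y \<in> Rn n" "\<And>i. i < n \<Longrightarrow> \<bar>y i - x i\<bar> < d" for y
  proof -
    have "y i \<in> X i" for i
    proof (cases "i < n")
      case True
      then show ?thesis using y(2)[of i] d(2)[of i] e(2)[of i] by (auto simp: dist_real_def)
    next
      case False
      then have "y i = x i" using y(1) assms(2) V by (auto simp: Rn_iff)
      then show ?thesis using X(1) by auto
    qed
    then show ?thesis using X(3) y(1) V by auto
  qed
  with d(1) that show thesis by blast
qed

lemma continuous_on_Euclidean_box:
  assumes "open_Rn n V" "continuous_on V g" "x \<in> V" "(\<epsilon>::real) > 0"
  obtains e where "e > 0"
    "\<And>y. \<lbrakk>y \<in> Rn n; \<And>i. i < n \<Longrightarrow> \<bar>y i - x i\<bar> < e\<rbrakk> \<Longrightarrow> y \<in> V \<and> \<bar>g y - g x\<bar> < \<epsilon>"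
proof -
  let ?U = "V \<inter> g -` ball (g x) \<epsilon>"
  have "openin (top_of_set V) ?U"
    using assms(2) by (rule continuous_openin_preimage_gen) simp
  then have "open_Rn n ?U"
    using assms(1) openin_trans by (auto simp: Euclidean_space_top_of_set)
  moreover have "x \<in> ?U" using assms by simp
  ultimately obtain e where "e > 0"
    "\<And>y. \<lbrakk>y \<in> Rn n; \<And>i. i < n \<Longrightarrow> \<bar>y i - x i\<bar> < e\<rbrakk> \<Longrightarrow> y \<in> ?U"
    using openin_Euclidean_box by metis
  then show thesis
    by (intro that[of e]) (auto simp: dist_real_def abs_minus_commute)
qed

lemma eventually_upd_in:
  assumes "open_Rn n V" "x \<in> V" "i < n"
  shows "\<forall>\<^sub>F t in nhds (x i). x(i := t) \<in> V"
proof -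
  obtain e where e: "e > 0" "\<And>y. \<lbrakk>y \<in> Rn n; \<And>j. j < n \<Longrightarrow> \<bar>y j - x j\<bar> < e\<rbrakk> \<Longrightarrow> y \<in> V"
    using openin_Euclidean_box[OF assms(1,2)] by metis
  have "x \<in> Rn n" using assms openin_Euclidean_subset by blast
  then have "x(i := t) \<in> V" if "dist t (x i) < e" for t
    using that e(1) assms(3) by (intro e(2)) (auto simp: Rn_upd dist_real_def)
  then show ?thesis unfolding eventually_nhds_metric using e(1) by blast
qed

lemma pderivative_cong:
  assumes "open_Rn n V" "x \<in> V" "i < n" "\<And>y. y \<in> V \<Longrightarrow> f y = g y"
  shows "pderivative i f x = pderivative i g x"
  unfolding pderivative_def
  by (rule deriv_cong_ev[OF _ refl])
    (use eventually_upd_in[OF assms(1-3)] assms(4) in \<open>auto elim: eventually_mono\<close>)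

lemma has_partial_cong:
  assumes "open_Rn n V" "x \<in> V" "i < n" "\<And>y. y \<in> V \<Longrightarrow> f y = g y"
    and "has_partial i f D x"
  shows "has_partial i g D x"
proof -
  have "\<forall>\<^sub>F t in nhds (x i). f (x(i := t)) = g (x(i := t))"
    using eventually_upd_in[OF assms(1-3)] assms(4) by (auto elim: eventually_mono)
  then show ?thesis using assms(5) DERIV_cong_ev[OF refl _ refl] by fast
qed

lemma has_partial_imp_pderivative:
  "has_partial i f D x \<Longrightarrow> pderivative i f x = D"
  unfolding pderivative_def by (rule DERIV_imp_deriv)

lemma iter_pderivative_snoc:
  "iter_pderivative (is @ [i]) f = iter_pderivative is (pderivative i f)"
  by (induction "is") auto

lemma smooth_fun_continuous:
  "\<lbrakk>smooth_fun n V f; open_Rn n V\<rbrakk> \<Longrightarrow> continuous_on V f"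
  unfolding smooth_fun_def using openin_Euclidean_subset
  by (fastforce simp: continuous_map_Euclidean_iff dest: spec[of _ "[]"])

lemma smooth_fun_has_partial:
  assumes "smooth_fun n V f" "i < n" "x \<in> V"
  shows "has_partial i f (pderivative i f x) x"
proof -
  have "(\<lambda>t. f (x(i := t))) field_differentiable at (x i)"
    using assms unfolding smooth_fun_def by (auto dest!: spec[of _ "[]"])
  then show ?thesis unfolding pderivative_def by (simp add: field_differentiable_derivI)
qed

lemma smooth_fun_pderivative:
  assumes "smooth_fun n V f" "i < n"
  shows "smooth_fun n V (pderivative i f)"
  unfolding smooth_fun_def
proof (intro allI impI)
  fix "is" assume "set is \<subseteq> {..<n}"
  then have "set (is @ [i]) \<subseteq> {..<n}" using assms(2) by auto
  then show "continuous_map (subtopology (Euclidean_space n) V) euclideanreal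
      (iter_pderivative is (pderivative i f)) \<and>
    (\<forall>j<n. \<forall>x\<in>V. (\<lambda>t. iter_pderivative is (pderivative i f) (x(j := t))) field_differentiable at (x j))"
    using assms(1) unfolding smooth_fun_def iter_pderivative_snoc[symmetric] by blast
qed

text \<open>Smoothness is the greatest property that implies continuity and existence of the partial
  derivatives and passes on to these.\<close>

lemma smooth_fun_coinduct:
  assumes V: "open_Rn n V" and "S f"
    and cont: "\<And>f. S f \<Longrightarrow> continuous_on V f"
    and diff: "\<And>f i. \<lbrakk>S f; i < n\<rbrakk> \<Longrightarrow> \<exists>g. S g \<and>
      (\<forall>x\<in>V. has_partial i f (g x) x)"
  shows "smooth_fun n V f"
proof -
  have iter: "\<exists>g. S g \<and> (\<forall>x\<in>V. iter_pderivative is f x = g x)" if "set is \<subseteq> {..<n}" for "is"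
    using that
  proof (induction "is")
    case Nil
    then show ?case using \<open>S f\<close> by auto
  next
    case (Cons i "is")
    then obtain g where g: "S g" "\<And>x. x \<in> V \<Longrightarrow> iter_pderivative is f x = g x" and i: "i < n" by auto
    obtain h where "S h" "\<And>x. x \<in> V \<Longrightarrow> has_partial i g (h x) x"
      using diff[OF g(1) i] by blast
    moreover from this(2) have "\<forall>x\<in>V. iter_pderivative (i # is) f x = h x"
      using pderivative_cong[OF V _ i g(2)] has_partial_imp_pderivative by simp
    ultimately show ?case by auto
  qed
  show ?thesis
    unfolding smooth_fun_def
  proof (intro allI impI conjI ballI)
    fix "is" assume "set is \<subseteq> {..<n}"
    then obtain g where g: "S g" "\<And>x. x \<in> V \<Longrightarrow> iter_pderivative is f x = g x" using iter by blast
    then have "continuous_on V (iter_pderivative is f)"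
      using cont[OF g(1)] by (simp cong: continuous_on_cong)
    then show "continuous_map (subtopology (Euclidean_space n) V) euclideanreal (iter_pderivative is f)"
      using openin_Euclidean_subset[OF V] by (simp add: continuous_map_Euclidean_iff)
    fix i x assume i: "i < n" and x: "x \<in> V"
    obtain D where "has_partial i g D x"
      using diff[OF g(1) i] x by blast
    then have "((\<lambda>t. iter_pderivative is f (x(i := t))) has_real_derivative D) (at (x i))"
      using has_partial_cong[OF V x i, of g "iter_pderivative is f"] g(2) by simp
    then show "(\<lambda>t. iter_pderivative is f (x(i := t))) field_differentiable at (x i)"
      by (auto simp: field_differentiable_def)
  qed
qed

text \<open>Continuity and partial derivatives at a point depend only on the values near it, and so do their
  iterations.\<close>

lemma smooth_fun_locally_eq:
  assumes V: "open_Rn n V"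
    and loc: "\<And>x. x \<in> V \<Longrightarrow> \<exists>U g. open_Rn n U \<and> x \<in> U \<and> smooth_fun n U g \<and>
      (\<forall>y\<in>U \<inter> V. g y = f y)"
  shows "smooth_fun n V f"
proof -
  define S where "S f \<longleftrightarrow> (\<forall>x\<in>V. \<exists>U g. open_Rn n U \<and> x \<in> U \<and> smooth_fun n U g \<and>
    (\<forall>y\<in>U \<inter> V. g y = f y))" for f
  have SE: "thesis" if "S f" "x \<in> V" "\<And>U g. \<lbrakk>open_Rn n U; x \<in> U; smooth_fun n U g;
      \<forall>y\<in>U \<inter> V. g y = f y\<rbrakk> \<Longrightarrow> thesis" for f x thesis
    using that unfolding S_def by meson
  show ?thesis
  proof (rule smooth_fun_coinduct[OF V])
    show "S f" unfolding S_def using loc by simp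
  next
    fix f assume f: "S f"
    show "continuous_on V f"
      unfolding continuous_on_eq_continuous_within
    proof
      fix x assume x: "x \<in> V"
      with f obtain U g where U: "open_Rn n U" "x \<in> U"
        and g: "smooth_fun n U g" "\<forall>y\<in>U \<inter> V. g y = f y"
        by (rule SE)
      have "open_Rn n (U \<inter> V)" using U(1) V by (rule openin_Int)
      then obtain T where T: "open T" "U \<inter> V = Rn n \<inter> T"
        by (auto simp: Euclidean_space_top_of_set openin_open)
      have "continuous_on (U \<inter> V) g"
        using smooth_fun_continuous[OF g(1) U(1)] by (rule continuous_on_subset) simp
      then have "continuous_on (U \<inter> V) f" using continuous_on_cong[of "U \<inter> V" "U \<inter> V" g f] g(2) by simp
      then have "continuous (at x within U \<inter> V) f"
        using U(2) x continuous_on_eq_continuous_within by blast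
      moreover have "at x within V = at x within U \<inter> V"
        by (rule at_within_nhd[of x T]) (use U x T openin_Euclidean_subset[OF V] in auto)
      ultimately show "continuous (at x within V) f" by simp
    qed
  next
    fix f i assume f: "S f" and i: "i < n"
    have part: "has_partial i f (pderivative i g y) y"
      if "open_Rn n U" "smooth_fun n U g" "\<forall>y\<in>U \<inter> V. g y = f y" "y \<in> U \<inter> V" for U g y
      by (rule has_partial_cong[OF openin_Int[OF that(1) V] that(4) i bspec[OF that(3)]
            smooth_fun_has_partial[OF that(2) i]]) (use that(4) in auto)
    show "\<exists>g. S g \<and> (\<forall>x\<in>V. has_partial i f (g x) x)"
    proof (intro exI[of _ "pderivative i f"] conjI ballI)
      show "S (pderivative i f)"
        unfolding S_def
      proof
        fix x assume "x \<in> V"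
        with f obtain U g where U: "open_Rn n U" "x \<in> U"
          and g: "smooth_fun n U g" "\<forall>y\<in>U \<inter> V. g y = f y"
          by (rule SE)
        have "\<forall>y\<in>U \<inter> V. pderivative i g y = pderivative i f y"
        proof
          fix y assume "y \<in> U \<inter> V"
          from has_partial_imp_pderivative[OF part[OF U(1) g this]]
          show "pderivative i g y = pderivative i f y" by simp
        qed
        then show "\<exists>U g. open_Rn n U \<and> x \<in> U \<and> smooth_fun n U g \<and>
            (\<forall>y\<in>U \<inter> V. g y = pderivative i f y)"
          using U smooth_fun_pderivative[OF g(1) i] by (intro exI[of _ U] exI[of _ "pderivative i g"]) simp
      qed
      fix x assume x: "x \<in> V"
      with f obtain U g where U: "open_Rn n U" "x \<in> U"
        and g: "smooth_fun n U g" "\<forall>y\<in>U \<inter> V. g y = f y"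
        by (rule SE)
      have "has_partial i f (pderivative i g x) x"
        using part[OF U(1) g] U(2) x by simp
      then show "has_partial i f (pderivative i f x) x"
        using has_partial_imp_pderivative by fastforce
    qed
  qed
qed

lemma smooth_fun_cong:
  assumes "open_Rn n V" "smooth_fun n V f" "\<And>x. x \<in> V \<Longrightarrow> f x = g x"
  shows "smooth_fun n V g"
  using assms(1) by (rule smooth_fun_locally_eq) (use assms in \<open>intro exI[of _ V] exI[of _ f], simp\<close>)

lemma smooth_fun_subset:
  assumes "smooth_fun n V f" "open_Rn n V" "open_Rn n U" "U \<subseteq> V"
  shows "smooth_fun n U f"
  using assms(3) by (rule smooth_fun_locally_eq) (use assms in \<open>intro exI[of _ V] exI[of _ f], auto\<close>)

lemma smooth_fun_local:
  assumes V: "open_Rn n V"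
    and loc: "\<And>x. x \<in> V \<Longrightarrow> \<exists>U. open_Rn n U \<and> x \<in> U \<and> smooth_fun n U f"
  shows "smooth_fun n V f"
  using V
proof (rule smooth_fun_locally_eq)
  fix x assume "x \<in> V"
  from loc[OF this] obtain U where "open_Rn n U \<and> x \<in> U \<and> smooth_fun n U f" by (rule exE)
  then show "\<exists>U g. open_Rn n U \<and> x \<in> U \<and> smooth_fun n U g \<and> (\<forall>y\<in>U \<inter> V. g y = f y)"
    by (intro exI[of _ U] exI[of _ f]) simp
qed

lemma MVT_between:
  fixes f :: "real \<Rightarrow> real"
  assumes "\<And>x. \<lbrakk>min a b \<le> x; x \<le> max a b\<rbrakk> \<Longrightarrow> (f has_real_derivative f' x) (at x)"
  obtains z where "min a b \<le> z" "z \<le> max a b" "f b - f a = (b - a) * f' z"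
proof (cases a b rule: linorder_cases)
  case less
  then obtain z where "a < z" "z < b" "f b - f a = (b - a) * f' z"
    using MVT2[of a b f f'] assms by auto
  then show ?thesis using that[of z] less by simp
next
  case equal
  then show ?thesis using that[of a] by simp
next
  case greater
  then obtain z where "b < z" "z < a" "f a - f b = (a - b) * f' z"
    using MVT2[of b a f f'] assms by auto
  then show ?thesis using that[of z] greater by (simp add: algebra_simps)
qed

text \<open>One step of the chain rule: only the coordinate \<open>k\<close> is differentiated, the others merely
  converge. By the mean value theorem the difference quotient is that of \<open>s\<close> times a value of
  \<open>\<partial>\<^sub>k f\<close> at a point close to \<open>p\<close>.\<close>

lemma chain_rule_step:
  assumes V: "open_Rn m V" and p: "p \<in> V" and k: "k < m"
    and part: "\<And>y. y \<in> V \<Longrightarrow> has_partial k f (g y) y"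
    and cont: "continuous_on V g"
    and \<phi>: "\<And>t. \<phi> t \<in> Rn m" "\<And>j. j < m \<Longrightarrow> (\<lambda>t. \<phi> t j) \<midarrow>t0\<rightarrow> p j"
    and s: "(s has_real_derivative s') (at t0)" "s t0 = p k"
    and \<phi>0: "\<phi> t0 = p"
  shows "((\<lambda>t. f ((\<phi> t)(k := s t)) - f ((\<phi> t)(k := p k))) has_real_derivative g p * s') (at t0)"
proof -
  let ?F = "\<lambda>t. f ((\<phi> t)(k := s t)) - f ((\<phi> t)(k := p k))"
  have s_lim: "s \<midarrow>t0\<rightarrow> p k" using DERIV_isCont[OF s(1)] s(2) by (simp add: isCont_def)
  have near: "\<forall>\<^sub>F t in at t0. (\<forall>j<m. \<bar>\<phi> t j - p j\<bar> < e) \<and> \<bar>s t - p k\<bar> < e" if "e > 0" for e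
  proof -
    have "\<forall>\<^sub>F t in at t0. \<forall>j\<in>{..<m}. \<bar>\<phi> t j - p j\<bar> < e"
      using tendstoD[OF \<phi>(2) that] by (intro eventually_ball_finite) (auto simp: dist_real_def)
    moreover have "\<forall>\<^sub>F t in at t0. \<bar>s t - p k\<bar> < e"
      using tendstoD[OF s_lim that] by (simp add: dist_real_def)
    ultimately show ?thesis by eventually_elim auto
  qed
  obtain e0 where e0: "e0 > 0" "\<And>y. \<lbrakk>y \<in> Rn m; \<And>j. j < m \<Longrightarrow> \<bar>y j - p j\<bar> < e0\<rbrakk> \<Longrightarrow> y \<in> V"
    using openin_Euclidean_box[OF V p] by metis
  define good where "good t z \<longleftrightarrow> \<bar>z - p k\<bar> \<le> \<bar>s t - p k\<bar> \<and> ?F t = (s t - p k) * g ((\<phi> t)(k := z))" for t z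
  have ex: "\<exists>z. good t z" if t: "\<forall>j<m. \<bar>\<phi> t j - p j\<bar> < e0" "\<bar>s t - p k\<bar> < e0" for t
  proof -
    have "((\<lambda>u. f ((\<phi> t)(k := u))) has_real_derivative g ((\<phi> t)(k := u))) (at u)"
      if u: "min (p k) (s t) \<le> u" "u \<le> max (p k) (s t)" for u
    proof -
      have "(\<phi> t)(k := u) \<in> V"
      proof (rule e0(2))
        show "(\<phi> t)(k := u) \<in> Rn m" using \<phi>(1) k by (rule Rn_upd)
        show "\<bar>((\<phi> t)(k := u)) j - p j\<bar> < e0" if "j < m" for j
          using t u that by (auto simp: abs_if min_def max_def split: if_splits)
      qed
      from part[OF this] show ?thesis by simp
    qed
    then obtain z where "min (p k) (s t) \<le> z" "z \<le> max (p k) (s t)"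
      "f ((\<phi> t)(k := s t)) - f ((\<phi> t)(k := p k)) = (s t - p k) * g ((\<phi> t)(k := z))"
      using MVT_between[of "p k" "s t" "\<lambda>u. f ((\<phi> t)(k := u))" "\<lambda>u. g ((\<phi> t)(k := u))"] by metis
    then have "good t z" by (auto simp: good_def abs_if min_def max_def split: if_splits)
    then show ?thesis ..
  qed
  define z where "z t = (SOME z. good t z)" for t
  have z: "\<forall>\<^sub>F t in at t0. good t (z t)"
    using near[OF e0(1)] by eventually_elim (use ex in \<open>auto simp: z_def intro: someI_ex\<close>)
  have "(\<lambda>t. g ((\<phi> t)(k := z t))) \<midarrow>t0\<rightarrow> g p"
  proof (rule tendstoI)
    fix \<epsilon> :: real assume "\<epsilon> > 0"
    then obtain e where e: "e > 0"
      "\<And>y. \<lbrakk>y \<in> Rn m; \<And>j. j < m \<Longrightarrow> \<bar>y j - p j\<bar> < e\<rbrakk> \<Longrightarrow> y \<in> V \<and> \<bar>g y - g p\<bar> < \<epsilon>"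
      using continuous_on_Euclidean_box[OF V cont p] by metis
    show "\<forall>\<^sub>F t in at t0. dist (g ((\<phi> t)(k := z t))) (g p) < \<epsilon>"
      using near[OF e(1)] z
    proof eventually_elim
      case (elim t)
      then have "\<bar>g ((\<phi> t)(k := z t)) - g p\<bar> < \<epsilon>"
        using e(2)[of "(\<phi> t)(k := z t)"] Rn_upd[OF \<phi>(1) k] by (auto simp: good_def)
      then show ?case by (simp add: dist_real_def)
    qed
  qed
  moreover have "(\<lambda>t. (s t - p k) / (t - t0)) \<midarrow>t0\<rightarrow> s'"
    using s by (simp add: has_field_derivative_iff)
  ultimately have lim: "(\<lambda>t. g ((\<phi> t)(k := z t)) * ((s t - p k) / (t - t0))) \<midarrow>t0\<rightarrow> g p * s'"
    by (rule tendsto_mult)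
  have F0: "?F t0 = 0" using s(2) \<phi>0 by simp
  have "\<forall>\<^sub>F t in at t0. g ((\<phi> t)(k := z t)) * ((s t - p k) / (t - t0)) = (?F t - ?F t0) / (t - t0)"
    using z by eventually_elim (simp only: F0, simp add: good_def)
  then have "(\<lambda>t. (?F t - ?F t0) / (t - t0)) \<midarrow>t0\<rightarrow> g p * s'"
    using lim by (simp only: tendsto_cong)
  then show ?thesis by (simp only: has_field_derivative_iff)
qed

text \<open>The path is followed one coordinate at a time: \<open>h k t\<close> uses the first \<open>k\<close> coordinates of \<open>\<gamma> t\<close> and
  the remaining ones of \<open>\<gamma> t0\<close>. The step from \<open>h k\<close> to \<open>h (Suc k)\<close> contributes the \<open>k\<close>-th summand.\<close>

theorem chain_rule_path:
  assumes V: "open_Rn m V" and \<gamma>0: "\<gamma> t0 \<in> V"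
    and f: "smooth_fun m V f"
    and \<gamma>: "\<forall>\<^sub>F t in nhds t0. \<gamma> t \<in> Rn m"
      "\<And>j. j < m \<Longrightarrow> ((\<lambda>t. \<gamma> t j) has_real_derivative \<gamma>' j) (at t0)"
  shows "((\<lambda>t. f (\<gamma> t)) has_real_derivative (\<Sum>j<m. pderivative j f (\<gamma> t0) * \<gamma>' j)) (at t0)"
proof -
  let ?p = "\<gamma> t0"
  define h where "h k t = (\<lambda>i. if i < k then \<gamma> t i else ?p i)" for k t
  have p: "?p \<in> Rn m" using \<gamma>0 openin_Euclidean_subset[OF V] by blast
  have h_lim: "(\<lambda>t. h k t j) \<midarrow>t0\<rightarrow> ?p j" if "j < m" for k j
    using DERIV_isCont[OF \<gamma>(2)[OF that]] by (cases "j < k") (simp_all add: h_def isCont_def)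
  have "((\<lambda>t. f (h k t)) has_real_derivative (\<Sum>j<k. pderivative j f ?p * \<gamma>' j)) (at t0)" if "k \<le> m" for k
    using that
  proof (induction k)
    case 0
    then show ?case by (simp add: h_def)
  next
    case (Suc k)
    have "((\<lambda>t. f ((h k t)(k := \<gamma> t k)) - f ((h k t)(k := ?p k))) has_real_derivative
        pderivative k f ?p * \<gamma>' k) (at t0)"
    proof (rule chain_rule_step[OF V \<gamma>0, where g = "pderivative k f"])
      show "has_partial k f (pderivative k f y) y" if "y \<in> V" for y
        using smooth_fun_has_partial[OF f _ that] Suc.prems by simp
      show "continuous_on V (pderivative k f)"
        using smooth_fun_continuous[OF smooth_fun_pderivative[OF f] V] Suc.prems by simp
      show "h k t \<in> Rn m" for t using p Suc.prems by (auto simp: h_def Rn_iff)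
    qed (use Suc.prems \<gamma>(2) h_lim in \<open>auto simp: h_def\<close>)
    moreover have "(h k t)(k := \<gamma> t k) = h (Suc k) t" "(h k t)(k := ?p k) = h k t" for t
      by (auto simp: h_def fun_eq_iff)
    ultimately have "((\<lambda>t. f (h (Suc k) t) - f (h k t)) has_real_derivative pderivative k f ?p * \<gamma>' k) (at t0)"
      by simp
    from DERIV_add[OF this Suc.IH] show ?case using Suc.prems by (simp add: add.commute)
  qed
  from this[of m] have "((\<lambda>t. f (h m t)) has_real_derivative (\<Sum>j<m. pderivative j f ?p * \<gamma>' j)) (at t0)"
    by simp
  moreover have "\<forall>\<^sub>F t in nhds t0. f (h m t) = f (\<gamma> t)"
    using \<gamma>(1)
  proof eventually_elim
    case (elim t)
    then have "h m t = \<gamma> t" using p by (auto simp: h_def Rn_iff fun_eq_iff)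
    then show ?case by simp
  qed
  ultimately show ?thesis using DERIV_cong_ev[OF refl _ refl] by fast
qed

text \<open>The mean value theorem, applied in the first and then in the second variable, expresses the
  double difference of \<open>F\<close> by the mixed derivative at a nearby point.\<close>

lemma double_difference:
  fixes F :: "real \<Rightarrow> real \<Rightarrow> real"
  assumes h: "0 < h" "h < e"
    and G: "\<And>s t. \<lbrakk>\<bar>s - a\<bar> < e; \<bar>t - b\<bar> < e\<rbrakk> \<Longrightarrow> ((\<lambda>s. F s t) has_real_derivative G s t) (at s)"
    and H: "\<And>s t. \<lbrakk>\<bar>s - a\<bar> < e; \<bar>t - b\<bar> < e\<rbrakk> \<Longrightarrow> ((\<lambda>t. G s t) has_real_derivative H s t) (at t)"
  obtains s t where "\<bar>s - a\<bar> \<le> h" "\<bar>t - b\<bar> \<le> h"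
    "F (a + h) (b + h) - F (a + h) b - F a (b + h) + F a b = h * h * H s t"
proof -
  have "((\<lambda>s. F s (b + h) - F s b) has_real_derivative G s (b + h) - G s b) (at s)"
    if "a \<le> s" "s \<le> a + h" for s
    using that h by (intro DERIV_diff G) auto
  then obtain s where s: "a < s" "s < a + h"
    "(F (a + h) (b + h) - F (a + h) b) - (F a (b + h) - F a b) = h * (G s (b + h) - G s b)"
    using MVT2[of a "a + h" "\<lambda>s. F s (b + h) - F s b" "\<lambda>s. G s (b + h) - G s b"] h(1) by auto
  have "((\<lambda>t. G s t) has_real_derivative H s t) (at t)" if "b \<le> t" "t \<le> b + h" for t
    using that h s by (intro H) auto
  then obtain t where t: "b < t" "t < b + h" "G s (b + h) - G s b = h * H s t"
    using MVT2[of b "b + h" "G s" "H s"] h(1) by auto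
  show thesis using s t by (intro that[of s t]) (auto simp: algebra_simps)
qed

text \<open>The double difference is symmetric in the two variables, so in every neighbourhood of \<open>x\<close> the two
  mixed derivatives share a value (possibly at different points); both are continuous at \<open>x\<close>.\<close>

lemma mixed_pderivative_commute:
  assumes V: "open_Rn n V" and x: "x \<in> V" and f: "smooth_fun n V f"
    and ij: "i < n" "j < n"
  shows "pderivative i (pderivative j f) x = pderivative j (pderivative i f) x"
proof (cases "i = j")
  case False
  define P where "P s t = x(i := s, j := t)" for s t
  let ?fij = "pderivative i (pderivative j f)" and ?fji = "pderivative j (pderivative i f)"
  have P_swap: "P s t = x(j := t, i := s)" for s t using False by (auto simp: P_def)
  have P_coords: "P s t i = s" "P s t j = t" for s t using False by (auto simp: P_def)
  have P_upd: "(P s t)(i := s') = P s' t" "(P s t)(j := t') = P s t'" for s t s' t'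
    using False by (auto simp: P_def)
  have P_x: "P (x i) (x j) = x" by (auto simp: P_def)
  have P_Rn: "P s t \<in> Rn n" for s t
    using x openin_Euclidean_subset[OF V] ij by (auto simp: P_def intro!: Rn_upd)
  have near: "\<bar>P s t k - x k\<bar> < d" if "\<bar>s - x i\<bar> < d" "\<bar>t - x j\<bar> < d" for s t d k
    using that by (auto simp: P_def)
  have cont: "continuous_on V ?fij" "continuous_on V ?fji"
    using f ij V by (auto intro!: smooth_fun_continuous smooth_fun_pderivative)
  have "\<bar>?fij x - ?fji x\<bar> \<le> 2 * \<epsilon>" if \<epsilon>: "\<epsilon> > 0" for \<epsilon>
  proof -
    obtain e1 where e1: "e1 > 0"
      "\<And>y. \<lbrakk>y \<in> Rn n; \<And>k. k < n \<Longrightarrow> \<bar>y k - x k\<bar> < e1\<rbrakk> \<Longrightarrow> y \<in> V \<and> \<bar>?fij y - ?fij x\<bar> < \<epsilon>"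
      using continuous_on_Euclidean_box[OF V cont(1) x \<epsilon>] by metis
    obtain e2 where e2: "e2 > 0"
      "\<And>y. \<lbrakk>y \<in> Rn n; \<And>k. k < n \<Longrightarrow> \<bar>y k - x k\<bar> < e2\<rbrakk> \<Longrightarrow> y \<in> V \<and> \<bar>?fji y - ?fji x\<bar> < \<epsilon>"
      using continuous_on_Euclidean_box[OF V cont(2) x \<epsilon>] by metis
    define e where "e = min e1 e2"
    have e: "e > 0" using e1 e2 by (simp add: e_def)
    have PV: "P s t \<in> V" "\<bar>?fij (P s t) - ?fij x\<bar> < \<epsilon>" "\<bar>?fji (P s t) - ?fji x\<bar> < \<epsilon>"
      if "\<bar>s - x i\<bar> < e" "\<bar>t - x j\<bar> < e" for s t
      using e1(2)[OF P_Rn near] e2(2)[OF P_Rn near] that by (auto simp: e_def)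
    have part_i: "((\<lambda>s. g (P s t)) has_real_derivative pderivative i g (P s t)) (at s)"
      and part_j: "((\<lambda>t. g (P s t)) has_real_derivative pderivative j g (P s t)) (at t)"
      if "smooth_fun n V g" "\<bar>s - x i\<bar> < e" "\<bar>t - x j\<bar> < e" for g s t
      using smooth_fun_has_partial[OF that(1) ij(1) PV(1)[OF that(2,3)]]
        smooth_fun_has_partial[OF that(1) ij(2) PV(1)[OF that(2,3)]]
      by (simp_all add: P_coords P_upd)
    define h where "h = e / 2"
    have h: "0 < h" "h < e" using e by (auto simp: h_def)
    let ?D = "f (P (x i + h) (x j + h)) - f (P (x i + h) (x j)) - f (P (x i) (x j + h)) + f (P (x i) (x j))"
    obtain s t where st: "\<bar>s - x i\<bar> \<le> h" "\<bar>t - x j\<bar> \<le> h" "?D = h * h * ?fji (P s t)"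
      by (rule double_difference[OF h, where F = "\<lambda>s t. f (P s t)" and a = "x i" and b = "x j"
          and G = "\<lambda>s t. pderivative i f (P s t)" and H = "\<lambda>s t. ?fji (P s t)"])
        (use part_i[OF f] part_j[OF smooth_fun_pderivative[OF f ij(1)]] in auto)
    obtain t' s' where st': "\<bar>t' - x j\<bar> \<le> h" "\<bar>s' - x i\<bar> \<le> h"
      "f (P (x i + h) (x j + h)) - f (P (x i) (x j + h)) - f (P (x i + h) (x j)) + f (P (x i) (x j))
        = h * h * ?fij (P s' t')"
      by (rule double_difference[OF h, where F = "\<lambda>t s. f (P s t)" and a = "x j" and b = "x i"
          and G = "\<lambda>t s. pderivative j f (P s t)" and H = "\<lambda>t s. ?fij (P s t)"])
        (use part_j[OF f] part_i[OF smooth_fun_pderivative[OF f ij(2)]] in auto)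
    have "h * h * ?fji (P s t) = h * h * ?fij (P s' t')" using st(3) st'(3) by linarith
    then have "?fji (P s t) = ?fij (P s' t')" using h(1) by simp
    then show ?thesis using PV(3)[of s t] PV(2)[of s' t'] st(1,2) st'(1,2) h(2) by simp
  qed
  \<comment> \<open>with a quarter of the distance for \<open>\<epsilon>\<close>, the distance is at most half of itself\<close>
  from this[of "\<bar>?fij x - ?fji x\<bar> / 4"] show ?thesis by auto
qed simp

lemma smooth_fun_const: "smooth_fun n V (\<lambda>x. c)"
proof -
  have const: "\<exists>d. iter_pderivative is (\<lambda>x. c) = (\<lambda>x. d)" for "is"
    by (induction "is") (auto simp: pderivative_def)
  show ?thesis
    unfolding smooth_fun_def
  proof (intro allI impI, goal_cases)
    case (1 "is")
    obtain d where "iter_pderivative is (\<lambda>x. c) = (\<lambda>x. d)"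
      using const[of "is"] by (rule exE)
    then show ?case by (simp add: field_differentiable_const)
  qed
qed

text \<open>The functions built from smooth functions by composition, sums and products. Their partial
  derivatives are of this kind again, hence all of them are smooth; this settles the closure
  properties of smooth functions in one coinduction.\<close>

inductive smooth_gen :: "nat \<Rightarrow> rvec set \<Rightarrow> (rvec \<Rightarrow> real) \<Rightarrow> bool" for n V where
  gen_comp: "\<lbrakk>open_Rn m W; smooth_fun m W h; smooth_vfun n m V g;
      \<And>x. x \<in> V \<Longrightarrow> g x \<in> W\<rbrakk> \<Longrightarrow> smooth_gen n V (\<lambda>x. h (g x))"
| gen_smooth: "smooth_fun n V f \<Longrightarrow> smooth_gen n V f"
| gen_add: "\<lbrakk>smooth_gen n V f; smooth_gen n V g\<rbrakk> \<Longrightarrow> smooth_gen n V (\<lambda>x. f x + g x)"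
| gen_mult: "\<lbrakk>smooth_gen n V f; smooth_gen n V g\<rbrakk> \<Longrightarrow> smooth_gen n V (\<lambda>x. f x * g x)"

lemma smooth_gen_sum:
  assumes "finite A" "\<And>i. i \<in> A \<Longrightarrow> smooth_gen n V (f i)"
  shows "smooth_gen n V (\<lambda>x. \<Sum>i\<in>A. f i x)"
  using assms
  by (induction A rule: finite_induct) (auto intro: gen_smooth smooth_fun_const gen_add)

lemma smooth_vfun_continuous:
  assumes V: "open_Rn n V" and g: "smooth_vfun n m V g" "\<And>x. x \<in> V \<Longrightarrow> g x \<in> Rn m"
  shows "continuous_on V g"
proof (rule continuous_on_coordinatewise_then_product)
  fix i
  show "continuous_on V (\<lambda>x. g x i)"
  proof (cases "i < m")
    case True
    then show ?thesis using g(1) smooth_fun_continuous[OF _ V] by (simp add: smooth_vfun_def)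
  next
    case False
    then have "\<And>x. x \<in> V \<Longrightarrow> g x i = 0" using g(2) by (auto simp: Rn_iff)
    then show ?thesis by (simp cong: continuous_on_cong)
  qed
qed

lemma has_partial_compose:
  assumes V: "open_Rn n V" and x: "x \<in> V" and i: "i < n"
    and W: "open_Rn m W" and h: "smooth_fun m W h"
    and g: "smooth_vfun n m V g" "\<And>x. x \<in> V \<Longrightarrow> g x \<in> W"
  shows "((\<lambda>t. h (g (x(i := t)))) has_real_derivative
    (\<Sum>j<m. pderivative j h (g x) * pderivative i (\<lambda>y. g y j) x)) (at (x i))"
proof -
  have "\<forall>\<^sub>F t in nhds (x i). g (x(i := t)) \<in> Rn m"
    using eventually_upd_in[OF V x i] by eventually_elim (use g(2) openin_Euclidean_subset[OF W] in blast)
  moreover have "((\<lambda>t. g (x(i := t)) j) has_real_derivative pderivative i (\<lambda>y. g y j) x) (at (x i))"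
    if "j < m" for j
    using smooth_fun_has_partial[OF _ i x, of "\<lambda>y. g y j"] g(1) that by (simp add: smooth_vfun_def)
  ultimately show ?thesis
    using chain_rule_path[OF W _ h, of "\<lambda>t. g (x(i := t))" "x i"] g(2)[OF x] by simp
qed

lemma smooth_gen_imp_smooth:
  assumes V: "open_Rn n V" and f: "smooth_gen n V f"
  shows "smooth_fun n V f"
proof (rule smooth_fun_coinduct[OF V])
  show "smooth_gen n V f" by fact
next
  fix f assume "smooth_gen n V f"
  then show "continuous_on V f"
  proof induction
    case (gen_comp m W h g)
    have "continuous_on V g"
      using gen_comp(3,4) openin_Euclidean_subset[OF gen_comp(1)]
      by (intro smooth_vfun_continuous[OF V gen_comp(3)]) auto
    moreover have "continuous_on W h" using smooth_fun_continuous[OF gen_comp(2,1)] .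
    moreover have "g ` V \<subseteq> W" using gen_comp(4) by auto
    ultimately show ?case using continuous_on_compose2[of W h V g] by simp
  next
    case (gen_smooth f)
    then show ?case by (rule smooth_fun_continuous[OF _ V])
  next
    case (gen_add f g)
    show ?case using gen_add.IH by (rule continuous_on_add)
  next
    case (gen_mult f g)
    show ?case using gen_mult.IH by (rule continuous_on_mult)
  qed
next
  fix f i assume "smooth_gen n V f" and i: "i < n"
  from this show "\<exists>g. smooth_gen n V g \<and> (\<forall>x\<in>V. has_partial i f (g x) x)"
  proof (induction rule: smooth_gen.induct)
    case (gen_comp m W h g)
    have "smooth_gen n V (\<lambda>x. pderivative j h (g x) * pderivative i (\<lambda>y. g y j) x)" if "j < m" for j
    proof (rule smooth_gen.gen_mult)
      show "smooth_gen n V (\<lambda>x. pderivative j h (g x))"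
        using gen_comp(1) smooth_fun_pderivative[OF gen_comp(2) that] gen_comp(3,4)
        by (rule smooth_gen.gen_comp)
      have "smooth_fun n V (\<lambda>y. g y j)" using gen_comp(3) that by (simp add: smooth_vfun_def)
      then show "smooth_gen n V (pderivative i (\<lambda>y. g y j))"
        by (intro smooth_gen.gen_smooth smooth_fun_pderivative i)
    qed
    then have "smooth_gen n V (\<lambda>x. \<Sum>j<m. pderivative j h (g x) * pderivative i (\<lambda>y. g y j) x)"
      by (intro smooth_gen_sum) auto
    then show ?case
      using has_partial_compose[OF V _ i gen_comp(1,2,3,4)]
      by (intro exI[of _ "\<lambda>x. \<Sum>j<m. pderivative j h (g x) * pderivative i (\<lambda>y. g y j) x"])
        (simp del: fun_upd_apply)
  next
    case (gen_smooth f)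
    then show ?case
      using smooth_fun_pderivative[OF _ i] smooth_fun_has_partial[OF _ i]
      by (intro exI[of _ "pderivative i f"]) (simp add: smooth_gen.gen_smooth del: fun_upd_apply)
  next
    case (gen_add f g)
    obtain f' where f': "smooth_gen n V f' \<and> (\<forall>x\<in>V. has_partial i f (f' x) x)"
      using gen_add.IH(1)[OF i] by (rule exE)
    obtain g' where g': "smooth_gen n V g' \<and> (\<forall>x\<in>V. has_partial i g (g' x) x)"
      using gen_add.IH(2)[OF i] by (rule exE)
    have "((\<lambda>t. f (x(i := t)) + g (x(i := t))) has_real_derivative f' x + g' x) (at (x i))"
      if "x \<in> V" for x
      using DERIV_add[OF bspec[OF conjunct2[OF f'] that] bspec[OF conjunct2[OF g'] that]] by simp
    then show ?case
      using smooth_gen.gen_add[OF conjunct1[OF f'] conjunct1[OF g']]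
      by (intro exI[of _ "\<lambda>x. f' x + g' x"]) (simp del: fun_upd_apply)
  next
    case (gen_mult f g)
    obtain f' where f': "smooth_gen n V f' \<and> (\<forall>x\<in>V. has_partial i f (f' x) x)"
      using gen_mult.IH(1)[OF i] by (rule exE)
    obtain g' where g': "smooth_gen n V g' \<and> (\<forall>x\<in>V. has_partial i g (g' x) x)"
      using gen_mult.IH(2)[OF i] by (rule exE)
    have "((\<lambda>t. f (x(i := t)) * g (x(i := t))) has_real_derivative f' x * g x + g' x * f x) (at (x i))"
      if "x \<in> V" for x
      using DERIV_mult[OF bspec[OF conjunct2[OF f'] that] bspec[OF conjunct2[OF g'] that]] by simp
    then show ?case
      using f' g' gen_mult.hyps
      by (intro exI[of _ "\<lambda>x. f' x * g x + g' x * f x"]) (simp add: smooth_gen.gen_add smooth_gen.gen_mult del: fun_upd_apply)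
  qed
qed

lemma smooth_fun_compose:
  assumes "open_Rn n V" "open_Rn m W" "smooth_fun m W h"
    "smooth_vfun n m V g" "\<And>x. x \<in> V \<Longrightarrow> g x \<in> W"
  shows "smooth_fun n V (\<lambda>x. h (g x))"
  by (rule smooth_gen_imp_smooth[OF assms(1)], rule gen_comp[OF assms(2-5)])

lemma smooth_fun_add:
  "\<lbrakk>open_Rn n V; smooth_fun n V f; smooth_fun n V g\<rbrakk> \<Longrightarrow> smooth_fun n V (\<lambda>x. f x + g x)"
  by (rule smooth_gen_imp_smooth, assumption, rule gen_add) (rule gen_smooth, assumption)+

lemma smooth_fun_mult:
  "\<lbrakk>open_Rn n V; smooth_fun n V f; smooth_fun n V g\<rbrakk> \<Longrightarrow> smooth_fun n V (\<lambda>x. f x * g x)"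
  by (rule smooth_gen_imp_smooth, assumption, rule gen_mult) (rule gen_smooth, assumption)+

lemma smooth_fun_sum:
  assumes V: "open_Rn n V" and f: "\<And>i. i \<in> A \<Longrightarrow> smooth_fun n V (f i)"
  shows "smooth_fun n V (\<lambda>x. \<Sum>i\<in>A. f i x)"
proof (cases "finite A")
  case True
  show ?thesis
    by (rule smooth_gen_imp_smooth[OF V], rule smooth_gen_sum[OF True], rule gen_smooth, rule f)
qed (simp add: smooth_fun_const)

section \<open>The exterior algebra in coordinates\<close>

text \<open>The number of transpositions that sort the concatenation of \<open>I\<close> and \<open>J\<close>, both in increasing order;
  its parity is the sign in \<open>dx\<^sub>I \<and> dx\<^sub>J = \<plusminus> dx\<^bsub>I \<union> J\<^esub>\<close>.\<close>

definition inversions :: "nat set \<Rightarrow> nat set \<Rightarrow> nat" where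
  "inversions I J = card {(i, j). i \<in> I \<and> j \<in> J \<and> j < i}"

definition shuffle_sign :: "nat set \<Rightarrow> nat set \<Rightarrow> real" where
  "shuffle_sign I J = (-1) ^ inversions I J"

lemma ext_mul_eq: "ext_mul a b K = (\<Sum>I\<in>Pow K. shuffle_sign I (K - I) * a I * b (K - I))"
  by (simp add: ext_mul_def shuffle_sign_def inversions_def)

lemma finite_inversions: "\<lbrakk>finite I; finite J\<rbrakk> \<Longrightarrow> finite {(i, j). i \<in> I \<and> j \<in> J \<and> j < i}"
  by (rule finite_subset[of _ "I \<times> J"]) auto

lemma inversions_Un_left:
  assumes "finite I" "finite I'" "finite J" "I \<inter> I' = {}"
  shows "inversions (I \<union> I') J = inversions I J + inversions I' J"
  unfolding inversions_def
  by (subst card_Un_disjoint[symmetric])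
    (use assms in \<open>auto intro!: finite_inversions arg_cong[of _ _ card]\<close>)

lemma inversions_Un_right:
  assumes "finite I" "finite J" "finite J'" "J \<inter> J' = {}"
  shows "inversions I (J \<union> J') = inversions I J + inversions I J'"
  unfolding inversions_def
  by (subst card_Un_disjoint[symmetric])
    (use assms in \<open>auto intro!: finite_inversions arg_cong[of _ _ card]\<close>)

lemma inversions_swap:
  assumes "finite I" "finite J" "I \<inter> J = {}"
  shows "inversions I J + inversions J I = card I * card J"
proof -
  have "inversions J I = card {(i, j). i \<in> I \<and> j \<in> J \<and> i < j}"
    unfolding inversions_def
    by (rule bij_betw_same_card[of prod.swap]) (auto simp: bij_betw_def inj_on_def image_iff)
  moreover have "{(i, j). i \<in> I \<and> j \<in> J \<and> j < i} \<union> {(i, j). i \<in> I \<and> j \<in> J \<and> i < j} = I \<times> J"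
    using assms(3) by (auto simp: neq_iff)
  then have "card {(i, j). i \<in> I \<and> j \<in> J \<and> j < i} + card {(i, j). i \<in> I \<and> j \<in> J \<and> i < j}
      = card (I \<times> J)"
    using assms(1,2) finite_subset[of _ "I \<times> J"]
    by (subst card_Un_disjoint[symmetric]) (auto simp: subset_iff)
  ultimately show ?thesis by (simp add: inversions_def card_cartesian_product)
qed

lemma inversions_singleton: "inversions {i} J = card {j \<in> J. j < i}"
  unfolding inversions_def
  by (rule bij_betw_same_card[of snd]) (auto simp: bij_betw_def inj_on_def image_iff)

lemma shuffle_sign_Un_left:
  "\<lbrakk>finite I; finite I'; finite J; I \<inter> I' = {}\<rbrakk>
   \<Longrightarrow> shuffle_sign (I \<union> I') J = shuffle_sign I J * shuffle_sign I' J"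
  by (simp add: shuffle_sign_def inversions_Un_left power_add)

lemma shuffle_sign_Un_right:
  "\<lbrakk>finite I; finite J; finite J'; J \<inter> J' = {}\<rbrakk>
   \<Longrightarrow> shuffle_sign I (J \<union> J') = shuffle_sign I J * shuffle_sign I J'"
  by (simp add: shuffle_sign_def inversions_Un_right power_add)

lemma shuffle_sign_swap:
  assumes "finite I" "finite J" "I \<inter> J = {}"
  shows "shuffle_sign I J = (-1) ^ (card I * card J) * shuffle_sign J I"
proof -
  have "(-1) ^ (card I * card J) * shuffle_sign J I
      = shuffle_sign I J * (shuffle_sign J I * shuffle_sign J I)"
    using inversions_swap[OF assms, symmetric] by (simp add: shuffle_sign_def power_add)
  also have "shuffle_sign J I * shuffle_sign J I = 1"
    by (simp add: shuffle_sign_def flip: power_add)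
  finally show ?thesis by simp
qed

lemma shuffle_sign_empty [simp]: "shuffle_sign {} J = 1" "shuffle_sign I {} = 1"
  by (simp_all add: shuffle_sign_def inversions_def)

lemma shuffle_sign_singleton: "shuffle_sign {i} J = (-1) ^ card {j \<in> J. j < i}"
  by (simp add: shuffle_sign_def inversions_singleton)

lemma ext_mul_infinite: "infinite K \<Longrightarrow> ext_mul a b K = 0"
  by (simp add: ext_mul_eq)

text \<open>Both sides sum over the partitions of \<open>K\<close> into \<open>I\<close>, \<open>J\<close> and \<open>K - I - J\<close>. The sign is the product of
  the signs of the three pairs of parts, since inversions are additive in both arguments.\<close>

lemma ext_mul_assoc: "ext_mul (ext_mul a b) c = ext_mul a (ext_mul b c)"
proof
  fix K
  show "ext_mul (ext_mul a b) c K = ext_mul a (ext_mul b c) K"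
  proof (cases "finite K")
    case True
    have "ext_mul (ext_mul a b) c K = (\<Sum>(L, I)\<in>Sigma (Pow K) Pow.
        shuffle_sign L (K - L) * (shuffle_sign I (L - I) * a I * b (L - I)) * c (K - L))"
      using True by (simp add: ext_mul_eq sum_distrib_left sum_distrib_right sum.Sigma finite_subset[OF _ True])
    also have "\<dots> = (\<Sum>(I, J)\<in>Sigma (Pow K) (\<lambda>I. Pow (K - I)).
        shuffle_sign I (K - I) * a I * (shuffle_sign J (K - I - J) * b J * c (K - I - J)))"
    proof (rule sum.reindex_bij_witness[where i = "\<lambda>(I, J). (I \<union> J, I)" and j = "\<lambda>(L, I). (I, L - I)"])
      fix p assume "p \<in> Sigma (Pow K) Pow"
      then obtain L I where p: "p = (L, I)" "I \<subseteq> L" "L \<subseteq> K" by auto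
      have fin: "finite I" "finite (L - I)" "finite (K - L)"
        using p True by (auto intro: finite_subset)
      have L: "L = I \<union> (L - I)" and KI: "K - I = (L - I) \<union> (K - L)" and KL: "K - I - (L - I) = K - L"
        using p by auto
      have "shuffle_sign L (K - L) = shuffle_sign I (K - L) * shuffle_sign (L - I) (K - L)"
        using shuffle_sign_Un_left[of I "L - I" "K - L"] L fin by auto
      moreover have "shuffle_sign I (K - I) = shuffle_sign I (L - I) * shuffle_sign I (K - L)"
        unfolding KI by (rule shuffle_sign_Un_right) (use fin p in auto)
      ultimately show "(case case p of (L, I) \<Rightarrow> (I, L - I) of (I, J) \<Rightarrow>
          shuffle_sign I (K - I) * a I * (shuffle_sign J (K - I - J) * b J * c (K - I - J)))
        = (case p of (L, I) \<Rightarrow> shuffle_sign L (K - L) * (shuffle_sign I (L - I) * a I * b (L - I)) * c (K - L))"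
        by (simp add: p KL)
    qed auto
    also have "\<dots> = ext_mul a (ext_mul b c) K"
      using True by (simp add: ext_mul_eq sum_distrib_left sum.Sigma)
    finally show ?thesis .
  qed (simp add: ext_mul_infinite)
qed

lemma ext_mul_add_left: "ext_mul (\<lambda>I. a I + a' I) b = (\<lambda>K. ext_mul a b K + ext_mul a' b K)"
  by (simp add: ext_mul_eq fun_eq_iff algebra_simps sum.distrib)

lemma ext_mul_add_right: "ext_mul a (\<lambda>I. b I + b' I) = (\<lambda>K. ext_mul a b K + ext_mul a b' K)"
  by (simp add: ext_mul_eq fun_eq_iff algebra_simps sum.distrib)

lemma ext_mul_scale_left: "ext_mul (\<lambda>I. r * a I) b = (\<lambda>K. r * ext_mul a b K)"
  by (simp add: ext_mul_eq fun_eq_iff sum_distrib_left mult_ac)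

lemma ext_mul_scale_right: "ext_mul a (\<lambda>I. r * b I) = (\<lambda>K. r * ext_mul a b K)"
  by (simp add: ext_mul_eq fun_eq_iff sum_distrib_left mult_ac)

lemma ext_mul_sum_left: "ext_mul (\<lambda>I. \<Sum>s\<in>S. a s I) b = (\<lambda>K. \<Sum>s\<in>S. ext_mul (a s) b K)"
proof
  fix K
  show "ext_mul (\<lambda>I. \<Sum>s\<in>S. a s I) b K = (\<Sum>s\<in>S. ext_mul (a s) b K)"
    unfolding ext_mul_eq by (subst sum.swap) (simp add: sum_distrib_left sum_distrib_right)
qed

lemma ext_mul_sum_right: "ext_mul a (\<lambda>I. \<Sum>s\<in>S. b s I) = (\<lambda>K. \<Sum>s\<in>S. ext_mul a (b s) K)"
proof
  fix K
  show "ext_mul a (\<lambda>I. \<Sum>s\<in>S. b s I) K = (\<Sum>s\<in>S. ext_mul a (b s) K)"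
    unfolding ext_mul_eq by (subst sum.swap) (simp add: sum_distrib_left)
qed

lemma ext_mul_zero [simp]: "ext_mul (\<lambda>I. 0) b = (\<lambda>K. 0)" "ext_mul a (\<lambda>I. 0) = (\<lambda>K. 0)"
  by (simp_all add: ext_mul_eq fun_eq_iff)

lemma ext_mul_nonzero:
  assumes "ext_mul a b K \<noteq> 0"
  obtains I where "finite K" "I \<subseteq> K" "a I \<noteq> 0" "b (K - I) \<noteq> 0"
proof -
  have "finite K" using assms ext_mul_infinite by blast
  moreover obtain I where "I \<in> Pow K" "shuffle_sign I (K - I) * a I * b (K - I) \<noteq> 0"
    using assms unfolding ext_mul_eq by (rule sum.not_neutral_contains_not_neutral)
  ultimately show thesis using that by auto
qed

lemma ext_mul_one_left:
  assumes "\<And>K. infinite K \<Longrightarrow> a K = 0"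
  shows "ext_mul ext_one a = a"
proof
  fix K
  show "ext_mul ext_one a K = a K"
  proof (cases "finite K")
    case True
    have "ext_mul ext_one a K = (\<Sum>I\<in>Pow K. if I = {} then a K else 0)"
      unfolding ext_mul_eq by (rule sum.cong) (auto simp: ext_one_def)
    then show ?thesis using True by simp
  qed (simp add: ext_mul_infinite assms)
qed

lemma ext_mul_one_right:
  assumes "\<And>K. infinite K \<Longrightarrow> a K = 0"
  shows "ext_mul a ext_one = a"
proof
  fix K
  show "ext_mul a ext_one K = a K"
  proof (cases "finite K")
    case True
    have "ext_mul a ext_one K = (\<Sum>I\<in>Pow K. if I = K then a K else 0)"
      unfolding ext_mul_eq by (rule sum.cong) (auto simp: ext_one_def)
    then show ?thesis using True by simp
  qed (simp add: ext_mul_infinite assms)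
qed

text \<open>Exchanging the two factors of \<open>dx\<^sub>I \<and> dx\<^sub>J\<close> turns inversions into non-inversions, and there
  are \<open>|I| |J|\<close> pairs altogether.\<close>

lemma ext_mul_commute:
  assumes a: "\<And>I. a I \<noteq> 0 \<Longrightarrow> int (card I) = k" and b: "\<And>I. b I \<noteq> 0 \<Longrightarrow> int (card I) = l"
  shows "ext_mul a b = (\<lambda>K. (-1) powi (k * l) * ext_mul b a K)"
proof
  fix K
  show "ext_mul a b K = (-1) powi (k * l) * ext_mul b a K"
  proof (cases "finite K")
    case True
    have "ext_mul a b K = (\<Sum>J\<in>Pow K. shuffle_sign (K - J) J * a (K - J) * b J)"
      unfolding ext_mul_eq
      by (rule sum.reindex_bij_witness[where i = "\<lambda>J. K - J" and j = "\<lambda>I. K - I"])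
        (auto simp: double_diff)
    also have "\<dots> = (\<Sum>J\<in>Pow K. (-1) powi (k * l) * (shuffle_sign J (K - J) * b J * a (K - J)))"
    proof (rule sum.cong[OF refl])
      fix J assume J: "J \<in> Pow K"
      show "shuffle_sign (K - J) J * a (K - J) * b J
        = (-1) powi (k * l) * (shuffle_sign J (K - J) * b J * a (K - J))"
      proof (cases "a (K - J) = 0 \<or> b J = 0")
        case False
        then have "k * l = int (card (K - J) * card J)" using a b by fastforce
        then have "(-1::real) powi (k * l) = (-1) ^ (card (K - J) * card J)"
          by (simp only: power_int_of_nat)
        then show ?thesis
          using shuffle_sign_swap[of "K - J" J] J True by (auto simp: finite_subset)
      qed auto
    qed
    also have "\<dots> = (-1) powi (k * l) * ext_mul b a K"
      by (simp add: ext_mul_eq sum_distrib_left)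
    finally show ?thesis .
  qed (simp add: ext_mul_infinite)
qed

definition one_form :: "ext \<Rightarrow> bool" where
  "one_form a \<longleftrightarrow> (\<forall>I. a I \<noteq> 0 \<longrightarrow> card I = 1)"

lemma one_form_infinite: "\<lbrakk>one_form a; infinite K\<rbrakk> \<Longrightarrow> a K = 0"
  unfolding one_form_def by (metis card.infinite zero_neq_one)

lemma one_form_anticommute:
  assumes "one_form a" "one_form b"
  shows "ext_mul a b = (\<lambda>K. - ext_mul b a K)"
  using ext_mul_commute[of a 1 b 1] assms by (simp add: one_form_def)

lemma one_form_square:
  assumes "one_form a"
  shows "ext_mul a a = (\<lambda>K. 0)"
proof
  fix K show "ext_mul a a K = 0" using fun_cong[OF one_form_anticommute[OF assms assms], of K] by simp
qed

definition ext_basis :: "nat \<Rightarrow> ext" where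
  "ext_basis i = (\<lambda>I. if I = {i} then 1 else 0)"

lemma one_form_basis: "one_form (ext_basis i)"
  by (simp add: one_form_def ext_basis_def)

lemma ext_mul_basis:
  "ext_mul (ext_basis i) a K
    = (if finite K \<and> i \<in> K then (-1) ^ card {j \<in> K. j < i} * a (K - {i}) else 0)"
proof (cases "finite K")
  case True
  have "ext_mul (ext_basis i) a K
      = (\<Sum>I\<in>Pow K. if I = {i} then shuffle_sign {i} (K - {i}) * a (K - {i}) else 0)"
    unfolding ext_mul_eq by (rule sum.cong) (auto simp: ext_basis_def)
  also have "\<dots> = (if i \<in> K then shuffle_sign {i} (K - {i}) * a (K - {i}) else 0)"
    using True by simp
  also have "{j \<in> K - {i}. j < i} = {j \<in> K. j < i}" by auto
  ultimately show ?thesis using True by (simp add: shuffle_sign_singleton)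
qed (simp add: ext_mul_infinite)


text \<open>The value on \<open>dx\<^sub>I\<close> of the algebra homomorphism that sends each \<open>dx\<^sub>i\<close> to \<open>\<theta> i\<close>.\<close>

definition ext_prod :: "(nat \<Rightarrow> ext) \<Rightarrow> nat set \<Rightarrow> ext" where
  "ext_prod \<theta> I = foldr ext_mul (map \<theta> (sorted_list_of_set I)) ext_one"

definition ext_subst :: "nat \<Rightarrow> (nat \<Rightarrow> ext) \<Rightarrow> ext \<Rightarrow> ext" where
  "ext_subst m \<theta> b = (\<lambda>K. \<Sum>I\<in>Pow {..<m}. b I * ext_prod \<theta> I K)"

lemma local_pullback_eq:
  "local_pullback n m g \<beta> x = ext_subst m (\<lambda>i. local_d n (local_fun (\<lambda>y. g y i)) x) (\<beta> (g x))"
  by (simp add: local_pullback_def ext_subst_def ext_prod_def)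

lemma ext_prod_empty: "ext_prod \<theta> {} = ext_one"
  by (simp add: ext_prod_def)

lemma ext_prod_insert_min:
  assumes "finite A" "\<forall>a\<in>A. i < a"
  shows "ext_prod \<theta> (insert i A) = ext_mul (\<theta> i) (ext_prod \<theta> A)"
proof -
  have "i \<notin> A" using assms by auto
  then have "sorted_list_of_set (insert i A) = insort i (sorted_list_of_set A)"
    using assms(1) by (simp add: sorted_list_of_set_insert)
  also have "\<dots> = i # sorted_list_of_set A"
    using assms by (intro insort_is_Cons) (auto simp: less_imp_le)
  finally show ?thesis by (simp add: ext_prod_def)
qed

lemma foldr_ext_mul_infinite: "infinite K \<Longrightarrow> foldr ext_mul as ext_one K = 0"
  by (cases "as") (auto simp: ext_one_def ext_mul_infinite)

lemma ext_prod_infinite: "infinite K \<Longrightarrow> ext_prod \<theta> I K = 0"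
  by (simp add: ext_prod_def foldr_ext_mul_infinite)

lemma ext_prod_singleton:
  assumes "one_form (\<theta> i)"
  shows "ext_prod \<theta> {i} = \<theta> i"
  using one_form_infinite[OF assms] by (simp add: ext_prod_def ext_mul_one_right)

text \<open>A new factor \<open>\<theta> i\<close> moves to its place past the factors with smaller index, changing the sign at each
  of them; if it meets its own copy, the product vanishes.\<close>

lemma ext_prod_left:
  assumes "finite J" and "one_form (\<theta> i)" and "\<And>j. j \<in> J \<Longrightarrow> one_form (\<theta> j)"
  shows "ext_mul (\<theta> i) (ext_prod \<theta> J)
    = (\<lambda>K. if i \<in> J then 0 else (-1) ^ card {j \<in> J. j < i} * ext_prod \<theta> (insert i J) K)"
  using assms
proof (induction J rule: finite_linorder_min_induct)
  case empty
  then show ?case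
    using one_form_infinite[of "\<theta> i"]
    by (simp add: ext_prod_empty ext_prod_singleton ext_mul_one_right)
next
  case (insert b A)
  have prod: "ext_prod \<theta> (insert b A) = ext_mul (\<theta> b) (ext_prod \<theta> A)"
    using insert.hyps by (intro ext_prod_insert_min) auto
  show ?case
  proof (cases i b rule: linorder_cases)
    case less
    then have "ext_prod \<theta> (insert i (insert b A)) = ext_mul (\<theta> i) (ext_prod \<theta> (insert b A))"
      using insert.hyps by (intro ext_prod_insert_min) auto
    moreover have "{j \<in> insert b A. j < i} = {}" "i \<notin> insert b A" using less insert.hyps by auto
    ultimately show ?thesis by (simp only: card.empty power_0 mult_1 if_False)
  next
    case equal
    then have "ext_mul (\<theta> i) (ext_prod \<theta> (insert b A)) = ext_mul (ext_mul (\<theta> b) (\<theta> b)) (ext_prod \<theta> A)"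
      by (simp add: prod ext_mul_assoc)
    then show ?thesis using equal insert.prems by (simp add: one_form_square)
  next
    case greater
    have "ext_mul (\<theta> i) (ext_prod \<theta> (insert b A)) = ext_mul (ext_mul (\<theta> i) (\<theta> b)) (ext_prod \<theta> A)"
      by (simp add: prod ext_mul_assoc)
    also have "\<dots> = (\<lambda>K. - ext_mul (\<theta> b) (ext_mul (\<theta> i) (ext_prod \<theta> A)) K)"
      using one_form_anticommute[of "\<theta> i" "\<theta> b"] insert.prems
        ext_mul_scale_left[of "-1" "ext_mul (\<theta> b) (\<theta> i)" "ext_prod \<theta> A"]
      by (simp add: ext_mul_assoc)
    also have "\<dots> = (\<lambda>K. if i \<in> A then 0
        else - ((-1) ^ card {j \<in> A. j < i}) * ext_mul (\<theta> b) (ext_prod \<theta> (insert i A)) K)"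
    proof -
      have "ext_mul (\<theta> i) (ext_prod \<theta> A)
          = (\<lambda>K. if i \<in> A then 0 else (-1) ^ card {j \<in> A. j < i} * ext_prod \<theta> (insert i A) K)"
        by (rule insert.IH) (use insert.prems in auto)
      then show ?thesis by (cases "i \<in> A") (simp_all add: ext_mul_scale_right)
    qed
    also have "ext_mul (\<theta> b) (ext_prod \<theta> (insert i A)) = ext_prod \<theta> (insert i (insert b A))"
      using insert.hyps greater ext_prod_insert_min[of "insert i A" b \<theta>] by (simp add: insert_commute)
    moreover have "card {j \<in> insert b A. j < i} = Suc (card {j \<in> A. j < i})"
    proof -
      have "{j \<in> insert b A. j < i} = insert b {j \<in> A. j < i}" using greater by auto
      moreover have "b \<notin> A" using insert.hyps by auto
      ultimately show ?thesis using insert.hyps by simp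
    qed
    ultimately show ?thesis using greater by auto
  qed
qed

text \<open>One-forms satisfy the relations of the \<open>dx\<^sub>i\<close>, so their products multiply by the same rule.\<close>

lemma ext_prod_mul:
  assumes "finite I" "finite J" and "\<And>j. j \<in> I \<union> J \<Longrightarrow> one_form (\<theta> j)"
  shows "ext_mul (ext_prod \<theta> I) (ext_prod \<theta> J)
    = (\<lambda>K. if I \<inter> J = {} then shuffle_sign I J * ext_prod \<theta> (I \<union> J) K else 0)"
  using assms
proof (induction I rule: finite_linorder_min_induct)
  case empty
  then show ?case by (simp add: ext_prod_empty ext_mul_one_left ext_prod_infinite)
next
  case (insert b A)
  have b: "b \<notin> A" using insert.hyps by auto
  have IH: "ext_mul (ext_prod \<theta> A) (ext_prod \<theta> J)
      = (\<lambda>K. if A \<inter> J = {} then shuffle_sign A J * ext_prod \<theta> (A \<union> J) K else 0)"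
    using insert.prems by (intro insert.IH) auto
  have "ext_mul (ext_prod \<theta> (insert b A)) (ext_prod \<theta> J)
      = ext_mul (\<theta> b) (ext_mul (ext_prod \<theta> A) (ext_prod \<theta> J))"
    using insert.hyps by (simp add: ext_prod_insert_min ext_mul_assoc)
  also have "\<dots> = (\<lambda>K. if A \<inter> J = {} then shuffle_sign A J * ext_mul (\<theta> b) (ext_prod \<theta> (A \<union> J)) K else 0)"
    unfolding IH by (auto simp: ext_mul_scale_right)
  also have "ext_mul (\<theta> b) (ext_prod \<theta> (A \<union> J)) = (\<lambda>K. if b \<in> A \<union> J then 0
      else (-1) ^ card {j \<in> A \<union> J. j < b} * ext_prod \<theta> (insert b (A \<union> J)) K)"
    using insert.hyps insert.prems by (intro ext_prod_left) auto
  also have "{j \<in> A \<union> J. j < b} = {j \<in> J. j < b}" using insert.hyps by auto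
  finally have "ext_mul (ext_prod \<theta> (insert b A)) (ext_prod \<theta> J) = (\<lambda>K. if A \<inter> J = {}
      then shuffle_sign A J * (if b \<in> A \<union> J then 0
        else (-1) ^ card {j \<in> J. j < b} * ext_prod \<theta> (insert b (A \<union> J)) K) else 0)" .
  moreover have "shuffle_sign (insert b A) J = (-1) ^ card {j \<in> J. j < b} * shuffle_sign A J"
    using shuffle_sign_Un_left[of "{b}" A J] insert b by (simp add: shuffle_sign_singleton)
  ultimately show ?case using b by (auto simp: fun_eq_iff)
qed

text \<open>By bilinearity it suffices to compare the products of the images of \<open>dx\<^sub>I\<close> and \<open>dx\<^sub>J\<close>.\<close>

theorem ext_subst_mul:
  assumes \<theta>: "\<And>i. i < m \<Longrightarrow> one_form (\<theta> i)"
  shows "ext_subst m \<theta> (ext_mul a b) = ext_mul (ext_subst m \<theta> a) (ext_subst m \<theta> b)"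
proof
  fix L
  let ?S = "Pow {..<m}"
  have fin: "finite I" if "I \<in> ?S" for I using that finite_subset by auto
  have prod_mul: "ext_mul (ext_prod \<theta> I) (ext_prod \<theta> J) L
      = (if I \<inter> J = {} then shuffle_sign I J * ext_prod \<theta> (I \<union> J) L else 0)"
    if "I \<in> ?S" "J \<in> ?S" for I J
    by (subst ext_prod_mul) (use that fin \<theta> in auto)
  have "ext_subst m \<theta> (ext_mul a b) L = (\<Sum>(K, I)\<in>Sigma ?S Pow.
      shuffle_sign I (K - I) * a I * b (K - I) * ext_prod \<theta> K L)"
    by (simp add: ext_subst_def ext_mul_eq sum_distrib_right sum.Sigma fin)
  also have "\<dots> = (\<Sum>(I, J)\<in>{(I, J) \<in> ?S \<times> ?S. I \<inter> J = {}}.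
      shuffle_sign I J * a I * b J * ext_prod \<theta> (I \<union> J) L)"
    by (rule sum.reindex_bij_witness[where i = "\<lambda>(I, J). (I \<union> J, I)" and j = "\<lambda>(K, I). (I, K - I)"])
      (auto simp: Un_absorb1)
  also have "\<dots> = (\<Sum>(I, J)\<in>?S \<times> ?S. a I * (b J * ext_mul (ext_prod \<theta> I) (ext_prod \<theta> J) L))"
    by (rule sum.mono_neutral_cong_left) (auto simp: prod_mul split: if_splits)
  also have "\<dots> = ext_mul (ext_subst m \<theta> a) (ext_subst m \<theta> b) L"
    by (simp add: ext_subst_def ext_mul_sum_left ext_mul_sum_right ext_mul_scale_left
        ext_mul_scale_right sum.cartesian_product sum_distrib_left)
  finally show "ext_subst m \<theta> (ext_mul a b) L = ext_mul (ext_subst m \<theta> a) (ext_subst m \<theta> b) L" .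
qed

lemma ext_subst_one: "ext_subst m \<theta> ext_one = ext_one"
proof
  fix K
  have "ext_subst m \<theta> ext_one K = (\<Sum>I\<in>Pow {..<m}. if I = {} then ext_one K else 0)"
    unfolding ext_subst_def
    by (rule sum.cong) (simp_all add: ext_one_def ext_prod_empty[unfolded ext_one_def])
  then show "ext_subst m \<theta> ext_one K = ext_one K" by simp
qed

lemma ext_subst_basis:
  assumes "i < m" "one_form (\<theta> i)"
  shows "ext_subst m \<theta> (ext_basis i) = \<theta> i"
proof
  fix K
  have "ext_subst m \<theta> (ext_basis i) K = (\<Sum>I\<in>Pow {..<m}. if I = {i} then \<theta> i K else 0)"
    unfolding ext_subst_def
    by (rule sum.cong) (auto simp: ext_basis_def ext_prod_singleton[of \<theta> i, OF assms(2)])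
  then show "ext_subst m \<theta> (ext_basis i) K = \<theta> i K" using assms(1) by simp
qed

lemma ext_subst_add: "ext_subst m \<theta> (\<lambda>I. a I + b I) = (\<lambda>K. ext_subst m \<theta> a K + ext_subst m \<theta> b K)"
  by (simp add: ext_subst_def fun_eq_iff algebra_simps sum.distrib)

lemma ext_subst_scale: "ext_subst m \<theta> (\<lambda>I. r * a I) = (\<lambda>K. r * ext_subst m \<theta> a K)"
  by (simp add: ext_subst_def fun_eq_iff sum_distrib_left mult_ac)

lemma ext_subst_sum: "ext_subst m \<theta> (\<lambda>I. \<Sum>s\<in>S. a s I) = (\<lambda>K. \<Sum>s\<in>S. ext_subst m \<theta> (a s) K)"
proof
  fix K
  show "ext_subst m \<theta> (\<lambda>I. \<Sum>s\<in>S. a s I) K = (\<Sum>s\<in>S. ext_subst m \<theta> (a s) K)"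
    unfolding ext_subst_def by (subst sum.swap) (simp add: sum_distrib_right)
qed

lemma ext_subst_cong:
  assumes "\<And>i. i < m \<Longrightarrow> \<theta> i = \<theta>' i" "\<And>I. I \<subseteq> {..<m} \<Longrightarrow> b I = b' I"
  shows "ext_subst m \<theta> b = ext_subst m \<theta>' b'"
proof
  fix K
  have "ext_prod \<theta> I = ext_prod \<theta>' I" if "I \<subseteq> {..<m}" for I
  proof -
    have "finite I" using that finite_subset by auto
    then have "map \<theta> (sorted_list_of_set I) = map \<theta>' (sorted_list_of_set I)"
      using assms(1) that by (intro map_cong) auto
    then show ?thesis by (simp only: ext_prod_def)
  qed
  then show "ext_subst m \<theta> b K = ext_subst m \<theta>' b' K"
    unfolding ext_subst_def by (intro sum.cong) (auto simp: assms(2))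
qed

lemma ext_subst_ext_prod:
  assumes "\<And>j. j < n \<Longrightarrow> one_form (\<phi> j)"
  shows "ext_subst n \<phi> (ext_prod \<theta> I) = ext_prod (\<lambda>i. ext_subst n \<phi> (\<theta> i)) I"
proof -
  have "ext_subst n \<phi> (foldr ext_mul (map \<theta> is) ext_one)
      = foldr ext_mul (map (\<lambda>i. ext_subst n \<phi> (\<theta> i)) is) ext_one" for "is"
    by (induction "is") (auto simp: ext_subst_one ext_subst_mul[OF assms])
  then show ?thesis by (simp add: ext_prod_def)
qed

text \<open>Both sides are algebra homomorphisms and agree on the \<open>dx\<^sub>i\<close>.\<close>

lemma ext_subst_ext_subst:
  assumes "\<And>j. j < n \<Longrightarrow> one_form (\<phi> j)"
  shows "ext_subst n \<phi> (ext_subst m \<theta> b) = ext_subst m (\<lambda>i. ext_subst n \<phi> (\<theta> i)) b"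
proof -
  have "ext_subst n \<phi> (ext_subst m \<theta> b)
      = (\<lambda>K. \<Sum>I\<in>Pow {..<m}. b I * ext_subst n \<phi> (ext_prod \<theta> I) K)"
    unfolding ext_subst_def[of m] by (simp add: ext_subst_sum ext_subst_scale)
  also have "\<dots> = ext_subst m (\<lambda>i. ext_subst n \<phi> (\<theta> i)) b"
    using ext_subst_ext_prod[of n \<phi>] assms by (simp add: ext_subst_def[of m])
  finally show ?thesis .
qed

text \<open>Each factor \<open>\<theta> i\<close> adds one index; this determines the support and the degree of a pullback.\<close>

lemma ext_prod_nonzero:
  assumes "finite I" "\<And>i. i \<in> I \<Longrightarrow> one_form (\<theta> i)" "\<And>i J. \<lbrakk>i \<in> I; \<theta> i J \<noteq> 0\<rbrakk> \<Longrightarrow> J \<subseteq> {..<n}"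
    and "ext_prod \<theta> I K \<noteq> 0"
  shows "K \<subseteq> {..<n} \<and> card K = card I"
  using assms
proof (induction I arbitrary: K rule: finite_linorder_min_induct)
  case empty
  then show ?case by (auto simp: ext_prod_empty ext_one_def split: if_splits)
next
  case (insert b A)
  then have "ext_mul (\<theta> b) (ext_prod \<theta> A) K \<noteq> 0" by (simp add: ext_prod_insert_min)
  then obtain I where I: "finite K" "I \<subseteq> K" "\<theta> b I \<noteq> 0" "ext_prod \<theta> A (K - I) \<noteq> 0"
    by (rule ext_mul_nonzero)
  have "K - I \<subseteq> {..<n} \<and> card (K - I) = card A" using insert I by blast
  moreover have "I \<subseteq> {..<n}" using insert.prems(2) I(3) by blast
  moreover have "card I = 1" using insert.prems(1) I(3) by (auto simp: one_form_def)
  moreover have "card K = card I + card (K - I)"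
    using I by (metis card_Diff_subset card_mono finite_subset le_add_diff_inverse)
  moreover have "b \<notin> A" using insert.hyps by auto
  ultimately show ?case using insert.hyps by auto
qed

lemma ext_subst_nonzero:
  assumes "\<And>i. i < m \<Longrightarrow> one_form (\<theta> i)" "\<And>i J. \<lbrakk>i < m; \<theta> i J \<noteq> 0\<rbrakk> \<Longrightarrow> J \<subseteq> {..<n}"
    and "ext_subst m \<theta> b K \<noteq> 0"
  obtains I where "I \<subseteq> {..<m}" "b I \<noteq> 0" "K \<subseteq> {..<n}" "card K = card I"
proof -
  obtain I where "I \<in> Pow {..<m}" "b I * ext_prod \<theta> I K \<noteq> 0"
    using assms(3) unfolding ext_subst_def by (rule sum.not_neutral_contains_not_neutral)
  then have I: "I \<subseteq> {..<m}" "b I \<noteq> 0" "ext_prod \<theta> I K \<noteq> 0" by auto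
  have "K \<subseteq> {..<n} \<and> card K = card I"
    by (rule ext_prod_nonzero[OF _ _ _ I(3)])
      (use assms(1,2) I(1) finite_subset[OF I(1)] in auto)
  with I that show thesis by blast
qed

section \<open>Differential forms in local coordinates\<close>

definition smooth_form :: "nat \<Rightarrow> rvec set \<Rightarrow> local_form \<Rightarrow> bool" where
  "smooth_form n V \<alpha> \<longleftrightarrow> (\<forall>I. smooth_fun n V (\<lambda>x. \<alpha> x I))"

text \<open>The condition concerns all points, also those outside the domain on which a form is smooth; this
  makes the formula for \<open>d\<close> below independent of a domain.\<close>

definition form_on :: "nat \<Rightarrow> local_form \<Rightarrow> bool" where
  "form_on n \<alpha> \<longleftrightarrow> (\<forall>x I. \<alpha> x I \<noteq> 0 \<longrightarrow> I \<subseteq> {..<n})"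

definition coeff_pderivative :: "nat \<Rightarrow> local_form \<Rightarrow> local_form" where
  "coeff_pderivative i \<alpha> = (\<lambda>x I. pderivative i (\<lambda>y. \<alpha> y I) x)"

abbreviation differential :: "nat \<Rightarrow> (rvec \<Rightarrow> real) \<Rightarrow> local_form" where
  "differential n u \<equiv> local_d n (local_fun u)"

lemma pderivative_const [simp]: "pderivative i (\<lambda>y. c) x = 0"
  by (simp add: pderivative_def)

text \<open>The formula \<open>d\<alpha> = (\<Sum>i. dx\<^sub>i \<and> \<partial>\<^sub>i\<alpha>)\<close>; through it the properties of \<open>d\<close> follow from those of
  partial derivatives and from the algebra of the \<open>dx\<^sub>i\<close>.\<close>

lemma local_d_eq:
  assumes "form_on n \<alpha>"
  shows "local_d n \<alpha> x = (\<lambda>K. \<Sum>i<n. ext_mul (ext_basis i) (coeff_pderivative i \<alpha> x) K)"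
proof
  fix K
  show "local_d n \<alpha> x K = (\<Sum>i<n. ext_mul (ext_basis i) (coeff_pderivative i \<alpha> x) K)"
  proof (cases "K \<subseteq> {..<n}")
    case True
    then have fin: "finite K" using finite_subset by blast
    have "local_d n \<alpha> x K
        = (\<Sum>i\<in>K. (-1) ^ card {j \<in> K. j < i} * pderivative i (\<lambda>y. \<alpha> y (K - {i})) x)"
      using True by (simp add: local_d_def)
    also have "\<dots> = (\<Sum>i<n. ext_mul (ext_basis i) (coeff_pderivative i \<alpha> x) K)"
      using True fin
      by (intro sum.mono_neutral_cong_left) (auto simp: ext_mul_basis coeff_pderivative_def)
    finally show ?thesis .
  next
    case False
    have "ext_mul (ext_basis i) (coeff_pderivative i \<alpha> x) K = 0" if "i < n" for i
    proof -
      have "\<not> K - {i} \<subseteq> {..<n}" using False that by auto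
      then have "\<alpha> y (K - {i}) = 0" for y using assms unfolding form_on_def by blast
      then show ?thesis by (simp add: ext_mul_basis coeff_pderivative_def)
    qed
    then show ?thesis using False by (simp add: local_d_def)
  qed
qed

lemma local_d_nonzero:
  assumes "local_d n \<alpha> x K \<noteq> 0"
  obtains i where "i \<in> K" "\<exists>y. \<alpha> y (K - {i}) \<noteq> 0"
proof -
  have "\<exists>i\<in>K. \<exists>y. \<alpha> y (K - {i}) \<noteq> 0"
  proof (rule ccontr)
    assume "\<not> ?thesis"
    then have "(\<lambda>y. \<alpha> y (K - {i})) = (\<lambda>y. 0)" if "i \<in> K" for i using that by auto
    then have "pderivative i (\<lambda>y. \<alpha> y (K - {i})) x = 0" if "i \<in> K" for i using that by simp
    then show False using assms by (simp add: local_d_def split: if_splits)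
  qed
  then show thesis using that by blast
qed

lemma form_on_local_d: "form_on n (local_d n \<alpha>)"
  by (auto simp: form_on_def local_d_def split: if_splits)

lemma form_on_local_fun: "form_on n (local_fun u)"
  by (simp add: form_on_def local_fun_def)

lemma form_on_mul:
  assumes "form_on n \<alpha>" "form_on n \<beta>"
  shows "form_on n (\<lambda>x. ext_mul (\<alpha> x) (\<beta> x))"
  unfolding form_on_def
proof (intro allI impI)
  fix x K assume "ext_mul (\<alpha> x) (\<beta> x) K \<noteq> 0"
  then obtain I where "I \<subseteq> K" "\<alpha> x I \<noteq> 0" "\<beta> x (K - I) \<noteq> 0" by (rule ext_mul_nonzero)
  then have "I \<subseteq> {..<n}" "K - I \<subseteq> {..<n}" using assms by (auto simp: form_on_def)
  then show "K \<subseteq> {..<n}" by auto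
qed

lemma differential_eq:
  "differential n u x = (\<lambda>K. \<Sum>j<n. pderivative j u x * ext_basis j K)"
proof -
  have "coeff_pderivative j (local_fun u) x = (\<lambda>I. pderivative j u x * ext_one I)" for j
    by (auto simp: coeff_pderivative_def local_fun_def ext_one_def)
  then have "ext_mul (ext_basis j) (coeff_pderivative j (local_fun u) x)
      = (\<lambda>K. pderivative j u x * ext_basis j K)" for j
    using one_form_infinite[OF one_form_basis] by (simp add: ext_mul_scale_right ext_mul_one_right)
  then show ?thesis by (simp add: local_d_eq[OF form_on_local_fun])
qed

lemma one_form_differential: "one_form (differential n u x)"
  unfolding one_form_def differential_eq
  by (auto simp: ext_basis_def elim!: sum.not_neutral_contains_not_neutral split: if_splits)

lemma differential_nonzero: "differential n u x I \<noteq> 0 \<Longrightarrow> I \<subseteq> {..<n}"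
  using form_on_local_d by (auto simp: form_on_def)

lemma smooth_formD: "smooth_form n V \<alpha> \<Longrightarrow> smooth_fun n V (\<lambda>x. \<alpha> x I)"
  by (simp add: smooth_form_def)

lemma smooth_form_const: "smooth_form n V (\<lambda>x. a)"
  by (simp add: smooth_form_def smooth_fun_const)

lemma smooth_form_local_fun:
  assumes "smooth_fun n V u"
  shows "smooth_form n V (local_fun u)"
  unfolding smooth_form_def
proof
  fix I show "smooth_fun n V (\<lambda>x. local_fun u x I)"
    using assms by (cases "I = {}") (simp_all add: local_fun_def smooth_fun_const)
qed

lemma smooth_form_mul:
  assumes V: "open_Rn n V" and "smooth_form n V \<alpha>" "smooth_form n V \<beta>"
  shows "smooth_form n V (\<lambda>x. ext_mul (\<alpha> x) (\<beta> x))"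
  unfolding smooth_form_def ext_mul_eq
  by (intro allI smooth_fun_sum[OF V] smooth_fun_mult[OF V] smooth_fun_const)
    (use assms in \<open>auto simp: smooth_form_def\<close>)

lemma smooth_form_coeff_pderivative:
  "\<lbrakk>smooth_form n V \<alpha>; i < n\<rbrakk> \<Longrightarrow> smooth_form n V (coeff_pderivative i \<alpha>)"
  by (simp add: smooth_form_def coeff_pderivative_def smooth_fun_pderivative)

lemma smooth_form_local_d:
  assumes V: "open_Rn n V" and \<alpha>: "smooth_form n V \<alpha>"
  shows "smooth_form n V (local_d n \<alpha>)"
  unfolding smooth_form_def
proof
  fix K
  show "smooth_fun n V (\<lambda>x. local_d n \<alpha> x K)"
  proof (cases "K \<subseteq> {..<n}")
    case True
    then have "smooth_fun n V (\<lambda>x. \<Sum>i\<in>K. (-1) ^ card {j \<in> K. j < i} * pderivative i (\<lambda>y. \<alpha> y (K - {i})) x)"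
      by (intro smooth_fun_sum[OF V] smooth_fun_mult[OF V] smooth_fun_const smooth_fun_pderivative
          smooth_formD[OF \<alpha>]) auto
    then show ?thesis using True by (simp add: local_d_def)
  qed (simp add: local_d_def smooth_fun_const)
qed

lemma coeff_pderivative_mul:
  assumes V: "open_Rn n V" and x: "x \<in> V" and i: "i < n"
    and \<alpha>: "smooth_form n V \<alpha>" and \<beta>: "smooth_form n V \<beta>"
  shows "coeff_pderivative i (\<lambda>y. ext_mul (\<alpha> y) (\<beta> y)) x
    = (\<lambda>K. ext_mul (coeff_pderivative i \<alpha> x) (\<beta> x) K + ext_mul (\<alpha> x) (coeff_pderivative i \<beta> x) K)"
proof
  fix K
  note part = smooth_fun_has_partial[OF _ i x]
  have "((\<lambda>t. shuffle_sign I (K - I) * \<alpha> (x(i := t)) I * \<beta> (x(i := t)) (K - I)) has_real_derivative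
      shuffle_sign I (K - I) * coeff_pderivative i \<alpha> x I * \<beta> x (K - I)
        + shuffle_sign I (K - I) * \<alpha> x I * coeff_pderivative i \<beta> x (K - I)) (at (x i))" for I
  proof -
    have "((\<lambda>t. (shuffle_sign I (K - I) * \<alpha> (x(i := t)) I) * \<beta> (x(i := t)) (K - I)) has_real_derivative
        (shuffle_sign I (K - I) * coeff_pderivative i \<alpha> x I) * \<beta> (x(i := x i)) (K - I)
        + coeff_pderivative i \<beta> x (K - I) * (shuffle_sign I (K - I) * \<alpha> (x(i := x i)) I)) (at (x i))"
      unfolding coeff_pderivative_def
      by (intro DERIV_mult DERIV_cmult part smooth_formD[OF \<alpha>] smooth_formD[OF \<beta>])
    then show ?thesis by (simp add: algebra_simps del: fun_upd_apply)
  qed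
  then have "((\<lambda>t. \<Sum>I\<in>Pow K. shuffle_sign I (K - I) * \<alpha> (x(i := t)) I * \<beta> (x(i := t)) (K - I)) has_real_derivative
      (\<Sum>I\<in>Pow K. shuffle_sign I (K - I) * coeff_pderivative i \<alpha> x I * \<beta> x (K - I)
        + shuffle_sign I (K - I) * \<alpha> x I * coeff_pderivative i \<beta> x (K - I))) (at (x i))"
    by (intro DERIV_sum)
  then have "pderivative i (\<lambda>y. ext_mul (\<alpha> y) (\<beta> y) K) x
      = (\<Sum>I\<in>Pow K. shuffle_sign I (K - I) * coeff_pderivative i \<alpha> x I * \<beta> x (K - I)
        + shuffle_sign I (K - I) * \<alpha> x I * coeff_pderivative i \<beta> x (K - I))"
    unfolding ext_mul_eq by (rule has_partial_imp_pderivative)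
  then show "coeff_pderivative i (\<lambda>y. ext_mul (\<alpha> y) (\<beta> y)) x K
      = ext_mul (coeff_pderivative i \<alpha> x) (\<beta> x) K + ext_mul (\<alpha> x) (coeff_pderivative i \<beta> x) K"
    by (simp add: coeff_pderivative_def[of i "\<lambda>y. ext_mul (\<alpha> y) (\<beta> y)"] ext_mul_eq sum.distrib)
qed

lemma coeff_pderivative_sum:
  assumes x: "x \<in> V" and i: "i < n" and \<alpha>: "\<And>s. s \<in> S \<Longrightarrow> smooth_form n V (\<alpha> s)"
  shows "coeff_pderivative i (\<lambda>y K. \<Sum>s\<in>S. \<alpha> s y K) x = (\<lambda>K. \<Sum>s\<in>S. coeff_pderivative i (\<alpha> s) x K)"
proof
  fix K
  have "((\<lambda>t. \<Sum>s\<in>S. \<alpha> s (x(i := t)) K) has_real_derivative (\<Sum>s\<in>S. coeff_pderivative i (\<alpha> s) x K)) (at (x i))"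
    unfolding coeff_pderivative_def
    by (intro DERIV_sum smooth_fun_has_partial[OF _ i x] smooth_formD[OF \<alpha>])
  from has_partial_imp_pderivative[OF this]
  show "coeff_pderivative i (\<lambda>y K. \<Sum>s\<in>S. \<alpha> s y K) x K = (\<Sum>s\<in>S. coeff_pderivative i (\<alpha> s) x K)"
    by (simp add: coeff_pderivative_def[of i "\<lambda>y K. \<Sum>s\<in>S. \<alpha> s y K"])
qed

lemma coeff_pderivative_const: "coeff_pderivative i (\<lambda>y. a) x = (\<lambda>K. 0)"
  by (simp add: coeff_pderivative_def)

text \<open>The Leibniz rule of each \<open>\<partial>\<^sub>i\<close>; in the second summand \<open>dx\<^sub>i\<close> moves past \<open>\<alpha>\<close>, which costs \<open>(-1)\<^sup>k\<close>.\<close>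

theorem local_d_mul:
  assumes V: "open_Rn n V" and x: "x \<in> V"
    and \<alpha>: "smooth_form n V \<alpha>" "form_on n \<alpha>" and \<beta>: "smooth_form n V \<beta>" "form_on n \<beta>"
    and deg: "\<And>I. \<alpha> x I \<noteq> 0 \<Longrightarrow> int (card I) = k"
  shows "local_d n (\<lambda>y. ext_mul (\<alpha> y) (\<beta> y)) x
    = (\<lambda>K. ext_mul (local_d n \<alpha> x) (\<beta> x) K + (-1) powi k * ext_mul (\<alpha> x) (local_d n \<beta> x) K)"
proof
  fix K
  let ?e = "ext_basis" and ?D = "coeff_pderivative"
  have swap: "ext_mul (?e i) (ext_mul (\<alpha> x) b) K = (-1) powi k * ext_mul (\<alpha> x) (ext_mul (?e i) b) K" for i b
  proof -
    have "ext_mul (?e i) (\<alpha> x) = (\<lambda>K. (-1) powi k * ext_mul (\<alpha> x) (?e i) K)"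
      using ext_mul_commute[of "?e i" 1 "\<alpha> x" k] deg one_form_basis[of i] by (simp add: one_form_def)
    then show ?thesis by (simp add: ext_mul_assoc[symmetric] ext_mul_scale_left)
  qed
  have "local_d n (\<lambda>y. ext_mul (\<alpha> y) (\<beta> y)) x K
      = (\<Sum>i<n. ext_mul (?e i) (?D i (\<lambda>y. ext_mul (\<alpha> y) (\<beta> y)) x) K)"
    by (simp add: local_d_eq form_on_mul \<alpha> \<beta>)
  also have "\<dots> = (\<Sum>i<n. ext_mul (ext_mul (?e i) (?D i \<alpha> x)) (\<beta> x) K
      + (-1) powi k * ext_mul (\<alpha> x) (ext_mul (?e i) (?D i \<beta> x)) K)"
    by (rule sum.cong) (simp_all add: coeff_pderivative_mul[OF V x _ \<alpha>(1) \<beta>(1)] ext_mul_add_right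
        swap ext_mul_assoc)
  also have "\<dots> = ext_mul (local_d n \<alpha> x) (\<beta> x) K + (-1) powi k * ext_mul (\<alpha> x) (local_d n \<beta> x) K"
    by (simp add: local_d_eq \<alpha> \<beta> ext_mul_sum_left ext_mul_sum_right sum.distrib sum_distrib_left)
  finally show "local_d n (\<lambda>y. ext_mul (\<alpha> y) (\<beta> y)) x K
    = ext_mul (local_d n \<alpha> x) (\<beta> x) K + (-1) powi k * ext_mul (\<alpha> x) (local_d n \<beta> x) K" .
qed

text \<open>Second partial derivatives commute, whereas the \<open>dx\<^sub>i\<close> anticommute.\<close>

theorem local_d_local_d:
  assumes V: "open_Rn n V" and x: "x \<in> V"
    and \<alpha>: "smooth_form n V \<alpha>" "form_on n \<alpha>"
  shows "local_d n (local_d n \<alpha>) x = (\<lambda>K. 0)"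
proof
  fix K
  let ?e = "ext_basis" and ?D = "coeff_pderivative"
  define f where "f i j = ext_mul (?e i) (ext_mul (?e j) (?D i (?D j \<alpha>) x)) K" for i j
  have "?D i (local_d n \<alpha>) x = (\<lambda>L. \<Sum>j<n. ext_mul (?e j) (?D i (?D j \<alpha>) x) L)" if i: "i < n" for i
  proof -
    have "?D i (local_d n \<alpha>) x = ?D i (\<lambda>y L. \<Sum>j<n. ext_mul (?e j) (?D j \<alpha> y) L) x"
      by (simp only: local_d_eq[OF \<alpha>(2), abs_def])
    also have "\<dots> = (\<lambda>L. \<Sum>j<n. ?D i (\<lambda>y. ext_mul (?e j) (?D j \<alpha> y)) x L)"
    proof (rule coeff_pderivative_sum[OF x i])
      fix j assume "j \<in> {..<n}"
      then have "smooth_form n V (?D j \<alpha>)" by (intro smooth_form_coeff_pderivative \<alpha>) simp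
      with V smooth_form_const show "smooth_form n V (\<lambda>y. ext_mul (?e j) (?D j \<alpha> y))"
        by (rule smooth_form_mul)
    qed
    also have "\<dots> = (\<lambda>L. \<Sum>j<n. ext_mul (?e j) (?D i (?D j \<alpha>) x) L)"
    proof (intro ext sum.cong refl)
      fix L j assume "j \<in> {..<n}"
      then have "smooth_form n V (?D j \<alpha>)" by (intro smooth_form_coeff_pderivative \<alpha>) simp
      from coeff_pderivative_mul[OF V x i smooth_form_const this, of "?e j"]
      show "?D i (\<lambda>y. ext_mul (?e j) (?D j \<alpha> y)) x L = ext_mul (?e j) (?D i (?D j \<alpha>) x) L"
        by (simp add: coeff_pderivative_const)
    qed
    finally show ?thesis .
  qed
  then have d: "local_d n (local_d n \<alpha>) x K = (\<Sum>i<n. \<Sum>j<n. f i j)"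
    by (simp add: local_d_eq[OF form_on_local_d] ext_mul_sum_right f_def)
  have anti: "f i j = - f j i" if "i < n" "j < n" for i j
  proof -
    have "?D i (?D j \<alpha>) x = ?D j (?D i \<alpha>) x"
      using mixed_pderivative_commute[OF V x smooth_formD[OF \<alpha>(1)] that]
      by (simp add: coeff_pderivative_def)
    moreover have "ext_mul (?e i) (ext_mul (?e j) b) K = - ext_mul (?e j) (ext_mul (?e i) b) K" for b
      using one_form_anticommute[OF one_form_basis[of i] one_form_basis[of j]]
        ext_mul_scale_left[of "-1" "ext_mul (?e j) (?e i)" b]
      by (simp flip: ext_mul_assoc)
    ultimately show ?thesis by (simp only: f_def)
  qed
  have "(\<Sum>i<n. \<Sum>j<n. f i j) = (\<Sum>i<n. \<Sum>j<n. - f j i)"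
    by (intro sum.cong refl, rule anti) simp_all
  also have "\<dots> = - (\<Sum>i<n. \<Sum>j<n. f j i)" by (simp add: sum_negf)
  also have "(\<Sum>i<n. \<Sum>j<n. f j i) = (\<Sum>i<n. \<Sum>j<n. f i j)" by (rule sum.swap)
  finally show "local_d n (local_d n \<alpha>) x K = 0" using d by simp
qed

lemma local_d_cong:
  assumes "open_Rn n V" "x \<in> V" "\<And>y. y \<in> V \<Longrightarrow> \<alpha> y = \<beta> y"
  shows "local_d n \<alpha> x = local_d n \<beta> x"
proof
  fix K
  have "pderivative i (\<lambda>y. \<alpha> y (K - {i})) x = pderivative i (\<lambda>y. \<beta> y (K - {i})) x" if "i < n" for i
    by (rule pderivative_cong[OF assms(1,2) that]) (simp add: assms(3))
  then show "local_d n \<alpha> x K = local_d n \<beta> x K"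
    unfolding local_d_def by (auto intro!: sum.cong)
qed

lemma differential_cong:
  assumes "open_Rn n V" "x \<in> V" "\<And>y. y \<in> V \<Longrightarrow> u y = v y"
  shows "differential n u x = differential n v x"
  by (rule local_d_cong[OF assms(1,2)]) (simp add: local_fun_def assms(3) cong: if_cong)

text \<open>Chain rule: \<open>g\<^sup>*(du) = d(u \<circ> g)\<close>.\<close>

lemma ext_subst_differential:
  assumes V: "open_Rn n V" and x: "x \<in> V" and W: "open_Rn m W"
    and u: "smooth_fun m W u" and g: "smooth_vfun n m V g" "\<And>x. x \<in> V \<Longrightarrow> g x \<in> W"
  shows "ext_subst m (\<lambda>i. differential n (\<lambda>y. g y i) x) (differential m u (g x))
    = differential n (\<lambda>y. u (g y)) x"
proof -
  let ?\<theta> = "\<lambda>i. differential n (\<lambda>y. g y i) x"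
  have "ext_subst m ?\<theta> (differential m u (g x))
      = (\<lambda>K. \<Sum>j<m. pderivative j u (g x) * ext_subst m ?\<theta> (ext_basis j) K)"
    by (simp add: differential_eq[of m] ext_subst_sum ext_subst_scale)
  also have "\<dots> = (\<lambda>K. \<Sum>j<m. pderivative j u (g x) * ?\<theta> j K)"
    by (simp add: ext_subst_basis one_form_differential)
  also have "\<dots> = (\<lambda>K. \<Sum>i<n. (\<Sum>j<m. pderivative j u (g x) * pderivative i (\<lambda>y. g y j) x) * ext_basis i K)"
    unfolding differential_eq sum_distrib_left sum_distrib_right
    by (subst sum.swap) (simp add: mult_ac)
  also have "\<dots> = differential n (\<lambda>y. u (g y)) x"
    using has_partial_imp_pderivative[OF has_partial_compose[OF V x _ W u g]]
    by (simp add: differential_eq)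
  finally show ?thesis .
qed

text \<open>Both sides substitute one-forms for the coordinate differentials, and these one-forms agree by the
  chain rule.\<close>

theorem local_pullback_compose:
  assumes V: "open_Rn n V" and x: "x \<in> V" and W: "open_Rn m W"
    and g: "smooth_vfun n m V g" "\<And>x. x \<in> V \<Longrightarrow> g x \<in> W" and h: "smooth_vfun m l W h"
  shows "local_pullback n m g (local_pullback m l h \<beta>) x = local_pullback n l (\<lambda>y. h (g y)) \<beta> x"
proof -
  have "ext_subst m (\<lambda>i. differential n (\<lambda>y. g y i) x) (differential m (\<lambda>z. h z i) (g x))
      = differential n (\<lambda>y. h (g y) i) x" if "i < l" for i
    using ext_subst_differential[OF V x W _ g, of "\<lambda>z. h z i"] h that by (simp add: smooth_vfun_def)
  then show ?thesis
    unfolding local_pullback_eq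
    by (subst ext_subst_ext_subst[OF one_form_differential]) (auto intro: ext_subst_cong)
qed

lemma local_pullback_cong:
  assumes V: "open_Rn n V" and x: "x \<in> V" and g: "\<And>y. y \<in> V \<Longrightarrow> g y = g' y"
    and \<beta>: "\<beta> (g x) = \<beta>' (g x)"
  shows "local_pullback n m g \<beta> x = local_pullback n m g' \<beta>' x"
  unfolding local_pullback_eq
  by (rule ext_subst_cong) (use g[OF x] \<beta> in \<open>auto intro!: differential_cong[OF V x] simp: g\<close>)

lemma local_pullback_mul:
  "local_pullback n m g (\<lambda>y. ext_mul (\<alpha> y) (\<beta> y)) x
    = ext_mul (local_pullback n m g \<alpha> x) (local_pullback n m g \<beta> x)"
  unfolding local_pullback_eq by (rule ext_subst_mul) (rule one_form_differential)

lemma local_pullback_nonzero: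
  assumes "local_pullback n m g \<beta> x K \<noteq> 0"
  obtains I where "I \<subseteq> {..<m}" "\<beta> (g x) I \<noteq> 0" "K \<subseteq> {..<n}" "card K = card I"
proof -
  let ?\<theta> = "\<lambda>i. differential n (\<lambda>y. g y i) x"
  have "ext_subst m ?\<theta> (\<beta> (g x)) K \<noteq> 0" using assms unfolding local_pullback_eq .
  moreover have "J \<subseteq> {..<n}" if "?\<theta> i J \<noteq> 0" for i J using that by (rule differential_nonzero)
  ultimately show thesis
    using ext_subst_nonzero[of m ?\<theta> n "\<beta> (g x)" K] one_form_differential that by metis
qed

lemma form_on_local_pullback: "form_on n (local_pullback n m g \<beta>)"
  unfolding form_on_def by (auto elim: local_pullback_nonzero)

text \<open>The pullback of \<open>dy\<^sub>I\<close> is a product of the exact forms \<open>dg\<^sub>i\<close>, hence closed.\<close>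

lemma differentials_prod_closed:
  assumes V: "open_Rn n V"
    and g: "\<And>i. i \<in> I \<Longrightarrow> smooth_fun n V (\<lambda>y. g y i)" and I: "finite I"
  shows "smooth_form n V (\<lambda>y. ext_prod (\<lambda>i. differential n (\<lambda>y. g y i) y) I)"
    and "x \<in> V \<Longrightarrow> local_d n (\<lambda>y. ext_prod (\<lambda>i. differential n (\<lambda>y. g y i) y) I) x = (\<lambda>K. 0)"
    and "form_on n (\<lambda>y. ext_prod (\<lambda>i. differential n (\<lambda>y. g y i) y) I)"
proof -
  let ?\<theta> = "\<lambda>y i. differential n (\<lambda>y. g y i) y"
  have form_on: "form_on n (\<lambda>y. ext_prod (?\<theta> y) I)" if "finite I" for I
    unfolding form_on_def
  proof (intro allI impI)
    fix x K assume "ext_prod (?\<theta> x) I K \<noteq> 0"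
    from ext_prod_nonzero[OF that one_form_differential differential_nonzero this]
    show "K \<subseteq> {..<n}" by simp
  qed
  then show "form_on n (\<lambda>y. ext_prod (?\<theta> y) I)" using I by simp
  have "smooth_form n V (\<lambda>y. ext_prod (?\<theta> y) I) \<and>
      (\<forall>x\<in>V. local_d n (\<lambda>y. ext_prod (?\<theta> y) I) x = (\<lambda>K. 0))"
    using I g
  proof (induction I rule: finite_linorder_min_induct)
    case empty
    have "form_on n (\<lambda>y. ext_one)" by (simp add: form_on_def ext_one_def)
    then show ?case
      by (simp add: ext_prod_empty smooth_form_const local_d_eq coeff_pderivative_const)
  next
    case (insert b A)
    have prod: "ext_prod (?\<theta> y) (insert b A) = ext_mul (?\<theta> y b) (ext_prod (?\<theta> y) A)" for y
      using insert.hyps by (intro ext_prod_insert_min) auto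
    have A: "smooth_form n V (\<lambda>y. ext_prod (?\<theta> y) A)"
      "\<And>x. x \<in> V \<Longrightarrow> local_d n (\<lambda>y. ext_prod (?\<theta> y) A) x = (\<lambda>K. 0)"
      using insert.IH insert.prems by auto
    have fun_b: "smooth_form n V (local_fun (\<lambda>y. g y b))"
      using insert.prems by (intro smooth_form_local_fun) auto
    then have b: "smooth_form n V (differential n (\<lambda>y. g y b))" by (rule smooth_form_local_d[OF V])
    have "local_d n (\<lambda>y. ext_mul (?\<theta> y b) (ext_prod (?\<theta> y) A)) x = (\<lambda>K. 0)" if x: "x \<in> V" for x
      using local_d_mul[OF V x b form_on_local_d A(1) form_on[OF insert.hyps(1)], of 1]
        local_d_local_d[OF V x fun_b form_on_local_fun] A(2)[OF x]
        one_form_differential[of n "\<lambda>y. g y b" x]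
      by (simp add: one_form_def)
    then show ?case unfolding prod using smooth_form_mul[OF V b A(1)] by simp
  qed
  then show "smooth_form n V (\<lambda>y. ext_prod (?\<theta> y) I)"
    and "x \<in> V \<Longrightarrow> local_d n (\<lambda>y. ext_prod (?\<theta> y) I) x = (\<lambda>K. 0)" by auto
qed

lemma smooth_form_local_pullback:
  assumes V: "open_Rn n V" and W: "open_Rn m W"
    and g: "smooth_vfun n m V g" "\<And>x. x \<in> V \<Longrightarrow> g x \<in> W" and \<beta>: "smooth_form m W \<beta>"
  shows "smooth_form n V (local_pullback n m g \<beta>)"
  unfolding smooth_form_def local_pullback_eq ext_subst_def
proof (intro allI smooth_fun_sum[OF V] smooth_fun_mult[OF V])
  fix K I assume "I \<in> Pow {..<m}"
  then have I: "finite I" "\<And>i. i \<in> I \<Longrightarrow> smooth_fun n V (\<lambda>y. g y i)"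
    using g(1) finite_subset by (auto simp: smooth_vfun_def)
  show "smooth_fun n V (\<lambda>x. \<beta> (g x) I)"
    using V W smooth_formD[OF \<beta>] g by (rule smooth_fun_compose)
  show "smooth_fun n V (\<lambda>x. ext_prod (\<lambda>i. differential n (\<lambda>y. g y i) x) I K)"
    by (rule smooth_formD[OF differentials_prod_closed(1)[OF V I(2,1)]])
qed

text \<open>The pullback of \<open>\<beta> = (\<Sum>I. \<beta>\<^sub>I dy\<^sub>I)\<close> is \<open>\<Sum>I. (\<beta>\<^sub>I \<circ> g) P\<^sub>I\<close> with closed forms \<open>P\<^sub>I\<close>, so its differential is
  \<open>\<Sum>I. d(\<beta>\<^sub>I \<circ> g) \<and> P\<^sub>I\<close>. The chain rule turns \<open>d(\<beta>\<^sub>I \<circ> g)\<close> into \<open>\<Sum>l. (\<partial>\<^sub>l\<beta>\<^sub>I \<circ> g) dg\<^sub>l\<close>, and collecting the terms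
  with fixed \<open>l\<close> gives the pullback of \<open>dy\<^sub>l \<and> \<partial>\<^sub>l\<beta>\<close>.\<close>

theorem local_d_local_pullback:
  assumes V: "open_Rn n V" and x: "x \<in> V" and W: "open_Rn m W"
    and g: "smooth_vfun n m V g" "\<And>x. x \<in> V \<Longrightarrow> g x \<in> W"
    and \<beta>: "smooth_form m W \<beta>" "form_on m \<beta>"
  shows "local_d n (local_pullback n m g \<beta>) x = local_pullback n m g (local_d m \<beta>) x"
proof -
  let ?\<theta> = "\<lambda>y i. differential n (\<lambda>y. g y i) y" and ?D = "coeff_pderivative" and ?e = ext_basis
  let ?P = "\<lambda>I y. ext_prod (?\<theta> y) I"
  have I: "finite I" "\<And>i. i \<in> I \<Longrightarrow> smooth_fun n V (\<lambda>y. g y i)" if "I \<in> Pow {..<m}" for I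
    using that g(1) finite_subset by (auto simp: smooth_vfun_def)
  have P: "smooth_form n V (?P I)" "local_d n (?P I) x = (\<lambda>K. 0)" "form_on n (?P I)"
    if "I \<in> Pow {..<m}" for I
    using differentials_prod_closed[OF V I(2)[OF that] I(1)[OF that]] x by simp_all
  have \<beta>g: "smooth_fun n V (\<lambda>y. \<beta> (g y) I)" for I
    using V W smooth_formD[OF \<beta>(1)] g by (rule smooth_fun_compose)
  define F where "F I y = (\<lambda>K. \<beta> (g y) I * ?P I y K)" for I y
  have F_mul: "F I y = ext_mul (local_fun (\<lambda>y. \<beta> (g y) I) y) (?P I y)" for I y
  proof -
    have "local_fun (\<lambda>y. \<beta> (g y) I) y = (\<lambda>L. \<beta> (g y) I * ext_one L)"
      by (auto simp: local_fun_def ext_one_def)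
    then show ?thesis
      by (simp add: F_def ext_mul_scale_left ext_mul_one_left ext_prod_infinite)
  qed
  have F_smooth: "smooth_form n V (F I)" and F_on: "form_on n (F I)" if "I \<in> Pow {..<m}" for I
    unfolding F_mul
    using smooth_form_mul[OF V smooth_form_local_fun[OF \<beta>g] P(1)[OF that]]
      form_on_mul[OF form_on_local_fun P(3)[OF that]] by auto
  have F_d: "local_d n (F I) x = ext_mul (differential n (\<lambda>y. \<beta> (g y) I) x) (?P I x)"
    if "I \<in> Pow {..<m}" for I
    unfolding F_mul
  proof (subst local_d_mul[OF V x smooth_form_local_fun[OF \<beta>g] form_on_local_fun P(1)[OF that]
        P(3)[OF that], where k = 0])
    show "int (card J) = 0" if "local_fun (\<lambda>y. \<beta> (g y) I) x J \<noteq> 0" for J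
      using that by (simp add: local_fun_def split: if_splits)
  qed (simp add: P(2)[OF that])
  have "local_d n (local_pullback n m g \<beta>) x
      = (\<lambda>K. \<Sum>i<n. ext_mul (?e i) (?D i (\<lambda>y K. \<Sum>I\<in>Pow {..<m}. F I y K) x) K)"
    by (subst local_d_eq[OF form_on_local_pullback])
      (simp add: local_pullback_eq[abs_def] ext_subst_def F_def)
  also have "\<dots> = (\<lambda>K. \<Sum>I\<in>Pow {..<m}. \<Sum>i<n. ext_mul (?e i) (?D i (F I) x) K)"
  proof
    fix K
    have "(\<Sum>i<n. ext_mul (?e i) (?D i (\<lambda>y K. \<Sum>I\<in>Pow {..<m}. F I y K) x) K)
        = (\<Sum>i<n. \<Sum>I\<in>Pow {..<m}. ext_mul (?e i) (?D i (F I) x) K)"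
    proof (intro sum.cong refl)
      fix i assume "i \<in> {..<n}"
      then have i: "i < n" by simp
      show "ext_mul (?e i) (?D i (\<lambda>y K. \<Sum>I\<in>Pow {..<m}. F I y K) x) K
          = (\<Sum>I\<in>Pow {..<m}. ext_mul (?e i) (?D i (F I) x) K)"
        using coeff_pderivative_sum[where \<alpha> = F and V = V and S = "Pow {..<m}", OF x i F_smooth]
        by (simp only: ext_mul_sum_right)
    qed
    then show "(\<Sum>i<n. ext_mul (?e i) (?D i (\<lambda>y K. \<Sum>I\<in>Pow {..<m}. F I y K) x) K)
        = (\<Sum>I\<in>Pow {..<m}. \<Sum>i<n. ext_mul (?e i) (?D i (F I) x) K)"
      by (simp only: sum.swap[of _ "{..<n}"])
  qed
  also have "\<dots> = (\<lambda>K. \<Sum>I\<in>Pow {..<m}. local_d n (F I) x K)"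
    by (simp add: local_d_eq[OF F_on])
  also have "\<dots> = (\<lambda>K. \<Sum>I\<in>Pow {..<m}. ext_mul (differential n (\<lambda>y. \<beta> (g y) I) x) (?P I x) K)"
    by (simp add: F_d)
  also have "\<dots> = (\<lambda>K. \<Sum>I\<in>Pow {..<m}. \<Sum>l<m. pderivative l (\<lambda>z. \<beta> z I) (g x) * ext_mul (?\<theta> x l) (?P I x) K)"
  proof -
    have "differential n (\<lambda>y. \<beta> (g y) I) x
        = (\<lambda>K. \<Sum>l<m. pderivative l (\<lambda>z. \<beta> z I) (g x) * ?\<theta> x l K)" for I
      using ext_subst_differential[OF V x W smooth_formD[OF \<beta>(1)] g, of I]
      by (simp add: differential_eq[of m] ext_subst_sum ext_subst_scale ext_subst_basis one_form_differential)
    then show ?thesis by (simp add: ext_mul_sum_left ext_mul_scale_left)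
  qed
  also have "\<dots> = (\<lambda>K. \<Sum>l<m. ext_mul (?\<theta> x l) (ext_subst m (?\<theta> x) (?D l \<beta> (g x))) K)"
    by (subst sum.swap)
      (simp add: ext_subst_def ext_mul_sum_right ext_mul_scale_right coeff_pderivative_def)
  also have "\<dots> = (\<lambda>K. \<Sum>l<m. ext_subst m (?\<theta> x) (ext_mul (?e l) (?D l \<beta> (g x))) K)"
    by (simp add: ext_subst_mul ext_subst_basis one_form_differential)
  also have "\<dots> = local_pullback n m g (local_d m \<beta>) x"
    by (simp add: local_pullback_eq local_d_eq[OF \<beta>(2)] ext_subst_sum)
  finally show ?thesis .
qed

section \<open>The de Rham algebra of a manifold\<close>

lemma is_chartD:
  assumes "is_chart X n c"
  shows "fst c \<subseteq> topspace X" "openin X (fst c)" "inj_on (snd c) (fst c)"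
    "open_Rn n (chart_image c)"
    "\<lbrakk>openin X U; U \<subseteq> fst c\<rbrakk> \<Longrightarrow> open_Rn n (snd c ` U)"
proof -
  have *: "openin X (fst c)" "open_Rn n (chart_image c)"
    "homeomorphic_map (subtopology X (fst c)) (subtopology (Euclidean_space n) (chart_image c)) (snd c)"
    using assms by (auto simp: is_chart_def)
  then show sub: "fst c \<subseteq> topspace X" "openin X (fst c)" "open_Rn n (chart_image c)"
    by (auto dest: openin_subset)
  show "inj_on (snd c) (fst c)"
    using homeomorphic_imp_injective_map[OF *(3)] sub(1) by (simp add: inf_absorb2)
  show "open_Rn n (snd c ` U)" if "openin X U" "U \<subseteq> fst c"
  proof -
    have "openin (subtopology X (fst c)) U" using that *(1) by (simp add: openin_open_subtopology)
    then have "openin (subtopology (Euclidean_space n) (chart_image c)) (snd c ` U)"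
      using homeomorphic_imp_open_map[OF *(3)] by (simp add: open_map_def)
    then show ?thesis using *(2) by (simp add: openin_open_subtopology)
  qed
qed

lemma chart_inv_in: "x \<in> chart_image c \<Longrightarrow> chart_inv c x \<in> fst c \<and> snd c (chart_inv c x) = x"
  by (simp add: chart_image_def chart_inv_def inv_into_into f_inv_into_f)

context
  fixes M :: "('a, 'z) smooth_manifold_scheme"
  assumes M: "is_smooth_manifold M"
begin

lemma atlas_chart: "c \<in> matlas M \<Longrightarrow> is_chart (mtop M) (mdim M) c"
  using M by (simp add: is_smooth_manifold_def)

lemma chart_at:
  assumes "p \<in> topspace (mtop M)"
  obtains c where "c \<in> matlas M" "p \<in> fst c"
  using M assms unfolding is_smooth_manifold_def by blast

lemma chart_inv_chart [simp]: "\<lbrakk>c \<in> matlas M; p \<in> fst c\<rbrakk> \<Longrightarrow> chart_inv c (snd c p) = p"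
  using is_chartD(3)[OF atlas_chart] by (simp add: chart_inv_def)

lemma chart_image_open: "c \<in> matlas M \<Longrightarrow> open_Rn (mdim M) (chart_image c)"
  using is_chartD(4)[OF atlas_chart] .

lemma chart_domain_open: "c \<in> matlas M \<Longrightarrow> openin (mtop M) (fst c)"
  using is_chartD(2)[OF atlas_chart] .

lemma chart_subset_topspace: "\<lbrakk>c \<in> matlas M; p \<in> fst c\<rbrakk> \<Longrightarrow> p \<in> topspace (mtop M)"
  using is_chartD(1)[OF atlas_chart] by blast

lemma smooth_map_id: "smooth_map M M (\<lambda>p. p)"
  using M by (auto simp: smooth_map_def is_smooth_manifold_def smooth_transition_def Int_def)

end

lemma smooth_vfun_subset:
  assumes "smooth_vfun n m V g" "open_Rn n V" "open_Rn n U" "U \<subseteq> V"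
  shows "smooth_vfun n m U g"
  using assms(1) smooth_fun_subset[OF _ assms(2-4)] by (simp add: smooth_vfun_def)

abbreviation chart_rep :: "'a chart \<Rightarrow> ('a \<Rightarrow> 'b) \<Rightarrow> 'b chart \<Rightarrow> rvec \<Rightarrow> rvec" where
  "chart_rep c f c' \<equiv> \<lambda>x. snd c' (f (chart_inv c x))"

abbreviation chart_preimage :: "'a chart \<Rightarrow> ('a \<Rightarrow> 'b) \<Rightarrow> 'b set \<Rightarrow> rvec set" where
  "chart_preimage c f B \<equiv> snd c ` {p \<in> fst c. f p \<in> B}"

lemma openin_chart_preimage:
  assumes M: "is_smooth_manifold M" and f: "continuous_map (mtop M) X f"
    and c: "c \<in> matlas M" and B: "openin X B"
  shows "openin (mtop M) {p \<in> fst c. f p \<in> B}"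
proof -
  have "{p \<in> fst c. f p \<in> B} = fst c \<inter> {p \<in> topspace (mtop M). f p \<in> B}"
    using chart_subset_topspace[OF M c] by auto
  then show ?thesis
    using chart_domain_open[OF M c] openin_continuous_map_preimage[OF f B] by (simp add: openin_Int)
qed

lemma smooth_map_continuous: "smooth_map M N f \<Longrightarrow> continuous_map (mtop M) (mtop N) f"
  by (simp add: smooth_map_def)

text \<open>A smooth map in the charts \<open>c\<close>, \<open>c'\<close>, restricted to the preimage of an open set \<open>B\<close>. For
  the identity map these are the transition maps of the atlas.\<close>

lemma smooth_map_in_charts:
  assumes M: "is_smooth_manifold M" and N: "is_smooth_manifold N" and f: "smooth_map M N f"
    and c: "c \<in> matlas M" and c': "c' \<in> matlas N" and B: "openin (mtop N) B" "B \<subseteq> fst c'"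
  shows "open_Rn (mdim M) (chart_preimage c f B)"
    and "smooth_vfun (mdim M) (mdim N) (chart_preimage c f B) (chart_rep c f c')"
    and "x \<in> chart_preimage c f B \<Longrightarrow> snd c' (f (chart_inv c x)) \<in> snd c' ` B"
proof -
  have opn: "open_Rn (mdim M) (chart_preimage c f B)"
    if "openin (mtop N) B" for B
    using openin_chart_preimage[OF M smooth_map_continuous[OF f] c that]
    by (rule is_chartD(5)[OF atlas_chart[OF M c]]) auto
  from opn[OF B(1)] show "open_Rn (mdim M) (chart_preimage c f B)" .
  have "smooth_vfun (mdim M) (mdim N) (chart_preimage c f (fst c')) (chart_rep c f c')"
    using f c c' by (simp add: smooth_map_def)
  then show "smooth_vfun (mdim M) (mdim N) (chart_preimage c f B) (chart_rep c f c')"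
    using opn[OF chart_domain_open[OF N c']] opn[OF B(1)]
    by (rule smooth_vfun_subset) (use B(2) in auto)
  show "x \<in> chart_preimage c f B \<Longrightarrow> snd c' (f (chart_inv c x)) \<in> snd c' ` B"
    using chart_inv_chart[OF M c] by auto
qed

text \<open>Near a point \<open>p\<close> the composite in charts factors through a chart around \<open>f p\<close>.\<close>

lemma smooth_map_compose:
  assumes X: "is_smooth_manifold X" and Y: "is_smooth_manifold Y" and Z: "is_smooth_manifold Z"
    and f: "smooth_map X Y f" and g: "smooth_map Y Z g"
  shows "smooth_map X Z (compose (topspace (mtop X)) g f)"
proof -
  let ?h = "compose (topspace (mtop X)) g f"
  have h: "?h p = g (f p)" if "p \<in> topspace (mtop X)" for p using that by (simp add: compose_def)
  have cont: "continuous_map (mtop X) (mtop Z) ?h"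
    using f g continuous_map_compose[of "mtop X" "mtop Y" f "mtop Z" g]
    by (auto simp: smooth_map_def h elim: continuous_map_eq)
  have "smooth_fun (mdim X) (chart_preimage c ?h (fst c'')) (\<lambda>x. snd c'' (?h (chart_inv c x)) i)"
    if c: "c \<in> matlas X" and c'': "c'' \<in> matlas Z" and i: "i < mdim Z" for c c'' i
  proof (rule smooth_fun_local)
    have "openin (mtop X) {p \<in> fst c. ?h p \<in> fst c''}"
      by (rule openin_chart_preimage[OF X cont c chart_domain_open[OF Z c'']])
    then show "open_Rn (mdim X) (chart_preimage c ?h (fst c''))"
      by (rule is_chartD(5)[OF atlas_chart[OF X c]]) auto
    fix x assume "x \<in> chart_preimage c ?h (fst c'')"
    then obtain p where p: "p \<in> fst c" "?h p \<in> fst c''" "x = snd c p" by auto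
    have top: "q \<in> topspace (mtop X)" if "q \<in> fst c" for q using chart_subset_topspace[OF X c that] .
    have "f p \<in> topspace (mtop Y)"
      using f top[OF p(1)] by (auto simp: smooth_map_def continuous_map_def)
    then obtain c' where c': "c' \<in> matlas Y" "f p \<in> fst c'" by (rule chart_at[OF Y])
    define B where "B = {q \<in> fst c'. g q \<in> fst c''}"
    have B: "openin (mtop Y) B" "B \<subseteq> fst c'"
      using openin_chart_preimage[OF Y smooth_map_continuous[OF g] c'(1) chart_domain_open[OF Z c'']]
      by (auto simp: B_def)
    note rep_f = smooth_map_in_charts[OF X Y f c c'(1) B]
    note rep_g = smooth_map_in_charts[OF Y Z g c'(1) c'' chart_domain_open[OF Z c''] subset_refl]
    let ?U = "chart_preimage c f B"
    have "smooth_fun (mdim X) ?U (\<lambda>x. snd c'' (g (chart_inv c' (snd c' (f (chart_inv c x))))) i)"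
      using rep_g(2) i
      by (intro smooth_fun_compose[OF rep_f(1) rep_g(1) _ rep_f(2),
            where h = "\<lambda>y. snd c'' (g (chart_inv c' y)) i"])
        (auto simp: smooth_vfun_def B_def chart_inv_chart[OF X c])
    then have "smooth_fun (mdim X) ?U (\<lambda>x. snd c'' (?h (chart_inv c x)) i)"
      by (rule smooth_fun_cong[OF rep_f(1)])
        (auto simp: B_def chart_inv_chart[OF X c] chart_inv_chart[OF Y c'(1)] h top)
    moreover have "x \<in> ?U" using p c'(2) top by (auto simp: B_def h)
    ultimately show "\<exists>U. open_Rn (mdim X) U \<and> x \<in> U \<and>
        smooth_fun (mdim X) U (\<lambda>x. snd c'' (?h (chart_inv c x)) i)"
      using rep_f(1) by (intro exI[of _ ?U]) simp
  qed
  with cont show ?thesis by (simp add: smooth_map_def smooth_vfun_def)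
qed

lemma Omega_iff:
  "\<alpha> \<in> Omega M k \<longleftrightarrow>
     (\<forall>c x I. \<alpha> c x I \<noteq> 0 \<longrightarrow> c \<in> matlas M \<and> x \<in> chart_image c \<and> I \<subseteq> {..<mdim M} \<and> int (card I) = k) \<and>
     (\<forall>c\<in>matlas M. smooth_form (mdim M) (chart_image c) (\<alpha> c)) \<and>
     (\<forall>c\<in>matlas M. \<forall>c'\<in>matlas M. \<forall>x\<in>snd c ` {p \<in> fst c. p \<in> fst c'}.
        \<alpha> c x = local_pullback (mdim M) (mdim M) (\<lambda>y. snd c' (chart_inv c y)) (\<alpha> c') x)"
  by (simp add: Omega_def smooth_form_def Int_def)

lemma Omega_nonzero:
  assumes "\<alpha> \<in> Omega M k" "\<alpha> c x I \<noteq> 0"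
  shows "c \<in> matlas M" "x \<in> chart_image c" "I \<subseteq> {..<mdim M}" "int (card I) = k"
  using assms unfolding Omega_iff by blast+

lemma Omega_smooth: "\<lbrakk>\<alpha> \<in> Omega M k; c \<in> matlas M\<rbrakk> \<Longrightarrow> smooth_form (mdim M) (chart_image c) (\<alpha> c)"
  by (simp add: Omega_iff)

lemma Omega_compatible:
  "\<lbrakk>\<alpha> \<in> Omega M k; c \<in> matlas M; c' \<in> matlas M; x \<in> snd c ` {p \<in> fst c. p \<in> fst c'}\<rbrakk>
   \<Longrightarrow> \<alpha> c x = local_pullback (mdim M) (mdim M) (\<lambda>y. snd c' (chart_inv c y)) (\<alpha> c') x"
  unfolding Omega_iff by blast

lemma Omega_form_on: "\<alpha> \<in> Omega M k \<Longrightarrow> form_on (mdim M) (\<alpha> c)"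
  unfolding form_on_def using Omega_nonzero(3) by blast

lemma Omega_infinite:
  assumes "\<alpha> \<in> Omega M k" "infinite I"
  shows "\<alpha> c x I = 0"
proof (rule ccontr)
  assume "\<alpha> c x I \<noteq> 0"
  from Omega_nonzero(3)[OF assms(1) this] assms(2) show False using finite_subset by blast
qed

lemma Omega_outside:
  assumes "\<alpha> \<in> Omega M k" "\<not> (c \<in> matlas M \<and> x \<in> chart_image c)"
  shows "\<alpha> c x = (\<lambda>I. 0)"
  using Omega_nonzero(1,2)[OF assms(1)] assms(2) by blast

lemma local_pullback_add:
  "local_pullback n m g (\<lambda>y I. \<alpha> y I + \<beta> y I) x
    = (\<lambda>K. local_pullback n m g \<alpha> x K + local_pullback n m g \<beta> x K)"
  unfolding local_pullback_eq by (rule ext_subst_add)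

lemma local_pullback_scale:
  "local_pullback n m g (\<lambda>y I. r * \<alpha> y I) x = (\<lambda>K. r * local_pullback n m g \<alpha> x K)"
  unfolding local_pullback_eq by (rule ext_subst_scale)

lemma smooth_form_add:
  "\<lbrakk>open_Rn n V; smooth_form n V \<alpha>; smooth_form n V \<beta>\<rbrakk>
   \<Longrightarrow> smooth_form n V (\<lambda>x I. \<alpha> x I + \<beta> x I)"
  by (simp add: smooth_form_def smooth_fun_add)

lemma smooth_form_scale:
  "\<lbrakk>open_Rn n V; smooth_form n V \<alpha>\<rbrakk> \<Longrightarrow> smooth_form n V (\<lambda>x I. r * \<alpha> x I)"
  by (simp add: smooth_form_def smooth_fun_mult smooth_fun_const)

lemma smooth_form_cong:
  assumes "open_Rn n V" "smooth_form n V \<alpha>" "\<And>x. x \<in> V \<Longrightarrow> \<alpha> x = \<beta> x"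
  shows "smooth_form n V \<beta>"
  unfolding smooth_form_def
proof
  fix I show "smooth_fun n V (\<lambda>x. \<beta> x I)"
    using assms(1) smooth_formD[OF assms(2), of I] by (rule smooth_fun_cong) (simp add: assms(3))
qed

context
  fixes M :: "('a, 'z) smooth_manifold_scheme"
  assumes M: "is_smooth_manifold M"
begin

lemmas overlap = smooth_map_in_charts[OF M M smooth_map_id[OF M]]

lemma Omega_combination:
  assumes \<alpha>: "\<alpha> \<in> Omega M k" and \<beta>: "\<beta> \<in> Omega M k"
  shows "(\<lambda>c x I. r * \<alpha> c x I + s * \<beta> c x I) \<in> Omega M k"
  unfolding Omega_iff
proof (intro conjI allI ballI impI)
  fix c x I assume "r * \<alpha> c x I + s * \<beta> c x I \<noteq> 0"
  then have "\<alpha> c x I \<noteq> 0 \<or> \<beta> c x I \<noteq> 0" by auto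
  then show "c \<in> matlas M" "x \<in> chart_image c" "I \<subseteq> {..<mdim M}" "int (card I) = k"
    using Omega_nonzero[OF \<alpha>, of c x I] Omega_nonzero[OF \<beta>, of c x I] by auto
next
  fix c assume c: "c \<in> matlas M"
  note V = chart_image_open[OF M c]
  show "smooth_form (mdim M) (chart_image c) (\<lambda>x I. r * \<alpha> c x I + s * \<beta> c x I)"
    by (rule smooth_form_add[OF V smooth_form_scale[OF V Omega_smooth[OF \<alpha> c]]
          smooth_form_scale[OF V Omega_smooth[OF \<beta> c]]])
next
  fix c c' x assume "c \<in> matlas M" "c' \<in> matlas M" "x \<in> snd c ` {p \<in> fst c. p \<in> fst c'}"
  from Omega_compatible[OF \<alpha> this] Omega_compatible[OF \<beta> this]
  show "(\<lambda>I. r * \<alpha> c x I + s * \<beta> c x I) = local_pullback (mdim M) (mdim M)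
      (\<lambda>y. snd c' (chart_inv c y)) (\<lambda>x I. r * \<alpha> c' x I + s * \<beta> c' x I) x"
    by (simp add: local_pullback_add local_pullback_scale)
qed

lemma Omega_add: "\<lbrakk>\<alpha> \<in> Omega M k; \<beta> \<in> Omega M k\<rbrakk> \<Longrightarrow> (\<lambda>c x I. \<alpha> c x I + \<beta> c x I) \<in> Omega M k"
  using Omega_combination[of \<alpha> k \<beta> 1 1] by simp

lemma Omega_scale: "\<alpha> \<in> Omega M k \<Longrightarrow> (\<lambda>c x I. r * \<alpha> c x I) \<in> Omega M k"
  using Omega_combination[of \<alpha> k \<alpha> r 0] by simp

lemma Omega_zero: "(\<lambda>c x I. 0) \<in> Omega M k"
  by (auto simp: Omega_iff smooth_form_const local_pullback_eq ext_subst_def)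

lemma Omega_wedge:
  assumes \<alpha>: "\<alpha> \<in> Omega M k" and \<beta>: "\<beta> \<in> Omega M l"
  shows "wedge \<alpha> \<beta> \<in> Omega M (k + l)"
  unfolding Omega_iff
proof (intro conjI allI ballI impI)
  fix c x K assume "wedge \<alpha> \<beta> c x K \<noteq> 0"
  then have "ext_mul (\<alpha> c x) (\<beta> c x) K \<noteq> 0" by (simp add: wedge_def)
  then obtain I where I: "finite K" "I \<subseteq> K" "\<alpha> c x I \<noteq> 0" "\<beta> c x (K - I) \<noteq> 0"
    by (rule ext_mul_nonzero)
  note n\<alpha> = Omega_nonzero[OF \<alpha> I(3)] and n\<beta> = Omega_nonzero[OF \<beta> I(4)]
  show "c \<in> matlas M" "x \<in> chart_image c" by fact+
  show "K \<subseteq> {..<mdim M}" using n\<alpha>(3) n\<beta>(3) by auto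
  have "card K = card I + card (K - I)"
    using I(1,2) by (metis card_Diff_subset card_mono finite_subset le_add_diff_inverse)
  then show "int (card K) = k + l" using n\<alpha>(4) n\<beta>(4) by simp
next
  fix c assume c: "c \<in> matlas M"
  show "smooth_form (mdim M) (chart_image c) (wedge \<alpha> \<beta> c)"
    unfolding wedge_def
    using chart_image_open[OF M c] Omega_smooth[OF \<alpha> c] Omega_smooth[OF \<beta> c] by (rule smooth_form_mul)
next
  fix c c' x assume "c \<in> matlas M" "c' \<in> matlas M" "x \<in> snd c ` {p \<in> fst c. p \<in> fst c'}"
  from Omega_compatible[OF \<alpha> this] Omega_compatible[OF \<beta> this]
  show "wedge \<alpha> \<beta> c x = local_pullback (mdim M) (mdim M) (\<lambda>y. snd c' (chart_inv c y)) (wedge \<alpha> \<beta> c') x"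
    by (simp add: wedge_def[abs_def] local_pullback_mul)
qed

lemma overlap_image:
  "\<lbrakk>c \<in> matlas M; x \<in> snd c ` {p \<in> fst c. p \<in> fst c'}\<rbrakk>
   \<Longrightarrow> x \<in> chart_image c \<and> snd c' (chart_inv c x) \<in> chart_image c'"
  using chart_inv_chart[OF M, of c] by (auto simp: chart_image_def)

lemma Omega_one: "form_one M \<in> Omega M 0"
  unfolding Omega_iff
proof (intro conjI allI ballI impI)
  fix c x K assume "form_one M c x K \<noteq> 0"
  then show "c \<in> matlas M" "x \<in> chart_image c" "K \<subseteq> {..<mdim M}" "int (card K) = 0"
    by (auto simp: form_one_def ext_one_def split: if_splits)
next
  fix c assume c: "c \<in> matlas M"
  show "smooth_form (mdim M) (chart_image c) (form_one M c)"
    by (rule smooth_form_cong[OF chart_image_open[OF M c] smooth_form_const[of _ _ ext_one]])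
      (simp add: form_one_def c)
next
  fix c c' x assume "c \<in> matlas M" "c' \<in> matlas M" "x \<in> snd c ` {p \<in> fst c. p \<in> fst c'}"
  with overlap_image[of c x c']
  show "form_one M c x = local_pullback (mdim M) (mdim M) (\<lambda>y. snd c' (chart_inv c y)) (form_one M c') x"
    by (simp add: form_one_def local_pullback_eq ext_subst_one)
qed

text \<open>The local differentials are compatible since \<open>d\<close> commutes with pullback along the transition
  maps.\<close>

lemma Omega_ext_d:
  assumes \<alpha>: "\<alpha> \<in> Omega M k"
  shows "ext_d M \<alpha> \<in> Omega M (k + 1)"
  unfolding Omega_iff
proof (intro conjI allI ballI impI)
  fix c x K assume nz: "ext_d M \<alpha> c x K \<noteq> 0"
  then show "c \<in> matlas M" "x \<in> chart_image c" and K: "K \<subseteq> {..<mdim M}"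
    by (simp_all add: ext_d_def local_d_def split: if_splits)
  have "local_d (mdim M) (\<alpha> c) x K \<noteq> 0" using nz by (simp add: ext_d_def split: if_splits)
  then obtain i where i: "i \<in> K" "\<exists>y. \<alpha> c y (K - {i}) \<noteq> 0"
    by (rule local_d_nonzero)
  have "int (card (K - {i})) = k" using i(2) Omega_nonzero(4)[OF \<alpha>] by blast
  moreover have "card K = Suc (card (K - {i}))"
    using card_Suc_Diff1[of K i] i(1) finite_subset[OF K] by simp
  ultimately show "int (card K) = k + 1" by simp
next
  fix c assume c: "c \<in> matlas M"
  show "smooth_form (mdim M) (chart_image c) (ext_d M \<alpha> c)"
    by (rule smooth_form_cong[OF chart_image_open[OF M c]
          smooth_form_local_d[OF chart_image_open[OF M c] Omega_smooth[OF \<alpha> c]]])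
      (simp add: ext_d_def c)
next
  fix c c' x assume c: "c \<in> matlas M" "c' \<in> matlas M" and x: "x \<in> snd c ` {p \<in> fst c. p \<in> fst c'}"
  let ?t = "\<lambda>y. snd c' (chart_inv c y)" and ?n = "mdim M"
  note ov = overlap[OF c chart_domain_open[OF M c(2)] subset_refl]
  have W: "?t y \<in> chart_image c'" if "y \<in> snd c ` {p \<in> fst c. p \<in> fst c'}" for y
    using overlap_image[OF c(1) that] by simp
  have "ext_d M \<alpha> c x = local_d ?n (\<alpha> c) x"
    using c(1) overlap_image[OF c(1) x] by (simp add: ext_d_def)
  also have "\<dots> = local_d ?n (local_pullback ?n ?n ?t (\<alpha> c')) x"
    using ov(1) x Omega_compatible[OF \<alpha> c] by (rule local_d_cong)
  also have "\<dots> = local_pullback ?n ?n ?t (local_d ?n (\<alpha> c')) x"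
    using ov(1) x chart_image_open[OF M c(2)] ov(2) W Omega_smooth[OF \<alpha> c(2)] Omega_form_on[OF \<alpha>]
    by (rule local_d_local_pullback)
  also have "\<dots> = local_pullback ?n ?n ?t (ext_d M \<alpha> c') x"
    using ov(1) x by (rule local_pullback_cong) (use W[OF x] c(2) in \<open>simp_all add: ext_d_def\<close>)
  finally show "ext_d M \<alpha> c x = local_pullback ?n ?n ?t (ext_d M \<alpha> c') x" .
qed

end

lemma deRham_simps [simp]:
  "gcarrier (deRham M) k = Omega M k"
  "\<zero>\<^bsub>gpiece (deRham M) k\<^esub> = (\<lambda>c x I. 0)"
  "\<alpha> \<oplus>\<^bsub>gpiece (deRham M) k\<^esub> \<beta> = (\<lambda>c x I. \<alpha> c x I + \<beta> c x I)"
  "r \<odot>\<^bsub>gpiece (deRham M) k\<^esub> \<alpha> = (\<lambda>c x I. r * \<alpha> c x I)"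
  "gmul (deRham M) k l = wedge" "gone (deRham M) = form_one M" "gdiff (deRham M) k = ext_d M"
  by (simp_all add: deRham_def)

lemma cring_real_ring: "cring real_ring"
proof (intro cringI abelian_groupI comm_monoidI)
  fix x assume "x \<in> carrier real_ring"
  show "\<exists>y\<in>carrier real_ring. y \<oplus>\<^bsub>real_ring\<^esub> x = \<zero>\<^bsub>real_ring\<^esub>"
    by (rule bexI[of _ "- x"]) simp_all
qed (simp_all add: algebra_simps)

lemma deRham_piece_module:
  assumes M: "is_smooth_manifold M"
  shows "module real_ring (gpiece (deRham M) k)"
proof (rule moduleI)
  show "cring real_ring" by (rule cring_real_ring)
  show "abelian_group (gpiece (deRham M) k)"
  proof (rule abelian_groupI)
    fix \<alpha> assume "\<alpha> \<in> gcarrier (deRham M) k"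
    then have "(\<lambda>c x I. -1 * \<alpha> c x I) \<in> gcarrier (deRham M) k"
      using Omega_scale[OF M, of \<alpha> k "-1"] by simp
    then show "\<exists>\<beta>\<in>gcarrier (deRham M) k. \<beta> \<oplus>\<^bsub>gpiece (deRham M) k\<^esub> \<alpha> = \<zero>\<^bsub>gpiece (deRham M) k\<^esub>"
      by (rule bexI[rotated]) simp
  qed (simp_all add: Omega_add[OF M] Omega_zero[OF M] algebra_simps)
qed (simp_all add: Omega_scale[OF M] algebra_simps)

text \<open>All identities are checked pointwise in charts. At chart--point pairs outside the atlas both sides
  vanish because forms are zero there.\<close>

lemma is_cdga_deRham:
  assumes M: "is_smooth_manifold M"
  shows "is_cdga (deRham M)"
proof (rule is_cdga.intro, unfold deRham_simps)
  show "module real_ring (gpiece (deRham M) k)" for k by (rule deRham_piece_module[OF M])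
  show "wedge \<alpha> \<beta> \<in> Omega M (k + l)" if "\<alpha> \<in> Omega M k" "\<beta> \<in> Omega M l" for \<alpha> \<beta> k l
    using that by (rule Omega_wedge[OF M])
  show "wedge (\<lambda>c x I. \<alpha> c x I + \<alpha>' c x I) \<beta> = (\<lambda>c x I. wedge \<alpha> \<beta> c x I + wedge \<alpha>' \<beta> c x I)" for \<alpha> \<alpha>' \<beta>
    by (simp add: wedge_def ext_mul_add_left)
  show "wedge \<alpha> (\<lambda>c x I. \<beta> c x I + \<beta>' c x I) = (\<lambda>c x I. wedge \<alpha> \<beta> c x I + wedge \<alpha> \<beta>' c x I)" for \<alpha> \<beta> \<beta>'
    by (simp add: wedge_def ext_mul_add_right)
  show "wedge (\<lambda>c x I. r * \<alpha> c x I) \<beta> = (\<lambda>c x I. r * wedge \<alpha> \<beta> c x I)" for r \<alpha> \<beta>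
    by (simp add: wedge_def ext_mul_scale_left)
  show "wedge \<alpha> (\<lambda>c x I. r * \<beta> c x I) = (\<lambda>c x I. r * wedge \<alpha> \<beta> c x I)" for r \<alpha> \<beta>
    by (simp add: wedge_def ext_mul_scale_right)
  show "wedge (wedge \<alpha> \<beta>) \<gamma> = wedge \<alpha> (wedge \<beta> \<gamma>)" for \<alpha> \<beta> \<gamma>
    by (simp add: wedge_def ext_mul_assoc)
  show "form_one M \<in> Omega M 0" by (rule Omega_one[OF M])
  show "wedge (form_one M) \<alpha> = \<alpha>" "wedge \<alpha> (form_one M) = \<alpha>" if \<alpha>: "\<alpha> \<in> Omega M k" for \<alpha> k
  proof -
    have "ext_mul (form_one M c x) (\<alpha> c x) = \<alpha> c x \<and> ext_mul (\<alpha> c x) (form_one M c x) = \<alpha> c x" for c x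
      using Omega_outside[OF \<alpha>, of c x] Omega_infinite[OF \<alpha>]
      by (auto simp: form_one_def ext_mul_one_left ext_mul_one_right)
    then show "wedge (form_one M) \<alpha> = \<alpha>" "wedge \<alpha> (form_one M) = \<alpha>" by (simp_all add: wedge_def)
  qed
  show "wedge \<alpha> \<beta> = (\<lambda>c x I. (-1) powi (k * l) * wedge \<beta> \<alpha> c x I)"
    if "\<alpha> \<in> Omega M k" "\<beta> \<in> Omega M l" for \<alpha> \<beta> k l
    using ext_mul_commute[OF Omega_nonzero(4)[OF that(1)] Omega_nonzero(4)[OF that(2)]]
    by (simp only: wedge_def)
  show "ext_d M \<alpha> \<in> Omega M (k + 1)" if "\<alpha> \<in> Omega M k" for \<alpha> k
    using that by (rule Omega_ext_d[OF M])
  have pd: "((\<lambda>t. \<alpha> c (x(i := t)) I) has_real_derivative pderivative i (\<lambda>y. \<alpha> c y I) x) (at (x i))"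
    if "\<alpha> \<in> Omega M k" "c \<in> matlas M" "x \<in> chart_image c" "i < mdim M" for \<alpha> k c x i I
    using smooth_formD[OF Omega_smooth[OF that(1,2)]] that(4,3) by (rule smooth_fun_has_partial)
  have pd_add: "pderivative i (\<lambda>y. \<alpha> c y I + \<alpha>' c y I) x
      = pderivative i (\<lambda>y. \<alpha> c y I) x + pderivative i (\<lambda>y. \<alpha>' c y I) x"
    if "\<alpha> \<in> Omega M k" "\<alpha>' \<in> Omega M k" "c \<in> matlas M" "x \<in> chart_image c" "i < mdim M" for \<alpha> \<alpha>' k c x i I
    using DERIV_add[OF pd[OF that(1,3-5)] pd[OF that(2,3-5)]] by (rule has_partial_imp_pderivative)
  have pd_scale: "pderivative i (\<lambda>y. r * \<alpha> c y I) x = r * pderivative i (\<lambda>y. \<alpha> c y I) x"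
    if "\<alpha> \<in> Omega M k" "c \<in> matlas M" "x \<in> chart_image c" "i < mdim M" for \<alpha> k c x i I r
    using DERIV_cmult[OF pd[OF that]] by (rule has_partial_imp_pderivative)
  have local_d_add: "local_d (mdim M) (\<lambda>x I. \<alpha> c x I + \<alpha>' c x I) x K
      = local_d (mdim M) (\<alpha> c) x K + local_d (mdim M) (\<alpha>' c) x K"
    if "\<alpha> \<in> Omega M k" "\<alpha>' \<in> Omega M k" "c \<in> matlas M" "x \<in> chart_image c" for \<alpha> \<alpha>' k c x K
    unfolding local_d_def
    by (simp add: sum.distrib[symmetric] distrib_left[symmetric], intro impI sum.cong refl)
      (use pd_add[OF that] in auto)
  show "ext_d M (\<lambda>c x I. \<alpha> c x I + \<alpha>' c x I) = (\<lambda>c x I. ext_d M \<alpha> c x I + ext_d M \<alpha>' c x I)"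
    if "\<alpha> \<in> Omega M k" "\<alpha>' \<in> Omega M k" for \<alpha> \<alpha>' k
    by (intro ext) (simp add: ext_d_def local_d_add[OF that])
  have local_d_scale: "local_d (mdim M) (\<lambda>x I. r * \<alpha> c x I) x K = r * local_d (mdim M) (\<alpha> c) x K"
    if "\<alpha> \<in> Omega M k" "c \<in> matlas M" "x \<in> chart_image c" for \<alpha> k c x K r
    unfolding local_d_def
    by (simp add: sum_distrib_left mult.left_commute[of r], intro impI sum.cong refl)
      (use pd_scale[OF that] in auto)
  show "ext_d M (\<lambda>c x I. r * \<alpha> c x I) = (\<lambda>c x I. r * ext_d M \<alpha> c x I)" if "\<alpha> \<in> Omega M k" for r \<alpha> k
    by (intro ext) (simp add: ext_d_def local_d_scale[OF that])
  show "ext_d M (ext_d M \<alpha>) = (\<lambda>c x I. 0)" if \<alpha>: "\<alpha> \<in> Omega M k" for \<alpha> k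
  proof (intro ext)
    fix c x I
    show "ext_d M (ext_d M \<alpha>) c x I = 0"
    proof (cases "c \<in> matlas M \<and> x \<in> chart_image c")
      case True
      then have c: "c \<in> matlas M" and x: "x \<in> chart_image c" by auto
      have "ext_d M (ext_d M \<alpha>) c x = local_d (mdim M) (local_d (mdim M) (\<alpha> c)) x"
        using c x local_d_cong[OF chart_image_open[OF M c] x, of "ext_d M \<alpha> c" "local_d (mdim M) (\<alpha> c)"]
        by (simp add: ext_d_def)
      also have "\<dots> = (\<lambda>K. 0)"
        by (rule local_d_local_d[OF chart_image_open[OF M c] x Omega_smooth[OF \<alpha> c] Omega_form_on[OF \<alpha>]])
      finally show ?thesis by simp
    next
      case False
      then show ?thesis by (subst ext_d_def) auto
    qed
  qed
  show "ext_d M (wedge \<alpha> \<beta>)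
      = (\<lambda>c x I. wedge (ext_d M \<alpha>) \<beta> c x I + (-1) powi k * wedge \<alpha> (ext_d M \<beta>) c x I)"
    if \<alpha>: "\<alpha> \<in> Omega M k" and \<beta>: "\<beta> \<in> Omega M l" for \<alpha> \<beta> k l
  proof (intro ext)
    fix c x I
    show "ext_d M (wedge \<alpha> \<beta>) c x I
        = wedge (ext_d M \<alpha>) \<beta> c x I + (-1) powi k * wedge \<alpha> (ext_d M \<beta>) c x I"
    proof (cases "c \<in> matlas M \<and> x \<in> chart_image c")
      case True
      then have c: "c \<in> matlas M" and x: "x \<in> chart_image c" by auto
      show ?thesis
        using c x local_d_mul[OF chart_image_open[OF M c] x Omega_smooth[OF \<alpha> c] Omega_form_on[OF \<alpha>]
            Omega_smooth[OF \<beta> c] Omega_form_on[OF \<beta>] Omega_nonzero(4)[OF \<alpha>]]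
        by (simp add: ext_d_def wedge_def[abs_def])
    next
      case False
      then have "ext_d M \<gamma> c x = (\<lambda>_. 0)" for \<gamma> by (auto simp: ext_d_def)
      then show ?thesis using Omega_outside[OF \<alpha> False] by (simp add: wedge_def)
    qed
  qed
qed

section \<open>Pullback of differential forms\<close>

text \<open>Two charts around \<open>f p\<close> differ by a transition map \<open>t\<close>, and the local forms of \<open>\<beta>\<close> by pullback along
  \<open>t\<close>; so the two expressions agree by functoriality of the local pullback.\<close>

lemma local_rep_compatible:
  assumes M: "is_smooth_manifold M" and N: "is_smooth_manifold N" and f: "smooth_map M N f"
    and \<beta>: "\<beta> \<in> Omega N k" and c: "c \<in> matlas M" and c': "c' \<in> matlas N" "c'' \<in> matlas N"
    and x: "x \<in> chart_image c" "f (chart_inv c x) \<in> fst c'" "f (chart_inv c x) \<in> fst c''"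
  shows "local_pullback (mdim M) (mdim N) (chart_rep c f c') (\<beta> c') x
    = local_pullback (mdim M) (mdim N) (chart_rep c f c'') (\<beta> c'') x"
proof -
  let ?m = "mdim M" and ?n = "mdim N" and ?g = "chart_rep c f c'"
    and ?t = "\<lambda>z. snd c'' (chart_inv c' z)"
  define B where "B = fst c' \<inter> fst c''"
  have opn: "openin (mtop N) (fst c')" "openin (mtop N) (fst c'')"
    using is_chartD(2)[OF atlas_chart[OF N]] c' by auto
  have B: "openin (mtop N) B" "B \<subseteq> fst c'" using opn by (auto simp: B_def)
  note rep = smooth_map_in_charts[OF M N f c c'(1) B]
  note tr = smooth_map_in_charts[OF N N smooth_map_id[OF N] c' opn(2) subset_refl]
  let ?V = "chart_preimage c f B" and ?W = "snd c' ` {p \<in> fst c'. p \<in> fst c''}"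
  have xV: "x \<in> ?V" using x chart_inv_in[OF x(1)] by (force simp: B_def)
  have W: "?g y \<in> ?W" if "y \<in> ?V" for y using rep(3)[OF that] by (auto simp: B_def)
  have "local_pullback ?m ?n ?g (\<beta> c') x
      = local_pullback ?m ?n ?g (local_pullback ?n ?n ?t (\<beta> c'')) x"
    using rep(1) xV refl Omega_compatible[OF \<beta> c' W[OF xV]] by (rule local_pullback_cong)
  also have "\<dots> = local_pullback ?m ?n (\<lambda>y. ?t (?g y)) (\<beta> c'') x"
    using rep(1) xV tr(1) rep(2) W tr(2) by (rule local_pullback_compose)
  also have "\<dots> = local_pullback ?m ?n (chart_rep c f c'') (\<beta> c'') x"
    using rep(1) xV
    by (rule local_pullback_cong) (auto simp: B_def chart_inv_chart[OF M c] chart_inv_chart[OF N c'(1)])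
  finally show ?thesis .
qed

lemma smooth_map_topspace: "\<lbrakk>smooth_map M N f; p \<in> topspace (mtop M)\<rbrakk> \<Longrightarrow> f p \<in> topspace (mtop N)"
  by (auto simp: smooth_map_def continuous_map_def)

lemma target_chart:
  assumes M: "is_smooth_manifold M" and N: "is_smooth_manifold N" and f: "smooth_map M N f"
    and c: "c \<in> matlas M" and x: "x \<in> chart_image c"
  obtains c' where "c' \<in> matlas N" "f (chart_inv c x) \<in> fst c'"
  using chart_at[OF N smooth_map_topspace[OF f chart_subset_topspace[OF M c]]] chart_inv_in[OF x] by blast

text \<open>The chart chosen in the definition depends on \<open>f\<close> and on the point but not on the form. Hence identities
  that involve no derivatives of forms hold for the pullback as soon as they hold locally.\<close>

lemma pullback_unfold:
  assumes M: "is_smooth_manifold M" and N: "is_smooth_manifold N" and f: "smooth_map M N f"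
    and c: "c \<in> matlas M" and x: "x \<in> chart_image c"
  obtains c' where "c' \<in> matlas N" "f (chart_inv c x) \<in> fst c'"
    "\<forall>\<beta>. pullback M N f \<beta> c x
      = local_pullback (mdim M) (mdim N) (chart_rep c f c') (\<beta> c') x"
proof -
  let ?P = "\<lambda>c'. c' \<in> matlas N \<and> f (chart_inv c x) \<in> fst c'"
  have "\<exists>c'. ?P c'" by (rule target_chart[OF assms]) auto
  then have "?P (SOME c'. ?P c')" by (rule someI_ex)
  with that[of "SOME c'. ?P c'"] show thesis using c x by (simp add: pullback_def Let_def)
qed

lemma pullback_outside: "\<not> (c \<in> matlas M \<and> x \<in> chart_image c) \<Longrightarrow> pullback M N f \<beta> c x = (\<lambda>_. 0)"
  by (auto simp: pullback_def)

lemma pullback_in_chart: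
  assumes M: "is_smooth_manifold M" and N: "is_smooth_manifold N" and f: "smooth_map M N f"
    and \<beta>: "\<beta> \<in> Omega N k" and c: "c \<in> matlas M" and c': "c' \<in> matlas N"
    and x: "x \<in> chart_preimage c f (fst c')"
  shows "pullback M N f \<beta> c x
    = local_pullback (mdim M) (mdim N) (chart_rep c f c') (\<beta> c') x"
proof -
  have x': "x \<in> chart_image c" "f (chart_inv c x) \<in> fst c'"
    using x chart_inv_chart[OF M c] by (auto simp: chart_image_def)
  obtain c'' where c'': "c'' \<in> matlas N" "f (chart_inv c x) \<in> fst c''"
    "\<forall>\<beta>. pullback M N f \<beta> c x
      = local_pullback (mdim M) (mdim N) (chart_rep c f c'') (\<beta> c'') x"
    by (rule pullback_unfold[OF M N f c x'(1)])
  show ?thesis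
    unfolding spec[OF c''(3)] by (rule local_rep_compatible[OF M N f \<beta> c c''(1) c' x'(1) c''(2) x'(2)])
qed

text \<open>Support and degree are read off from the local pullback. Smoothness holds near each point, where a
  single chart of the target can be used. Compatibility is functoriality of the local pullback for the
  composite of \<open>f\<close> in charts with a transition map of \<open>M\<close>.\<close>

lemma pullback_Omega:
  assumes M: "is_smooth_manifold M" and N: "is_smooth_manifold N" and f: "smooth_map M N f"
    and \<beta>: "\<beta> \<in> Omega N k"
  shows "pullback M N f \<beta> \<in> Omega M k"
  unfolding Omega_iff
proof (intro conjI allI ballI impI)
  fix c x K assume nz: "pullback M N f \<beta> c x K \<noteq> 0"
  have "c \<in> matlas M \<and> x \<in> chart_image c"
  proof (rule ccontr)
    assume "\<not> (c \<in> matlas M \<and> x \<in> chart_image c)"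
    from pullback_outside[OF this, of N f \<beta>] nz show False by simp
  qed
  then show c: "c \<in> matlas M" and x: "x \<in> chart_image c" by auto
  obtain c' where "\<forall>\<beta>. pullback M N f \<beta> c x
      = local_pullback (mdim M) (mdim N) (chart_rep c f c') (\<beta> c') x"
    by (rule pullback_unfold[OF M N f c x])
  with nz have nz': "local_pullback (mdim M) (mdim N) (chart_rep c f c') (\<beta> c') x K \<noteq> 0"
    by simp
  obtain I where I: "\<beta> c' (snd c' (f (chart_inv c x))) I \<noteq> 0" "K \<subseteq> {..<mdim M}" "card K = card I"
    by (rule local_pullback_nonzero[OF nz'])
  show "K \<subseteq> {..<mdim M}" by fact
  show "int (card K) = k" using Omega_nonzero(4)[OF \<beta> I(1)] I(3) by simp
next
  fix c assume c: "c \<in> matlas M"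
  show "smooth_form (mdim M) (chart_image c) (pullback M N f \<beta> c)"
    unfolding smooth_form_def
  proof
    fix I
    show "smooth_fun (mdim M) (chart_image c) (\<lambda>x. pullback M N f \<beta> c x I)"
    proof (rule smooth_fun_local[OF chart_image_open[OF M c]])
      fix x assume x: "x \<in> chart_image c"
      obtain c' where c': "c' \<in> matlas N" "f (chart_inv c x) \<in> fst c'"
        by (rule target_chart[OF M N f c x])
      note rep = smooth_map_in_charts[OF M N f c c'(1) chart_domain_open[OF N c'(1)] subset_refl]
      let ?U = "chart_preimage c f (fst c')"
      have "smooth_form (mdim M) ?U
          (local_pullback (mdim M) (mdim N) (chart_rep c f c') (\<beta> c'))"
        by (rule smooth_form_local_pullback[OF rep(1) chart_image_open[OF N c'(1)] rep(2) _
              Omega_smooth[OF \<beta> c'(1)]])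
          (use rep(3) in \<open>auto simp: chart_image_def\<close>)
      then have "smooth_form (mdim M) ?U (pullback M N f \<beta> c)"
        by (rule smooth_form_cong[OF rep(1)]) (simp add: pullback_in_chart[OF M N f \<beta> c c'(1)])
      then have "smooth_fun (mdim M) ?U (\<lambda>x. pullback M N f \<beta> c x I)" by (rule smooth_formD)
      moreover have "x \<in> ?U"
        using c'(2) chart_inv_in[OF x] by (intro image_eqI[of _ _ "chart_inv c x"]) simp_all
      ultimately show "\<exists>U. open_Rn (mdim M) U \<and> x \<in> U \<and>
          smooth_fun (mdim M) U (\<lambda>x. pullback M N f \<beta> c x I)"
        using rep(1) by (intro exI[of _ ?U] conjI)
    qed
  qed
next
  fix c d x assume c: "c \<in> matlas M" "d \<in> matlas M" and x: "x \<in> snd c ` {p \<in> fst c. p \<in> fst d}"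
  let ?m = "mdim M" and ?n = "mdim N" and ?t = "\<lambda>y. snd d (chart_inv c y)"
  obtain p where p: "p \<in> fst c" "p \<in> fst d" "x = snd c p" using x by auto
  then have inv: "chart_inv c x = p" using chart_inv_chart[OF M c(1)] by simp
  have "x \<in> chart_image c" using p by (auto simp: chart_image_def)
  then obtain c' where c': "c' \<in> matlas N" "f p \<in> fst c'"
    unfolding inv[symmetric] by (rule target_chart[OF M N f c(1)])
  let ?g = "chart_rep d f c'"
  define B where "B = {q \<in> fst d. f q \<in> fst c'}"
  have opn': "openin (mtop N) (fst c')" using chart_domain_open[OF N c'(1)] .
  have B: "openin (mtop M) B" "B \<subseteq> fst d"
    using openin_chart_preimage[OF M smooth_map_continuous[OF f] c(2) opn'] by (auto simp: B_def)
  note tr = smooth_map_in_charts[OF M M smooth_map_id[OF M] c B]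
  note rep = smooth_map_in_charts[OF M N f c(2) c'(1) opn' subset_refl]
  let ?V = "snd c ` {p \<in> fst c. p \<in> B}" and ?W = "chart_preimage d f (fst c')"
  have xV: "x \<in> ?V" using p c' by (auto simp: B_def)
  have W: "?t y \<in> ?W" if "y \<in> ?V" for y using tr(3)[OF that] by (simp add: B_def)
  have "pullback M N f \<beta> c x = local_pullback ?m ?n (chart_rep c f c') (\<beta> c') x"
    by (rule pullback_in_chart[OF M N f \<beta> c(1) c'(1)]) (use p c' in auto)
  also have "\<dots> = local_pullback ?m ?n (\<lambda>y. ?g (?t y)) (\<beta> c') x"
    using tr(1) xV
    by (rule local_pullback_cong) (auto simp: B_def chart_inv_chart[OF M c(1)] chart_inv_chart[OF M c(2)])
  also have "\<dots> = local_pullback ?m ?m ?t (local_pullback ?m ?n ?g (\<beta> c')) x"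
    using local_pullback_compose[OF tr(1) xV rep(1) tr(2) W rep(2)] by simp
  also have "\<dots> = local_pullback ?m ?m ?t (pullback M N f \<beta> d) x"
    using tr(1) xV refl pullback_in_chart[OF M N f \<beta> c(2) c'(1) W[OF xV], symmetric]
    by (rule local_pullback_cong)
  finally show "pullback M N f \<beta> c x = local_pullback ?m ?m ?t (pullback M N f \<beta> d) x" .
qed

text \<open>The chart around \<open>f p\<close> is kept fixed in a neighbourhood of \<open>p\<close>, so that the derivative can be taken.\<close>

lemma pullback_ext_d:
  assumes M: "is_smooth_manifold M" and N: "is_smooth_manifold N" and f: "smooth_map M N f"
    and \<beta>: "\<beta> \<in> Omega N k"
  shows "pullback M N f (ext_d N \<beta>) = ext_d M (pullback M N f \<beta>)"
proof (rule ext, rule ext)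
  fix c x
  show "pullback M N f (ext_d N \<beta>) c x = ext_d M (pullback M N f \<beta>) c x"
  proof (cases "c \<in> matlas M \<and> x \<in> chart_image c")
    case True
    then have c: "c \<in> matlas M" and x: "x \<in> chart_image c" by auto
    let ?m = "mdim M" and ?n = "mdim N"
    obtain c' where c': "c' \<in> matlas N" "f (chart_inv c x) \<in> fst c'"
      by (rule target_chart[OF M N f c x])
    let ?g = "chart_rep c f c'" and ?V = "chart_preimage c f (fst c')"
    note rep = smooth_map_in_charts[OF M N f c c'(1) chart_domain_open[OF N c'(1)] subset_refl]
    have xV: "x \<in> ?V" using c'(2) chart_inv_in[OF x] by force
    have W: "?g y \<in> chart_image c'" if "y \<in> ?V" for y using rep(3)[OF that] by (simp add: chart_image_def)
    have "pullback M N f (ext_d N \<beta>) c x = local_pullback ?m ?n ?g (ext_d N \<beta> c') x"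
      by (rule pullback_in_chart[OF M N f Omega_ext_d[OF N \<beta>] c c'(1) xV])
    also have "\<dots> = local_pullback ?m ?n ?g (local_d ?n (\<beta> c')) x"
      using rep(1) xV refl
      by (rule local_pullback_cong) (use W[OF xV] c'(1) in \<open>simp add: ext_d_def\<close>)
    also have "\<dots> = local_d ?m (local_pullback ?m ?n ?g (\<beta> c')) x"
      by (rule local_d_local_pullback[symmetric, OF rep(1) xV chart_image_open[OF N c'(1)] rep(2) W
            Omega_smooth[OF \<beta> c'(1)] Omega_form_on[OF \<beta>]])
    also have "\<dots> = local_d ?m (pullback M N f \<beta> c) x"
      using rep(1) xV pullback_in_chart[OF M N f \<beta> c c'(1), symmetric] by (rule local_d_cong)
    also have "\<dots> = ext_d M (pullback M N f \<beta>) c x" using c x by (simp add: ext_d_def)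
    finally show ?thesis .
  next
    case False
    then show ?thesis by (auto simp: pullback_outside ext_d_def)
  qed
qed

lemma smooth_map_cong:
  assumes M: "is_smooth_manifold M" and N: "is_smooth_manifold N" and f: "smooth_map M N f"
    and eq: "\<And>p. p \<in> topspace (mtop M) \<Longrightarrow> f p = g p"
  shows "smooth_map M N g"
  unfolding smooth_map_def
proof (intro conjI ballI)
  show "continuous_map (mtop M) (mtop N) g"
    using f eq by (auto simp: smooth_map_def elim: continuous_map_eq)
  fix c c' assume c: "c \<in> matlas M" and c': "c' \<in> matlas N"
  have eq': "f p = g p" if "p \<in> fst c" for p using eq chart_subset_topspace[OF M c that] by simp
  note rep = smooth_map_in_charts[OF M N f c c' chart_domain_open[OF N c'] subset_refl]
  have dom: "{p \<in> fst c. g p \<in> fst c'} = {p \<in> fst c. f p \<in> fst c'}" using eq' by auto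
  show "smooth_vfun (mdim M) (mdim N) (chart_preimage c g (fst c')) (chart_rep c g c')"
    unfolding smooth_vfun_def dom
  proof (intro allI impI)
    fix i assume "i < mdim N"
    then have "smooth_fun (mdim M) (chart_preimage c f (fst c')) (\<lambda>x. snd c' (f (chart_inv c x)) i)"
      using rep(2) by (simp add: smooth_vfun_def)
    then show "smooth_fun (mdim M) (chart_preimage c f (fst c')) (\<lambda>x. snd c' (g (chart_inv c x)) i)"
      by (rule smooth_fun_cong[OF rep(1)]) (auto simp: chart_inv_chart[OF M c] eq')
  qed
qed

text \<open>In charts this is the compatibility of \<open>\<beta>\<close> with the transition map from a chart to itself.\<close>

lemma pullback_id:
  assumes M: "is_smooth_manifold M" and \<beta>: "\<beta> \<in> Omega M k"
  shows "pullback M M (\<lambda>p\<in>topspace (mtop M). p) \<beta> = \<beta>"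
proof (rule ext, rule ext)
  fix c x
  let ?n = "mdim M"
  define f where "f = (\<lambda>p\<in>topspace (mtop M). p)"
  have f: "smooth_map M M f"
    by (rule smooth_map_cong[OF M M smooth_map_id[OF M]]) (simp add: f_def)
  have "pullback M M f \<beta> c x = \<beta> c x"
  proof (cases "c \<in> matlas M \<and> x \<in> chart_image c")
    case True
    then have c: "c \<in> matlas M" and x: "x \<in> chart_image c" by auto
    have top: "f p = p" if "p \<in> fst c" for p
      using chart_subset_topspace[OF M c that] by (simp add: f_def)
    have dom: "{p \<in> fst c. f p \<in> fst c} = fst c" "{p \<in> fst c. p \<in> fst c} = fst c"
      using top by auto
    have xV: "x \<in> snd c ` fst c" using x by (simp add: chart_image_def)
    have "pullback M M f \<beta> c x = local_pullback ?n ?n (chart_rep c f c) (\<beta> c) x"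
      using pullback_in_chart[OF M M f \<beta> c c] xV by (simp only: dom)
    also have "\<dots> = local_pullback ?n ?n (\<lambda>y. snd c (chart_inv c y)) (\<beta> c) x"
      using chart_image_open[OF M c] x
      by (rule local_pullback_cong) (simp_all add: top chart_inv_in x)
    also have "\<dots> = \<beta> c x" using Omega_compatible[OF \<beta> c c] xV by (simp only: dom)
    finally show ?thesis .
  qed (simp add: pullback_outside Omega_outside[OF \<beta>])
  then show "pullback M M (\<lambda>p\<in>topspace (mtop M). p) \<beta> c x = \<beta> c x" by (simp only: f_def)
qed

text \<open>Charts \<open>c'\<close> around \<open>f p\<close> and \<open>c''\<close> around \<open>g (f p)\<close> reduce this to the functoriality of the local
  pullback on the set of points that \<open>f\<close> maps into \<open>c'\<close> and \<open>g \<circ> f\<close> into \<open>c''\<close>.\<close>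

lemma pullback_compose:
  assumes X: "is_smooth_manifold X" and Y: "is_smooth_manifold Y" and Z: "is_smooth_manifold Z"
    and f: "smooth_map X Y f" and g: "smooth_map Y Z g" and \<gamma>: "\<gamma> \<in> Omega Z k"
  shows "pullback X Z (compose (topspace (mtop X)) g f) \<gamma> = pullback X Y f (pullback Y Z g \<gamma>)"
proof (rule ext, rule ext)
  fix c x
  let ?h = "compose (topspace (mtop X)) g f"
  show "pullback X Z ?h \<gamma> c x = pullback X Y f (pullback Y Z g \<gamma>) c x"
  proof (cases "c \<in> matlas X \<and> x \<in> chart_image c")
    case True
    then have c: "c \<in> matlas X" and x: "x \<in> chart_image c" by auto
    define p where "p = chart_inv c x"
    have p: "p \<in> fst c" "snd c p = x" using chart_inv_in[OF x] by (auto simp: p_def)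
    have h: "?h q = g (f q)" if "q \<in> fst c" for q
      using chart_subset_topspace[OF X c that] by (simp add: compose_def)
    obtain c' where c': "c' \<in> matlas Y" "f p \<in> fst c'"
      by (rule target_chart[OF X Y f c x, folded p_def])
    obtain c'' where c'': "c'' \<in> matlas Z" "g (f p) \<in> fst c''"
      by (rule chart_at[OF Z smooth_map_topspace[OF g chart_subset_topspace[OF Y c']]])
    define B where "B = {q \<in> fst c'. g q \<in> fst c''}"
    have opn'': "openin (mtop Z) (fst c'')" using chart_domain_open[OF Z c''(1)] .
    have B: "openin (mtop Y) B" "B \<subseteq> fst c'"
      using openin_chart_preimage[OF Y smooth_map_continuous[OF g] c'(1) opn''] by (auto simp: B_def)
    note rep_f = smooth_map_in_charts[OF X Y f c c'(1) B]
    note rep_g = smooth_map_in_charts[OF Y Z g c'(1) c''(1) opn'' subset_refl]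
    let ?l = "mdim X" and ?m = "mdim Y" and ?n = "mdim Z"
    let ?V = "chart_preimage c f B" and ?W = "snd c' ` {q \<in> fst c'. g q \<in> fst c''}"
    let ?F = "chart_rep c f c'" and ?G = "chart_rep c' g c''"
    have xV: "x \<in> ?V" using p c'(2) c''(2) by (force simp: B_def)
    have W: "?F y \<in> ?W" if "y \<in> ?V" for y using rep_f(3)[OF that] by (simp add: B_def)
    have "pullback X Z ?h \<gamma> c x = local_pullback ?l ?n (chart_rep c ?h c'') (\<gamma> c'') x"
      by (rule pullback_in_chart[OF X Z smooth_map_compose[OF X Y Z f g] \<gamma> c c''(1)])
        (use p c''(2) h in force)
    also have "\<dots> = local_pullback ?l ?n (\<lambda>y. ?G (?F y)) (\<gamma> c'') x"
      using rep_f(1) xV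
      by (rule local_pullback_cong)
        (auto simp: B_def chart_inv_chart[OF X c] chart_inv_chart[OF Y c'(1)] h p_def[symmetric] p(1))
    also have "\<dots> = local_pullback ?l ?m ?F (local_pullback ?m ?n ?G (\<gamma> c'')) x"
      using local_pullback_compose[OF rep_f(1) xV rep_g(1) rep_f(2) W rep_g(2)] by simp
    also have "\<dots> = local_pullback ?l ?m ?F (pullback Y Z g \<gamma> c') x"
      using rep_f(1) xV refl pullback_in_chart[OF Y Z g \<gamma> c'(1) c''(1) W[OF xV], symmetric]
      by (rule local_pullback_cong)
    also have "\<dots> = pullback X Y f (pullback Y Z g \<gamma>) c x"
      by (rule pullback_in_chart[symmetric, OF X Y f pullback_Omega[OF Y Z g \<gamma>] c c'(1)])
        (use p c'(2) in auto)
    finally show ?thesis .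
  qed (simp add: pullback_outside)
qed

lemma pullback_hom:
  assumes M: "is_smooth_manifold M" and N: "is_smooth_manifold N" and f: "smooth_map M N f"
  shows "(\<lambda>k. \<lambda>\<beta>\<in>Omega N k. pullback M N f \<beta>) \<in> cdga_hom (deRham N) (deRham M)"
proof -
  have ptwise: "pullback M N f (\<lambda>c x I. \<alpha> c x I + \<beta> c x I) c x
      = (\<lambda>I. pullback M N f \<alpha> c x I + pullback M N f \<beta> c x I) \<and>
    pullback M N f (\<lambda>c x I. r * \<alpha> c x I) c x = (\<lambda>I. r * pullback M N f \<alpha> c x I) \<and>
    pullback M N f (wedge \<alpha> \<beta>) c x = wedge (pullback M N f \<alpha>) (pullback M N f \<beta>) c x \<and>
    pullback M N f (form_one N) c x = form_one M c x" for \<alpha> \<beta> r c x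
  proof (cases "c \<in> matlas M \<and> x \<in> chart_image c")
    case True
    then have c: "c \<in> matlas M" and x: "x \<in> chart_image c" by auto
    obtain c' where c': "c' \<in> matlas N" "f (chart_inv c x) \<in> fst c'"
      and eq: "\<forall>\<beta>. pullback M N f \<beta> c x
        = local_pullback (mdim M) (mdim N) (chart_rep c f c') (\<beta> c') x"
      by (rule pullback_unfold[OF M N f c x])
    have "snd c' (f (chart_inv c x)) \<in> chart_image c'" using c'(2) by (auto simp: chart_image_def)
    then have "form_one N c' (snd c' (f (chart_inv c x))) = ext_one" using c'(1) by (simp add: form_one_def)
    then show ?thesis
      using c x
      by (simp add: spec[OF eq] local_pullback_add local_pullback_scale local_pullback_mul wedge_def)
        (simp add: local_pullback_eq ext_subst_one form_one_def)
  next
    case False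
    then show ?thesis by (auto simp: pullback_outside wedge_def form_one_def)
  qed
  have eqs: "pullback M N f (\<lambda>c x I. \<alpha> c x I + \<beta> c x I) = (\<lambda>c x I. pullback M N f \<alpha> c x I + pullback M N f \<beta> c x I)"
    "pullback M N f (\<lambda>c x I. r * \<alpha> c x I) = (\<lambda>c x I. r * pullback M N f \<alpha> c x I)"
    "pullback M N f (wedge \<alpha> \<beta>) = wedge (pullback M N f \<alpha>) (pullback M N f \<beta>)"
    "pullback M N f (form_one N) = form_one M" for \<alpha> \<beta> r
    by (rule ext, rule ext, rule ptwise[THEN conjunct1],
        rule ext, rule ext, rule ptwise[THEN conjunct2, THEN conjunct1],
        rule ext, rule ext, rule ptwise[THEN conjunct2, THEN conjunct2, THEN conjunct1],
        rule ext, rule ext, rule ptwise[THEN conjunct2, THEN conjunct2, THEN conjunct2])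
  show ?thesis
    unfolding cdga_hom_def
    by (simp add: eqs pullback_Omega[OF M N f] pullback_ext_d[OF M N f] Omega_add[OF N] Omega_scale[OF N]
        Omega_wedge[OF N] Omega_one[OF N] Omega_ext_d[OF N])
qed

section \<open>Symplectic manifolds and the tower of cones\<close>

lemma symplecticD:
  assumes "is_symplectic X"
  shows "is_smooth_manifold X" "sform X \<in> Omega X 2" "ext_d X (sform X) = (\<lambda>c x I. 0)"
  using assms by (auto simp: is_symplectic_def)

lemma symp_cat_simps [simp]:
  "Obj symp_cat = {X. is_symplectic X}"
  "Hom symp_cat X Y = {f \<in> extensional (topspace (mtop X)).
     smooth_map X Y f \<and> pullback X Y f (sform Y) = sform X}"
  "Idn symp_cat X = (\<lambda>p\<in>topspace (mtop X). p)"
  "Comp symp_cat X Y Z g f = compose (topspace (mtop X)) g f"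
  by (simp_all add: symp_cat_def)

lemma is_category_symp_cat: "is_category symp_cat"
proof
  fix X :: "'a symplectic_manifold" assume "X \<in> Obj symp_cat"
  then have X: "is_smooth_manifold X" "sform X \<in> Omega X 2" by (auto dest: symplecticD)
  have "smooth_map X X (\<lambda>p\<in>topspace (mtop X). p)"
    by (rule smooth_map_cong[OF X(1) X(1) smooth_map_id[OF X(1)]]) simp
  then show "Idn symp_cat X \<in> Hom symp_cat X X" using pullback_id[OF X] by simp
next
  fix X Y Z :: "'a symplectic_manifold" and f g
  assume "X \<in> Obj symp_cat" "Y \<in> Obj symp_cat" "Z \<in> Obj symp_cat"
    and f: "f \<in> Hom symp_cat X Y" and g: "g \<in> Hom symp_cat Y Z"
  then have X: "is_smooth_manifold X" and Y: "is_smooth_manifold Y" and Z: "is_smooth_manifold Z"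
    and \<omega>: "sform Z \<in> Omega Z 2" by (auto dest: symplecticD)
  show "Comp symp_cat X Y Z g f \<in> Hom symp_cat X Z"
    using f g smooth_map_compose[OF X Y Z] pullback_compose[OF X Y Z _ _ \<omega>] by simp
next
  fix X Y :: "'a symplectic_manifold" and f
  assume f: "f \<in> Hom symp_cat X Y"
  then have top: "f p \<in> topspace (mtop Y)" if "p \<in> topspace (mtop X)" for p
    using that smooth_map_topspace[of X Y f] by simp
  have ext: "f \<in> extensional (topspace (mtop X))" using f by simp
  show "Comp symp_cat X X Y f (Idn symp_cat X) = f" "Comp symp_cat X Y Y (Idn symp_cat Y) f = f"
    using top by (auto intro!: extensionalityI[OF _ ext] simp: compose_def)
next
  fix W X Y Z :: "'a symplectic_manifold" and f g h
  assume f: "f \<in> Hom symp_cat W X"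
  then have "f p \<in> topspace (mtop X)" if "p \<in> topspace (mtop W)" for p
    using that smooth_map_topspace[of W X f] by simp
  then show "Comp symp_cat W Y Z h (Comp symp_cat W X Y g f) = Comp symp_cat W X Z (Comp symp_cat X Y Z h g) f"
    by (auto simp: compose_def fun_eq_iff)
qed

context
  fixes X :: "'a symplectic_manifold"
  assumes X: "is_symplectic X"
begin

interpretation dR: is_cdga "deRham X"
  using symplecticD(1)[OF X] by (rule is_cdga_deRham)

lemma wedge_power_closed:
  "wedge_power X (sform X) p \<in> Omega X (2 * int p)" "ext_d X (wedge_power X (sform X) p) = (\<lambda>c x I. 0)"
proof (induction p)
  case 0
  show "wedge_power X (sform X) 0 \<in> Omega X (2 * int 0)" using dR.one_closed by simp
  show "ext_d X (wedge_power X (sform X) 0) = (\<lambda>c x I. 0)" using dR.diff_one by simp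
next
  case (Suc p)
  note \<omega> = symplecticD(2,3)[OF X]
  show "wedge_power X (sform X) (Suc p) \<in> Omega X (2 * int (Suc p))"
    using dR.mul_closed_deg[of "sform X" 2 "wedge_power X (sform X) p" "2 * int p" "2 * int (Suc p)"]
      \<omega>(1) Suc.IH(1) by simp
  show "ext_d X (wedge_power X (sform X) (Suc p)) = (\<lambda>c x I. 0)"
    using dR.diff_mul[of "sform X" 2 "wedge_power X (sform X) p" "2 * int p"] \<omega> Suc.IH
    by (simp add: wedge_def)
qed

lemma is_cdga_symp_cone: "is_cdga (symp_cone X p)"
  unfolding symp_cone_def
  using wedge_power_closed[of "p + 1"] by (intro dR.is_cdga_adjoin) simp_all

lemma gcarrier_symp_cone:
  "gcarrier (symp_cone X p) k = Omega X k \<times> Omega X (k - (2 * int p + 1))"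
  by (simp add: symp_cone_def)

text \<open>The powers of \<open>\<omega>\<close> are formed by multiplication from the left, so the cone one level up is literally
  the cone of \<open>w z\<close> with \<open>w = \<omega>\<close>.\<close>

lemma cone_q_hom: "cone_q X r \<in> cdga_hom (symp_cone X (Suc r)) (symp_cone X r)"
proof -
  let ?z = "wedge_power X (sform X) (r + 1)" and ?m = "2 * int r + 1"
  have src: "symp_cone X (Suc r) = adjoin (deRham X) (?m + 2) (gmul (deRham X) 2 (?m + 1) (sform X) ?z)"
    by (simp add: symp_cone_def)
  have "cone_q X r = (\<lambda>k. \<lambda>(a, b)\<in>gcarrier (symp_cone X (Suc r)) k.
      (a, gmul (deRham X) (k - (?m + 2)) 2 b (sform X)))"
    by (simp add: cone_q_def)
  also have "\<dots> \<in> cdga_hom (symp_cone X (Suc r)) (symp_cone X r)"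
    unfolding src unfolding symp_cone_def
    using wedge_power_closed[of "r + 1"] symplecticD(2,3)[OF X] by (intro dR.adjoin_mul_hom) simp_all
  finally show ?thesis .
qed

lemma cone_q_iter_hom: "cone_q_iter X b j \<in> cdga_hom (symp_cone X (b + j)) (symp_cone X b)"
proof (induction j)
  case 0
  show ?case
    using cdga_hom_id[OF is_cdga_symp_cone, of b] by (simp only: cone_q_iter.simps cdga_cat_simps add_0_right)
next
  case (Suc j)
  then show ?case
    using cdga_hom_compose[OF is_cdga_symp_cone cone_q_hom Suc.IH] by simp
qed

lemma cone_q_iter_add:
  "cone_q_iter X b (i + j) = Comp cdga_cat (symp_cone X (b + i + j)) (symp_cone X (b + i)) (symp_cone X b)
     (cone_q_iter X b i) (cone_q_iter X (b + i) j)"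
proof (induction j)
  case 0
  show ?case
    using is_category.Comp_Idn_right[OF is_category_cdga_cat, of "symp_cone X (b + i)" "symp_cone X b"
        "cone_q_iter X b i"] is_cdga_symp_cone cone_q_iter_hom[of b i]
    by (simp only: cone_q_iter.simps cdga_cat_simps mem_Collect_eq add_0_right)
next
  case (Suc j)
  have "cone_q_iter X b (i + Suc j) = Comp cdga_cat (symp_cone X (Suc (b + i + j))) (symp_cone X (b + i + j))
      (symp_cone X b) (Comp cdga_cat (symp_cone X (b + i + j)) (symp_cone X (b + i)) (symp_cone X b)
        (cone_q_iter X b i) (cone_q_iter X (b + i) j)) (cone_q X (b + i + j))"
    using Suc.IH by (simp only: cone_q_iter.simps add_Suc_right add.assoc)
  also have "\<dots> = Comp cdga_cat (symp_cone X (Suc (b + i + j))) (symp_cone X (b + i)) (symp_cone X b)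
      (cone_q_iter X b i) (Comp cdga_cat (symp_cone X (Suc (b + i + j))) (symp_cone X (b + i + j))
        (symp_cone X (b + i)) (cone_q_iter X (b + i) j) (cone_q X (b + i + j)))"
    by (rule is_category.Comp_assoc[OF is_category_cdga_cat, symmetric])
      (simp_all only: cdga_cat_simps mem_Collect_eq is_cdga_symp_cone cone_q_hom cone_q_iter_hom)
  finally show ?case by (simp only: cone_q_iter.simps add_Suc_right)
qed

lemma cone_tower_functor:
  "is_functor (op_cat poset_cat) cdga_cat (cone_tower X)" "functor_ext (op_cat poset_cat) (cone_tower X)"
proof -
  show "is_functor (op_cat poset_cat) cdga_cat (cone_tower X)"
  proof (intro is_functor.intro is_functor_axioms.intro is_category_op_cat is_category_poset_cat
      is_category_cdga_cat)
    fix a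
    show "Fobj (cone_tower X) a \<in> Obj cdga_cat" by (simp add: cone_tower_def is_cdga_symp_cone)
    show "Fmor (cone_tower X) a a (Idn (op_cat poset_cat) a) = Idn cdga_cat (Fobj (cone_tower X) a)"
      by (simp add: cone_tower_def poset_cat_def)
  next
    fix a b :: nat and u :: unit assume "u \<in> Hom (op_cat poset_cat) a b"
    then have u: "b \<le> a" by (simp add: poset_cat_def split: if_splits)
    then show "Fmor (cone_tower X) a b u \<in> Hom cdga_cat (Fobj (cone_tower X) a) (Fobj (cone_tower X) b)"
      using cone_q_iter_hom[of b "a - b"] by (simp add: cone_tower_def poset_cat_def)
  next
    fix a b c :: nat and u v :: unit
    assume "u \<in> Hom (op_cat poset_cat) a b" "v \<in> Hom (op_cat poset_cat) b c"
    then have ab: "b \<le> a" "c \<le> b" by (simp_all add: poset_cat_def split: if_splits)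
    then have "c + (b - c) = b" "b + (a - b) = a" "(b - c) + (a - b) = a - c" by auto
    then have "cone_q_iter X c (a - c) = Comp cdga_cat (symp_cone X a) (symp_cone X b) (symp_cone X c)
        (cone_q_iter X c (b - c)) (cone_q_iter X b (a - b))"
      using cone_q_iter_add[of c "b - c" "a - b"] by simp
    then show "Fmor (cone_tower X) a c (Comp (op_cat poset_cat) a b c v u)
        = Comp cdga_cat (Fobj (cone_tower X) a) (Fobj (cone_tower X) b) (Fobj (cone_tower X) c)
            (Fmor (cone_tower X) b c v) (Fmor (cone_tower X) a b u)"
      using ab by (simp add: cone_tower_def poset_cat_def)
  qed
  show "functor_ext (op_cat poset_cat) (cone_tower X)"
    by (auto simp: functor_ext_def cone_tower_def poset_cat_def extensional_def)
qed

end

lemma pullback_wedge_power: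
  fixes X Y :: "'a symplectic_manifold"
  assumes X: "is_symplectic X" and Y: "is_symplectic Y" and f: "smooth_map X Y f"
    and \<omega>: "pullback X Y f (sform Y) = sform X"
  shows "pullback X Y f (wedge_power Y (sform Y) p) = wedge_power X (sform X) p"
proof (induction p)
  case 0
  show ?case
    using cdga_homD(6)[OF pullback_hom[OF symplecticD(1)[OF X] symplecticD(1)[OF Y] f]]
      Omega_one[OF symplecticD(1)[OF Y]] by simp
next
  case (Suc p)
  have mem: "sform Y \<in> Omega Y 2" "wedge_power Y (sform Y) p \<in> Omega Y (2 * int p)"
    using symplecticD(2)[OF Y] wedge_power_closed(1)[OF Y] by auto
  then have "pullback X Y f (wedge (sform Y) (wedge_power Y (sform Y) p))
      = wedge (pullback X Y f (sform Y)) (pullback X Y f (wedge_power Y (sform Y) p))"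
    using cdga_homD(5)[OF pullback_hom[OF symplecticD(1)[OF X] symplecticD(1)[OF Y] f],
        of "sform Y" 2 "wedge_power Y (sform Y) p" "2 * int p"] Omega_wedge[OF symplecticD(1)[OF Y] mem]
    by simp
  then show ?case using Suc.IH \<omega> by simp
qed

context
  fixes X Y :: "'a symplectic_manifold" and f
  assumes X: "is_symplectic X" and Y: "is_symplectic Y" and f: "smooth_map X Y f"
    and \<omega>: "pullback X Y f (sform Y) = sform X"
begin

lemma cone_pullback_hom: "cone_pullback X Y f p \<in> cdga_hom (symp_cone Y p) (symp_cone X p)"
proof -
  let ?m = "2 * int p + 1" and ?F = "\<lambda>k. \<lambda>\<beta>\<in>Omega Y k. pullback X Y f \<beta>"
  have z: "wedge_power Y (sform Y) (p + 1) \<in> Omega Y (?m + 1)"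
    using wedge_power_closed(1)[OF Y, of "p + 1"] by simp
  have "cone_pullback X Y f p = (\<lambda>k. \<lambda>(a, b)\<in>gcarrier (symp_cone Y p) k. (?F k a, ?F (k - ?m) b))"
    by (auto simp: cone_pullback_def gcarrier_symp_cone[OF Y] fun_eq_iff)
  also have "\<dots> \<in> cdga_hom (symp_cone Y p) (symp_cone X p)"
    unfolding symp_cone_def
    using z pullback_wedge_power[OF X Y f \<omega>, of "p + 1"]
    by (intro adjoin_map_hom is_cdga_deRham pullback_hom symplecticD(1) X Y f) simp_all
  finally show ?thesis .
qed

text \<open>On the component of \<open>\<theta>\<close> this is \<open>f\<^sup>*(\<beta> \<and> \<omega>\<^sub>Y) = f\<^sup>*\<beta> \<and> \<omega>\<^sub>X\<close>.\<close>

lemma cone_pullback_cone_q: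
  "Comp cdga_cat (symp_cone Y (Suc r)) (symp_cone Y r) (symp_cone X r) (cone_pullback X Y f r) (cone_q Y r)
   = Comp cdga_cat (symp_cone Y (Suc r)) (symp_cone X (Suc r)) (symp_cone X r) (cone_q X r)
       (cone_pullback X Y f (Suc r))"
proof -
  have wedge: "pullback X Y f (wedge \<beta> (sform Y)) = wedge (pullback X Y f \<beta>) (sform X)"
    if "\<beta> \<in> Omega Y k" for \<beta> k
    using cdga_homD(5)[OF pullback_hom[OF symplecticD(1)[OF X] symplecticD(1)[OF Y] f], of \<beta> k "sform Y" 2]
      that symplecticD(2)[OF Y] Omega_wedge[OF symplecticD(1)[OF Y] that symplecticD(2)[OF Y]] \<omega>
    by simp
  have q_in: "cone_q Y r k x \<in> gcarrier (symp_cone Y r) k" if "x \<in> gcarrier (symp_cone Y (Suc r)) k" for k x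
    using cdga_homD(2)[OF cone_q_hom[OF Y] that] .
  have f_in: "cone_pullback X Y f (Suc r) k x \<in> gcarrier (symp_cone X (Suc r)) k"
    if "x \<in> gcarrier (symp_cone Y (Suc r)) k" for k x
    using cdga_homD(2)[OF cone_pullback_hom that] .
  have "cone_pullback X Y f r k (cone_q Y r k x) = cone_q X r k (cone_pullback X Y f (Suc r) k x)"
    if x: "x \<in> gcarrier (symp_cone Y (Suc r)) k" for k x
  proof -
    obtain a b where ab: "x = (a, b)" by (cases x)
    then have b: "b \<in> Omega Y (k - (2 * int (Suc r) + 1))"
      using x unfolding gcarrier_symp_cone[OF Y] by simp
    have 1: "cone_q Y r k x = (a, wedge b (sform Y))" using x by (simp add: cone_q_def ab)
    have 2: "cone_pullback X Y f (Suc r) k x = (pullback X Y f a, pullback X Y f b)"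
      using x by (simp add: cone_pullback_def ab)
    have "cone_pullback X Y f r k (a, wedge b (sform Y)) = (pullback X Y f a, pullback X Y f (wedge b (sform Y)))"
      using q_in[OF x] unfolding 1 by (simp add: cone_pullback_def)
    also have "\<dots> = cone_q X r k (pullback X Y f a, pullback X Y f b)"
      using f_in[OF x] wedge[OF b] unfolding 2 by (simp add: cone_q_def)
    finally show ?thesis by (simp only: 1 2)
  qed
  then show ?thesis by (auto simp: fun_eq_iff compose_def)
qed

lemma cone_pullback_cone_q_iter:
  "Comp cdga_cat (symp_cone Y (b + j)) (symp_cone Y b) (symp_cone X b) (cone_pullback X Y f b) (cone_q_iter Y b j)
   = Comp cdga_cat (symp_cone Y (b + j)) (symp_cone X (b + j)) (symp_cone X b) (cone_q_iter X b j)
       (cone_pullback X Y f (b + j))"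
proof (induction j)
  case 0
  show ?case
    using is_category.Comp_Idn_right[OF is_category_cdga_cat, of "symp_cone Y b" "symp_cone X b" "cone_pullback X Y f b"]
      is_category.Comp_Idn_left[OF is_category_cdga_cat, of "symp_cone Y b" "symp_cone X b" "cone_pullback X Y f b"]
      is_cdga_symp_cone[OF X] is_cdga_symp_cone[OF Y] cone_pullback_hom[of b]
    by (simp only: cone_q_iter.simps cdga_cat_simps mem_Collect_eq add_0_right)
next
  case (Suc j)
  let ?C = "Comp cdga_cat" and ?X = "symp_cone X" and ?Y = "symp_cone Y" and ?f = "cone_pullback X Y f"
  let ?n = "b + j"
  note assoc = is_category.Comp_assoc[OF is_category_cdga_cat]
  note homs = cdga_cat_simps mem_Collect_eq is_cdga_symp_cone[OF X] is_cdga_symp_cone[OF Y] cone_q_hom[OF X] cone_q_hom[OF Y] cone_q_iter_hom[OF X] cone_q_iter_hom[OF Y] cone_pullback_hom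
  have "?C (?Y (Suc ?n)) (?Y b) (?X b) (?f b) (?C (?Y (Suc ?n)) (?Y ?n) (?Y b) (cone_q_iter Y b j) (cone_q Y ?n))
      = ?C (?Y (Suc ?n)) (?Y ?n) (?X b) (?C (?Y ?n) (?Y b) (?X b) (?f b) (cone_q_iter Y b j)) (cone_q Y ?n)"
    by (rule assoc) (simp_all only: homs)
  also have "\<dots> = ?C (?Y (Suc ?n)) (?Y ?n) (?X b) (?C (?Y ?n) (?X ?n) (?X b) (cone_q_iter X b j) (?f ?n)) (cone_q Y ?n)"
    by (simp only: Suc.IH)
  also have "\<dots> = ?C (?Y (Suc ?n)) (?X ?n) (?X b) (cone_q_iter X b j) (?C (?Y (Suc ?n)) (?Y ?n) (?X ?n) (?f ?n) (cone_q Y ?n))"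
    by (rule assoc[symmetric]) (simp_all only: homs)
  also have "\<dots> = ?C (?Y (Suc ?n)) (?X ?n) (?X b) (cone_q_iter X b j)
      (?C (?Y (Suc ?n)) (?X (Suc ?n)) (?X ?n) (cone_q X ?n) (?f (Suc ?n)))"
    by (simp only: cone_pullback_cone_q)
  also have "\<dots> = ?C (?Y (Suc ?n)) (?X (Suc ?n)) (?X b)
      (?C (?X (Suc ?n)) (?X ?n) (?X b) (cone_q_iter X b j) (cone_q X ?n)) (?f (Suc ?n))"
    by (rule assoc) (simp_all only: homs)
  finally show ?case by (simp only: cone_q_iter.simps add_Suc_right)
qed

lemma cone_pullback_nat_trans:
  "nat_trans (op_cat poset_cat) cdga_cat (cone_tower Y) (cone_tower X) (cone_pullback X Y f)"
  unfolding nat_trans_def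
proof (intro conjI ballI)
  show "cone_pullback X Y f \<in> (\<Pi>\<^sub>E a\<in>Obj (op_cat poset_cat).
      Hom cdga_cat (Fobj (cone_tower Y) a) (Fobj (cone_tower X) a))"
    using cone_pullback_hom by (simp add: cone_tower_def poset_cat_def PiE_iff)
  fix a b :: nat and u :: unit assume "u \<in> Hom (op_cat poset_cat) a b"
  then have "b \<le> a" by (simp add: poset_cat_def split: if_splits)
  then show "Comp cdga_cat (Fobj (cone_tower Y) a) (Fobj (cone_tower Y) b) (Fobj (cone_tower X) b)
        (cone_pullback X Y f b) (Fmor (cone_tower Y) a b u)
      = Comp cdga_cat (Fobj (cone_tower Y) a) (Fobj (cone_tower X) a) (Fobj (cone_tower X) b)
        (Fmor (cone_tower X) a b u) (cone_pullback X Y f a)"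
    using cone_pullback_cone_q_iter[of b "a - b"]
    by (simp add: cone_tower_def poset_cat_def del: cdga_cat_simps)
qed

end

lemma cone_pullback_id:
  assumes X: "is_symplectic X"
  shows "cone_pullback X X (\<lambda>p\<in>topspace (mtop X). p) p = Idn cdga_cat (symp_cone X p)"
  using pullback_id[OF symplecticD(1)[OF X]]
  by (auto simp: cone_pullback_def gcarrier_symp_cone[OF X] fun_eq_iff)

lemma cone_pullback_compose:
  assumes X: "is_symplectic X" and Y: "is_symplectic Y" and Z: "is_symplectic Z"
    and f: "smooth_map X Y f" and g: "smooth_map Y Z g"
  shows "cone_pullback X Z (compose (topspace (mtop X)) g f) p
    = Comp cdga_cat (symp_cone Z p) (symp_cone Y p) (symp_cone X p) (cone_pullback X Y f p) (cone_pullback Y Z g p)"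
  using pullback_compose[OF symplecticD(1)[OF X] symplecticD(1)[OF Y] symplecticD(1)[OF Z] f g]
    pullback_Omega[OF symplecticD(1)[OF Y] symplecticD(1)[OF Z] g]
  by (auto simp: cone_pullback_def gcarrier_symp_cone[OF Y] gcarrier_symp_cone[OF Z] fun_eq_iff compose_def)

theorem proposition6p7:
  shows "is_functor
    (op_cat (symp_cat :: ('a symplectic_manifold, 'a \<Rightarrow> 'a) category))
    (fun_cat
      (op_cat (poset_cat :: (nat, unit) category))
      (cdga_cat :: (('a form \<times> 'a form) graded_algebra,
                    int \<Rightarrow> 'a form \<times> 'a form \<Rightarrow> 'a form \<times> 'a form) category))
    cone_functor"
proof (intro is_functor.intro is_functor_axioms.intro is_category_op_cat is_category_fun_cat
    is_category_symp_cat is_category_poset_cat is_category_cdga_cat, goal_cases)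
  case (1 X)
  then show ?case using cone_tower_functor[of X] by (simp add: cone_functor_def)
next
  case (2 Y X f)
  then show ?case using cone_pullback_nat_trans[of X Y f] by (simp add: cone_functor_def)
next
  case (3 X)
  then show ?case
    using cone_pullback_id[of X]
    by (simp add: cone_functor_def cone_tower_def poset_cat_def fun_eq_iff del: cdga_cat_simps)
next
  case (4 Z Y X g f)
  then show ?case
    using cone_pullback_compose[of X Y Z f g]
    by (simp add: cone_functor_def cone_tower_def poset_cat_def fun_eq_iff del: cdga_cat_simps)
qed

end
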